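(* Fix $B<0$ and $\delta\in[0,1)$. Assume the outcomes $(Y_{i,t}(0),Y_{i,t}(1))_{i,t}$ are generated by the conjugate Gaussian model described in the context. Then the experiment whose treatment group sizes $m_t$ are produced by the algorithm described in the context is $(\delta,B)$-RRC.
   Context: Setting. At stages $t=1,2,\dots,T$ ($T$ not necessarily fixed) there is a set $\mathcal N_t$ of $N_t$ units ($N_t$ known). Before stage $t$ a size $m_t$ is chosen on the basis of past observations, and a treatment group $\mathcal T_t\subseteq\mathcal N_t$ with $|\mathcal T_t|=m_t$ is chosen at random; $\mathcal C_t=\mathcal N_t\setminus\mathcal T_t$ is the control group, and $W_{i,t}=1$ if $i\in\mathcal T_t$, $W_{i,t}=0$ otherwise. Unit $i\in\mathcal N_t$ has potential outcomes $Y_{i,t}(0),Y_{i,t}(1)\in\mathbb R$ and only $Y_{i,t}(W_{i,t})$ is observed. The cost of stage $t$ is $r_t=\sum_{i\in\mathcal T_t}(Y_{i,t}(1)-Y_{i,t}(0))$ ($=0$ if $\mathcal T_t=\emptyset$) and $R_t=\sum_{k\le t}r_k$. An experiment running for $T$ stages that selects the size of $\mathcal T_t$ before stage $t$ is $(\delta,B)$-RRC (risk-of-ruin-constrained) if $\mathbb P(R_T>B)\ge1-\delta$. Conjugate Gaussian model. The unknown parameters $\mu_{\rm true}(0),\mu_{\rm true}(1)$ are independent with prior $\mu_{\rm true}(w)\sim N(\mu_0(w),\sigma_0(w)^2)$, $w=0,1$, and given these, the pairs $(Y_{i,t}(0),Y_{i,t}(1))$ are i.i.d. over $(i,t)$,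 Gaussian with mean $(\mu_{\rm true}(0),\mu_{\rm true}(1))$ and diagonal covariance matrix with diagonal entries $\sigma(0)^2,\sigma(1)^2$. Here $\mu_0(w)\in\mathbb R$, $\sigma_0(w)^2>0$, $\sigma(w)^2>0$ are hyperparameters. Statistics. $s^{\mathcal T}_t(w)=\sum_{i\in\mathcal T_t}Y_{i,t}(w)$, $S^{\mathcal T}_t(w)=\sum_{k\le t}s^{\mathcal T}_k(w)$, $s^{\mathcal C}_t(w)=\sum_{i\in\mathcal C_t}Y_{i,t}(w)$, $S^{\mathcal C}_t(w)=\sum_{k\le t}s^{\mathcal C}_k(w)$, $M_t^{(1)}=\sum_{k\le t}m_k$, $M_t^{(0)}=\sum_{k\le t}(N_k-m_k)$ (all $0$ for $t=0$). For $t\ge1$: $$\sigma_{p,t}(w)^2=\Big(\tfrac1{\sigma_0(w)^2}+\tfrac{M^{(w)}_{t-1}}{\sigma(w)^2}\Big)^{-1},$$ $$\mu_{p,t}(0)=\sigma_{p,t}(0)^2\Big(\tfrac{\mu_0(0)}{\sigma_0(0)^2}+\tfrac{S^{\mathcal C}_{t-1}(0)}{\sigma(0)^2}\Big),\quad \mu_{p,t}(1)=\sigma_{p,t}(1)^2\Big(\tfrac{\mu_0(1)}{\sigma_0(1)^2}+\tfrac{S^{\mathcal T}_{t-1}(1)}{\sigma(1)^2}\Big),$$ $$\tilde\mu_t(m)=\mu_{p,t}(1)\,m-\mu_{p,t}(0)\,(m+M^{(1)}_{t-1}),$$ $$\tilde\sigma_t^2(m)=m^2\sigma_{p,t}(1)^2+m\,\sigma(1)^2+(m+M^{(1)}_{t-1})^2\sigma_{p,t}(0)^2+(m+M^{(1)}_{t-1})\,\sigma(0)^2,\qquad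 \tilde\sigma_t(m)=\sqrt{\tilde\sigma_t^2(m)}.$$ $\Phi$ is the standard normal CDF. Algorithm. Input $B<0$, $\delta\in[0,1)$. Start with $t=1$. While $\prod_{k=1}^{t-1}(1-\Delta_k)>1-\delta$ (the empty product is $1$), do the following at stage $t$. 1. Choose $\Delta_t\in\big[0,\,1-\tfrac{1-\delta}{\prod_{k=1}^{t-1}(1-\Delta_k)}\big]$ and $b_t\ge B$. 2. Estimate the data variances $\sigma(w)^2$, $w=0,1$, if they are unknown: for $t\ge2$, use the sample variance (denominator $M_{t-1}^{(w)}-1$) of the outcomes observed in stages $1,\dots,t-1$ in the control groups (for $w=0$) and in the treatment groups (for $w=1$); for $t=1$, use some prior estimate. These values are used as $\sigma(w)^2$ in the formulas of stage $t$. 3. Compute $\mu_{p,t}(w),\sigma_{p,t}(w)^2$ for $w=0,1$, $q_t=\Phi^{-1}(\Delta_t)$, and $A_t=q_t^2(\sigma_{p,t}(1)^2+\sigma_{p,t}(0)^2)-(\mu_{p,t}(1)-\mu_{p,t}(0))^2$, $B_t=q_t^2(\sigma(1)^2+\sigma(0)^2+2\sigma_{p,t}(0)^2M^{(1)}_{t-1})+2(b_t-S^{\mathcal T}_{t-1}(1)+\mu_{p,t}(0)M^{(1)}_{t-1})(\mu_{p,t}(1)-\mu_{p,t}(0))$, $C_t=q_t^2\sigma_{p,t}(0)^2(M^{(1)}_{t-1})^2+q_t^2\sigma(0)^2M^{(1)}_{t-1}-(b_t-S^{\mathcal T}_{t-1}(1)+\mu_{p,t}(0)M^{(1)}_{t-1})^2$.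 4. If $\dfrac{b_t-S^{\mathcal T}_{t-1}(1)-\tilde\mu_t(\lfloor N_t/2\rfloor)}{\tilde\sigma_t(\lfloor N_t/2\rfloor)}\le q_t$, set $m_t=\lfloor N_t/2\rfloor$. Else, if $B_t^2-4A_tC_t<0$, set $m_t=0$. Else let $\mathcal M_t=\Big\{\Big\lfloor\tfrac{-B_t+\sqrt{B_t^2-4A_tC_t}}{2A_t}\Big\rfloor,\Big\lfloor\tfrac{-B_t-\sqrt{B_t^2-4A_tC_t}}{2A_t}\Big\rfloor\Big\}$ and $\mathcal V_t=\Big\{m\in\mathcal M_t\cap[0,\tfrac{N_t}2]:\ \tfrac{b_t-S^{\mathcal T}_{t-1}(1)-\tilde\mu_t(m)}{\tilde\sigma_t(m)}\le q_t\Big\}$; set $m_t=\max\mathcal V_t$ if $\mathcal V_t\ne\emptyset$ and $m_t=0$ otherwise. 5. Output $m_t$, run stage $t$ with treatment group size $m_t$, observe $s^{\mathcal T}_t(1)$ and $s^{\mathcal C}_t(0)$, update $M_t^{(0)},M_t^{(1)},S^{\mathcal T}_t(1),S^{\mathcal C}_t(0)$, and replace $t$ by $t+1$. $T$ is the number of stages run.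
   Formalization: The data variances σ(w)² are taken as known, so step 2 (estimating unknown variances) is omitted; with an arbitrary prior estimate at stage 1 that is far too small, the algorithm can treat too many units and the (δ,B)-RRC bound fails. *)

theory Defs
  imports "HOL-Probability.Probability"
begin

text \<open>
  The index \<open>w \<in> {0,1}\<close> is a \<open>bool\<close>: \<open>False\<close> is control (\<open>w = 0\<close>), \<open>True\<close> is treatment (\<open>w = 1\<close>).
  Sample points are \<open>\<omega>\<close>; \<open>\<N> t\<close> is the set of units of stage \<open>t \<ge> 1\<close>, \<open>\<T> t \<omega>\<close> its treatment group,
  \<open>Y i t w \<omega>\<close> the potential outcome of unit \<open>i\<close> at stage \<open>t\<close> under \<open>w\<close>.
  The hyperparameters \<open>\<sigma>0 w\<close> and \<open>\<sigma> w\<close> are standard deviations.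
\<close>

section \<open>Costs and the risk-of-ruin constraint\<close>

definition stage_cost ::
  "(nat \<Rightarrow> 'a \<Rightarrow> 'u set) \<Rightarrow> ('u \<Rightarrow> nat \<Rightarrow> bool \<Rightarrow> 'a \<Rightarrow> real) \<Rightarrow> nat \<Rightarrow> 'a \<Rightarrow> real" where
  "stage_cost \<T> Y t \<omega> = (\<Sum>i\<in>\<T> t \<omega>. Y i t True \<omega> - Y i t False \<omega>)"

definition total_cost ::
  "(nat \<Rightarrow> 'a \<Rightarrow> 'u set) \<Rightarrow> ('u \<Rightarrow> nat \<Rightarrow> bool \<Rightarrow> 'a \<Rightarrow> real) \<Rightarrow> nat \<Rightarrow> 'a \<Rightarrow> real" where
  "total_cost \<T> Y t \<omega> = (\<Sum>k=1..t. stage_cost \<T> Y k \<omega>)"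

definition RRC ::
  "'a measure \<Rightarrow> (nat \<Rightarrow> 'a \<Rightarrow> 'u set) \<Rightarrow> ('u \<Rightarrow> nat \<Rightarrow> bool \<Rightarrow> 'a \<Rightarrow> real) \<Rightarrow> ('a \<Rightarrow> nat)
    \<Rightarrow> real \<Rightarrow> real \<Rightarrow> bool" where
  "RRC M \<T> Y T \<delta> B \<longleftrightarrow> measure M {\<omega> \<in> space M. total_cost \<T> Y (T \<omega>) \<omega> > B} \<ge> 1 - \<delta>"


section \<open>The conjugate Gaussian model\<close>

definition param_events :: "'a measure \<Rightarrow> (bool \<Rightarrow> 'a \<Rightarrow> real) \<Rightarrow> 'a set set" where
  "param_events M \<theta> = {\<theta> w -` E \<inter> space M | w E. E \<in> sets borel}"

definition diag_gaussian :: "(bool \<Rightarrow> real) \<Rightarrow> (bool \<Rightarrow> real) \<Rightarrow> (real \<times> real) measure" where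
  "diag_gaussian \<mu> \<sigma> =
     density lborel (normal_density (\<mu> False) (\<sigma> False)) \<Otimes>\<^sub>M
     density lborel (normal_density (\<mu> True) (\<sigma> True))"

text \<open>
  \<open>\<theta> w\<close> is the random parameter \<open>\<mu>\<^sub>t\<^sub>r\<^sub>u\<^sub>e(w)\<close>. The last conjunct says that, conditionally on the \<open>\<sigma>\<close>-algebra
  of the parameters, the pairs \<open>(Y i t False, Y i t True)\<close> are i.i.d. with law \<open>diag_gaussian \<theta> \<sigma>\<close>.
\<close>

definition conjugate_gaussian_model ::
  "'a measure \<Rightarrow> (nat \<Rightarrow> 'u set) \<Rightarrow> (bool \<Rightarrow> real) \<Rightarrow> (bool \<Rightarrow> real) \<Rightarrow> (bool \<Rightarrow> real)
    \<Rightarrow> (bool \<Rightarrow> 'a \<Rightarrow> real) \<Rightarrow> ('u \<Rightarrow> nat \<Rightarrow> bool \<Rightarrow> 'a \<Rightarrow> real) \<Rightarrow> bool" where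
  "conjugate_gaussian_model M \<N> \<mu>0 \<sigma>0 \<sigma> \<theta> Y \<longleftrightarrow>
     (\<forall>w. distributed M lborel (\<theta> w) (normal_density (\<mu>0 w) (\<sigma>0 w))) \<and>
     prob_space.indep_var M borel (\<theta> False) borel (\<theta> True) \<and>
     (\<forall>t\<ge>1. \<forall>i\<in>\<N> t. \<forall>w. Y i t w \<in> borel_measurable M) \<and>
     (\<forall>J E. finite J \<and> J \<subseteq> {(i, t). 1 \<le> t \<and> i \<in> \<N> t} \<and> (\<forall>j\<in>J. E j \<in> sets borel) \<longrightarrow>
        (AE \<omega> in M.
           real_cond_exp M (sigma (space M) (param_events M \<theta>))
             (indicator {\<omega> \<in> space M. \<forall>(i, t)\<in>J. (Y i t False \<omega>, Y i t True \<omega>) \<in> E (i, t)}) \<omega>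
           = (\<Prod>j\<in>J. measure (diag_gaussian (\<lambda>w. \<theta> w \<omega>) \<sigma>) (E j))))"


section \<open>Observations and random assignment\<close>

definition outcome_events ::
  "'a measure \<Rightarrow> (nat \<Rightarrow> 'u set) \<Rightarrow> ('u \<Rightarrow> nat \<Rightarrow> bool \<Rightarrow> 'a \<Rightarrow> real) \<Rightarrow> 'a set set" where
  "outcome_events M \<N> Y =
     {Y i k w -` E \<inter> space M | i k w E. 1 \<le> k \<and> i \<in> \<N> k \<and> E \<in> sets borel}"

definition assignment_events ::
  "'a measure \<Rightarrow> (nat \<Rightarrow> 'a \<Rightarrow> 'u set) \<Rightarrow> nat \<Rightarrow> 'a set set" where
  "assignment_events M \<T> t = {\<T> k -` {A} \<inter> space M | k A. 1 \<le> k \<and> k \<le> t}"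

definition observed_outcome_events ::
  "'a measure \<Rightarrow> (nat \<Rightarrow> 'u set) \<Rightarrow> (nat \<Rightarrow> 'a \<Rightarrow> 'u set) \<Rightarrow> ('u \<Rightarrow> nat \<Rightarrow> bool \<Rightarrow> 'a \<Rightarrow> real)
    \<Rightarrow> nat \<Rightarrow> 'a set set" where
  "observed_outcome_events M \<N> \<T> Y t =
     {(\<lambda>\<omega>. Y i k (i \<in> \<T> k \<omega>) \<omega>) -` E \<inter> space M | i k E.
        1 \<le> k \<and> k \<le> t \<and> i \<in> \<N> k \<and> E \<in> sets borel}"

definition observed ::
  "'a measure \<Rightarrow> (nat \<Rightarrow> 'u set) \<Rightarrow> (nat \<Rightarrow> 'a \<Rightarrow> 'u set) \<Rightarrow> ('u \<Rightarrow> nat \<Rightarrow> bool \<Rightarrow> 'a \<Rightarrow> real)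
    \<Rightarrow> nat \<Rightarrow> 'a measure" where
  "observed M \<N> \<T> Y t =
     sigma (space M) (assignment_events M \<T> t \<union> observed_outcome_events M \<N> \<T> Y t)"

text \<open>
  At every stage \<open>t\<close> that is run (\<open>t \<le> T\<close>), \<open>\<T> t\<close> is uniform among the subsets of \<open>\<N> t\<close> of size \<open>m t\<close>,
  conditionally on the parameters, all potential outcomes (past, present and future) and the
  earlier assignments.
\<close>

definition random_assignment ::
  "'a measure \<Rightarrow> (nat \<Rightarrow> 'u set) \<Rightarrow> (bool \<Rightarrow> 'a \<Rightarrow> real) \<Rightarrow> ('u \<Rightarrow> nat \<Rightarrow> bool \<Rightarrow> 'a \<Rightarrow> real)
    \<Rightarrow> (nat \<Rightarrow> 'a \<Rightarrow> nat) \<Rightarrow> (nat \<Rightarrow> 'a \<Rightarrow> 'u set) \<Rightarrow> ('a \<Rightarrow> nat) \<Rightarrow> bool" where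
  "random_assignment M \<N> \<theta> Y m \<T> T \<longleftrightarrow>
     (\<forall>t\<ge>1. \<T> t \<in> measurable M (count_space (Pow (\<N> t)))) \<and>
     (\<forall>\<omega>\<in>space M. \<forall>t\<in>{1..T \<omega>}. card (\<T> t \<omega>) = m t \<omega>) \<and>
     (\<forall>t\<ge>1. \<forall>A\<subseteq>\<N> t. AE \<omega> in M. t \<le> T \<omega> \<longrightarrow>
        real_cond_exp M
          (sigma (space M)
             (param_events M \<theta> \<union> outcome_events M \<N> Y \<union> assignment_events M \<T> (t - 1)))
          (indicator {\<omega> \<in> space M. \<T> t \<omega> = A}) \<omega>
        = (if card A = m t \<omega> then 1 / real (card (\<N> t) choose m t \<omega>) else 0))"


section \<open>Statistics\<close>

text \<open>\<open>observed_sum \<N> \<T> Y True t\<close> is \<open>S\<^sup>\<T>\<^sub>t(1)\<close> and \<open>observed_sum \<N> \<T> Y False t\<close> is \<open>S\<^sup>\<C>\<^sub>t(0)\<close>.\<close>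

definition observed_sum ::
  "(nat \<Rightarrow> 'u set) \<Rightarrow> (nat \<Rightarrow> 'a \<Rightarrow> 'u set) \<Rightarrow> ('u \<Rightarrow> nat \<Rightarrow> bool \<Rightarrow> 'a \<Rightarrow> real)
    \<Rightarrow> bool \<Rightarrow> nat \<Rightarrow> 'a \<Rightarrow> real" where
  "observed_sum \<N> \<T> Y w t \<omega> =
     (\<Sum>k=1..t. \<Sum>i\<in>(if w then \<T> k \<omega> else \<N> k - \<T> k \<omega>). Y i k w \<omega>)"

text \<open>\<open>M\<^sup>(\<^sup>w\<^sup>)\<^sub>t\<close>, for stage sizes \<open>N\<close> and treatment sizes \<open>m\<close>.\<close>

definition cum_size :: "(nat \<Rightarrow> nat) \<Rightarrow> (nat \<Rightarrow> nat) \<Rightarrow> bool \<Rightarrow> nat \<Rightarrow> real" where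
  "cum_size N m w t = (\<Sum>k=1..t. if w then real (m k) else real (N k) - real (m k))"

definition post_var :: "real \<Rightarrow> real \<Rightarrow> real \<Rightarrow> real" where
  "post_var s0 s n = inverse (1 / s0\<^sup>2 + n / s\<^sup>2)"

definition post_mean :: "real \<Rightarrow> real \<Rightarrow> real \<Rightarrow> real \<Rightarrow> real \<Rightarrow> real" where
  "post_mean m0 s0 s n S = post_var s0 s n * (m0 / s0\<^sup>2 + S / s\<^sup>2)"


section \<open>The algorithm\<close>

text \<open>
  Below, \<open>p w\<close> and \<open>v w\<close> stand for \<open>\<mu>\<^sub>p\<^sub>,\<^sub>t(w)\<close> and \<open>\<sigma>\<^sub>p\<^sub>,\<^sub>t(w)\<^sup>2\<close>, \<open>M1\<close> for \<open>M\<^sup>(\<^sup>1\<^sup>)\<close> at stage \<open>t-1\<close>,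
  and \<open>S1\<close> for \<open>S\<^sup>\<T>(1)\<close> at stage \<open>t-1\<close>.
\<close>

definition mu_tilde :: "(bool \<Rightarrow> real) \<Rightarrow> real \<Rightarrow> real \<Rightarrow> real" where
  "mu_tilde p M1 m = p True * m - p False * (m + M1)"

definition sigma_tilde :: "(bool \<Rightarrow> real) \<Rightarrow> (bool \<Rightarrow> real) \<Rightarrow> real \<Rightarrow> real \<Rightarrow> real" where
  "sigma_tilde v \<sigma> M1 m =
     sqrt (m\<^sup>2 * v True + m * (\<sigma> True)\<^sup>2 + (m + M1)\<^sup>2 * v False + (m + M1) * (\<sigma> False)\<^sup>2)"

definition Phi :: "real \<Rightarrow> real" where
  "Phi = cdf (density lborel std_normal_density)"

text \<open>
  Conventions in degenerate cases. For \<open>\<Delta> = 0\<close> the quantile is \<open>-\<infinity>\<close>, the test of step 4 fails for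
  every \<open>m > 0\<close>, and the size is \<open>0\<close>. If \<open>A = 0\<close> the roots are not defined; division by zero yields the
  single candidate \<open>0\<close>. If \<open>sigma_tilde\<close> vanishes then \<open>m = 0\<close>, and the size is \<open>0\<close> whatever the test says.
\<close>

definition treatment_size ::
  "nat \<Rightarrow> real \<Rightarrow> real \<Rightarrow> (bool \<Rightarrow> real) \<Rightarrow> (bool \<Rightarrow> real) \<Rightarrow> (bool \<Rightarrow> real) \<Rightarrow> real \<Rightarrow> real \<Rightarrow> nat" where
  "treatment_size N \<Delta> b p v \<sigma> M1 S1 =
     (let q = inv Phi \<Delta>;
          A = q\<^sup>2 * (v True + v False) - (p True - p False)\<^sup>2;
          B = q\<^sup>2 * ((\<sigma> True)\<^sup>2 + (\<sigma> False)\<^sup>2 + 2 * v False * M1)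
                + 2 * (b - S1 + p False * M1) * (p True - p False);
          C = q\<^sup>2 * v False * M1\<^sup>2 + q\<^sup>2 * (\<sigma> False)\<^sup>2 * M1 - (b - S1 + p False * M1)\<^sup>2;
          D = B\<^sup>2 - 4 * A * C;
          ok = (\<lambda>m::real. (b - S1 - mu_tilde p M1 m) / sigma_tilde v \<sigma> M1 m \<le> q);
          candidates = {\<lfloor>(- B + sqrt D) / (2 * A)\<rfloor>, \<lfloor>(- B - sqrt D) / (2 * A)\<rfloor>};
          V = {m \<in> candidates. 0 \<le> m \<and> real_of_int m \<le> real N / 2 \<and> ok (real_of_int m)}
      in if \<Delta> = 0 then 0
         else if ok (real (N div 2)) then N div 2
         else if D < 0 then 0
         else if V \<noteq> {} then nat (Max V)
         else 0)"

text \<open>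
  One run of the algorithm through \<open>T\<close> stages, with budget choices \<open>\<Delta>\<close>, \<open>b\<close>, treatment sizes \<open>m\<close> and
  observed sums \<open>S w t\<close> (see \<open>observed_sum\<close>). The data variances \<open>\<sigma>\<^sup>2\<close> are known, so they are not estimated.
  No stage is run once the loop condition fails; an experiment may also be ended earlier.
\<close>

definition algorithm_run ::
  "real \<Rightarrow> real \<Rightarrow> (bool \<Rightarrow> real) \<Rightarrow> (bool \<Rightarrow> real) \<Rightarrow> (bool \<Rightarrow> real) \<Rightarrow> (nat \<Rightarrow> nat)
    \<Rightarrow> (nat \<Rightarrow> real) \<Rightarrow> (nat \<Rightarrow> real) \<Rightarrow> (nat \<Rightarrow> nat) \<Rightarrow> (bool \<Rightarrow> nat \<Rightarrow> real) \<Rightarrow> nat \<Rightarrow> bool" where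
  "algorithm_run B \<delta> \<mu>0 \<sigma>0 \<sigma> N \<Delta> b m S T \<longleftrightarrow>
     (\<forall>t\<in>{1..T}.
        (\<Prod>k=1..<t. 1 - \<Delta> k) > 1 - \<delta> \<and>
        \<Delta> t \<in> {0..1 - (1 - \<delta>) / (\<Prod>k=1..<t. 1 - \<Delta> k)} \<and>
        b t \<ge> B \<and>
        m t = treatment_size (N t) (\<Delta> t) (b t)
                (\<lambda>w. post_mean (\<mu>0 w) (\<sigma>0 w) (\<sigma> w) (cum_size N m w (t - 1)) (S w (t - 1)))
                (\<lambda>w. post_var (\<sigma>0 w) (\<sigma> w) (cum_size N m w (t - 1)))
                \<sigma> (cum_size N m True (t - 1)) (S True (t - 1)))"

end

theory Submission
  imports Defs
begin

text \<open>
  Let \<open>Q\<^sub>t = (1 - \<Delta>\<^sub>1) \<cdots> (1 - \<Delta>\<^sub>t)\<close>; the choice of \<open>\<Delta>\<^sub>t\<close> keeps \<open>Q\<^sub>t \<ge> 1 - \<delta>\<close>. The indicator of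
  \<open>R\<^sub>t > B\<close> divided by \<open>Q\<^sub>t\<close> starts at \<open>1\<close> and has nonnegative conditional increments given the
  observations before the stage: if \<open>m\<^sub>t = 0\<close> the cost does not move and \<open>Q\<^sub>t\<close> decreases, and if \<open>m\<^sub>t > 0\<close> then
  \<open>R\<^sub>t \<le> B\<close> has conditional probability at most \<open>\<Delta>\<^sub>t\<close>, so that the mean of the new value is at least
  \<open>(1 - \<Delta>\<^sub>t) / Q\<^sub>t = 1 / Q\<^sub>t\<^sub>-\<^sub>1\<close>. Stopping at \<open>min T n\<close> and letting \<open>n\<close> tend to infinity gives the bound.

  The conditional probability is computed for a fixed history of assignments. Along such a history the
  observed outcomes form a vector whose coordinates do not depend on the assignment; the errors of the
  posterior means are Gaussian and independent of this vector, and so is the noise of the unobserved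
  outcomes. Since the assignment probabilities depend on the past only through the observations,
  conditioning on the history does not change the law of the unobserved part.
\<close>

section \<open>Preliminaries on independence and the normal distribution\<close>

text \<open>Ruin is never observed: \<open>R\<^sub>t\<close> contains the control outcomes of all
  treated units, past and present. The indicator of \<open>R\<^sub>t > B\<close> is therefore not
  adapted to the observations, and no stage can condition on whether the budget is already
  overspent. Each stage with a nonempty group predicts the whole of \<open>R\<^sub>t\<close> anew
  instead of its increment; this is the origin of the \<open>m + M1\<close> control terms in
  \<open>sigma_tilde\<close>, and it allows the old indicator to be bounded by 1. The increments are
  integrated over observable events and weighted by \<open>1 / Q\<^sub>t\<close>, a weight known
  before stage \<open>t\<close>. The second obstacle is selection: group sizes react to the data, so
  a realised history is itself informative and the data restricted to it are no longer Gaussian. The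
  Gaussian computations are therefore made for deterministic arms on the whole space, where
  everything is a function of independent residuals; what is carried over to a history is only an
  identity of mean zero on every data event.\<close>

lemma measure_eqI_pair_PiM:
  assumes I: "finite I"
    and sets: "sets M1 = sets (N \<Otimes>\<^sub>M PiM I K)" "sets M2 = sets (N \<Otimes>\<^sub>M PiM I K)"
    and fin: "emeasure M1 (space M1) \<noteq> \<infinity>"
    and eq: "\<And>A E. A \<in> sets N \<Longrightarrow> (\<And>i. i \<in> I \<Longrightarrow> E i \<in> sets (K i)) \<Longrightarrow>
      emeasure M1 (A \<times> PiE I E) = emeasure M2 (A \<times> PiE I E)"
  shows "M1 = M2"
proof -
  \<comment> \<open>For finite \<open>I\<close> the members of \<open>prod_algebra I K\<close> are
    exactly the boxes \<open>PiE I E\<close>, so the generator consists of the sets on which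
    agreement is assumed.\<close>
  define G where "G = {A \<times> B |A B. A \<in> sets N \<and> B \<in> prod_algebra I K}"
  have alg: "prod_algebra I K = {PiE I E |E. E \<in> (\<Pi> i\<in>I. sets (K i))}"
    using prod_algebra_eq_finite[OF I, of K] by simp
  have sub: "prod_algebra I K \<subseteq> Pow (space (PiM I K))"
    unfolding space_PiM by (rule prod_algebra_sets_into_space)
  have top: "space (PiM I K) \<in> prod_algebra I K"
    unfolding space_PiM alg by auto
  have gen: "sets (N \<Otimes>\<^sub>M PiM I K) = sigma_sets (space N \<times> space (PiM I K)) G"
  proof -
    have "sets (N \<Otimes>\<^sub>M PiM I K) = sets (sigma (space N \<times> space (PiM I K)) G)"
      unfolding G_def
    proof (rule sets_pair_eq[where Ca="{space N}" and Cb="{space (PiM I K)}"])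
      show "sets N = sigma_sets (space N) (sets N)"
        by (simp add: sets.sigma_sets_eq)
    qed (use sub top sets.space_closed[of N] in \<open>auto simp: sets_PiM space_PiM\<close>)
    also have "\<dots> = sigma_sets (space N \<times> space (PiM I K)) G"
      by (rule sets_measure_of) (use sub sets.space_closed[of N] in \<open>auto simp: G_def\<close>)
    finally show ?thesis .
  qed
  have sp: "space M1 = space N \<times> space (PiM I K)"
    using sets_eq_imp_space_eq[OF sets(1)] by (simp add: space_pair_measure)
  show ?thesis
  proof (rule measure_eqI_generator_eq[where E=G and \<Omega>="space N \<times> space (PiM I K)"
        and A="\<lambda>_. space N \<times> space (PiM I K)"])
    show "Int_stable G"
    proof (rule Int_stableI)
      fix a b assume "a \<in> G" "b \<in> G"
      then obtain A B C D where "a = A \<times> B" "b = C \<times> D" "A \<in> sets N" "C \<in> sets N"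
        "B \<in> prod_algebra I K" "D \<in> prod_algebra I K"
        by (auto simp: G_def)
      moreover from this have "B \<inter> D \<in> prod_algebra I K"
        using Int_stable_prod_algebra[of I K] by (auto simp: Int_stable_def)
      ultimately show "a \<inter> b \<in> G"
        unfolding G_def Times_Int_Times by (auto simp: Times_Int_Times)
    qed
    show "G \<subseteq> Pow (space N \<times> space (PiM I K))"
      using sub sets.space_closed[of N] by (auto simp: G_def)
    show "emeasure M1 X = emeasure M2 X" if "X \<in> G" for X
      using that unfolding G_def alg by (auto intro!: eq)
    show "range (\<lambda>_::nat. space N \<times> space (PiM I K)) \<subseteq> G"
      using top by (auto simp: G_def)
    show "emeasure M1 (space N \<times> space (PiM I K)) \<noteq> \<infinity>" for i :: nat
      using fin sp by simp
  qed (use sets gen in auto)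
qed

text \<open>Independence as a product law, so that the two variables may have values in different
  types (a pair of reals and a vector of outcomes); for equal types it is
  \<open>indep_var\<close>.\<close>

definition indep_pair :: "'a measure \<Rightarrow> 'b measure \<Rightarrow> ('a \<Rightarrow> 'b) \<Rightarrow> 'c measure \<Rightarrow> ('a \<Rightarrow> 'c) \<Rightarrow> bool" where
  "indep_pair M P Z Q X \<longleftrightarrow> Z \<in> measurable M P \<and> X \<in> measurable M Q \<and>
     distr M (P \<Otimes>\<^sub>M Q) (\<lambda>\<omega>. (Z \<omega>, X \<omega>)) = distr M P Z \<Otimes>\<^sub>M distr M Q X"

lemma (in prob_space) indep_var_iff_indep_pair:
  "indep_var P Z Q X \<longleftrightarrow> indep_pair M P Z Q X"
  unfolding indep_var_distribution_eq indep_pair_def by auto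

lemma (in prob_space) indep_pair_compose:
  assumes ZX: "indep_pair M P Z Q X" and f: "f \<in> measurable P P'" and g: "g \<in> measurable Q Q'"
  shows "indep_pair M P' (\<lambda>\<omega>. f (Z \<omega>)) Q' (\<lambda>\<omega>. g (X \<omega>))"
proof -
  note [measurable] = f g
  have [measurable]: "Z \<in> measurable M P" "X \<in> measurable M Q"
    and eq: "distr M (P \<Otimes>\<^sub>M Q) (\<lambda>\<omega>. (Z \<omega>, X \<omega>)) = distr M P Z \<Otimes>\<^sub>M distr M Q X"
    using ZX by (auto simp: indep_pair_def)
  interpret x: prob_space "distr (distr M Q X) Q' g"
    by (intro prob_space.prob_space_distr prob_space_distr) auto
  have "distr M P' (\<lambda>\<omega>. f (Z \<omega>)) \<Otimes>\<^sub>M distr M Q' (\<lambda>\<omega>. g (X \<omega>)) =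
      distr (distr M P Z) P' f \<Otimes>\<^sub>M distr (distr M Q X) Q' g"
    by (simp add: distr_distr comp_def)
  also have "\<dots> = distr (distr M P Z \<Otimes>\<^sub>M distr M Q X) (P' \<Otimes>\<^sub>M Q') (\<lambda>(x, y). (f x, g y))"
    by (rule pair_measure_distr) (auto intro: x.sigma_finite_measure_axioms)
  also have "\<dots> = distr M (P' \<Otimes>\<^sub>M Q') (\<lambda>\<omega>. (f (Z \<omega>), g (X \<omega>)))"
    unfolding eq[symmetric] by (subst distr_distr) (auto simp: comp_def)
  finally show ?thesis by (simp add: indep_pair_def)
qed

text \<open>The two hypotheses together make the law of \<open>(H, Z, X)\<close> a product of three
  marginals, and such a product may be rebracketed. In use \<open>H\<close> is fresh noise,
  \<open>Z\<close> the posterior error and \<open>X\<close> the data.\<close>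

lemma (in prob_space) indep_pair_assoc:
  assumes HZX: "indep_pair M N H (P \<Otimes>\<^sub>M Q) (\<lambda>\<omega>. (Z \<omega>, X \<omega>))"
    and ZX: "indep_pair M P Z Q X"
  shows "indep_pair M (N \<Otimes>\<^sub>M P) (\<lambda>\<omega>. (H \<omega>, Z \<omega>)) Q X"
proof -
  have [measurable]: "H \<in> measurable M N" "Z \<in> measurable M P" "X \<in> measurable M Q"
    using HZX ZX by (auto simp: indep_pair_def)
  interpret h: prob_space "distr M N H" by (rule prob_space_distr) simp
  interpret z: prob_space "distr M P Z" by (rule prob_space_distr) simp
  interpret x: prob_space "distr M Q X" by (rule prob_space_distr) simp
  interpret zx: pair_prob_space "distr M P Z" "distr M Q X" ..
  interpret hz: pair_prob_space "distr M N H" "distr M P Z" ..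
  have zx_eq: "distr M P Z \<Otimes>\<^sub>M distr M Q X = distr M (P \<Otimes>\<^sub>M Q) (\<lambda>\<omega>. (Z \<omega>, X \<omega>))"
    using ZX by (simp add: indep_pair_def)
  have hzx_eq: "distr M N H \<Otimes>\<^sub>M (distr M P Z \<Otimes>\<^sub>M distr M Q X) =
      distr M (N \<Otimes>\<^sub>M (P \<Otimes>\<^sub>M Q)) (\<lambda>\<omega>. (H \<omega>, Z \<omega>, X \<omega>))"
    using HZX unfolding zx_eq by (simp add: indep_pair_def)
  have HZ: "indep_pair M N H P Z"
    using indep_pair_compose[OF HZX, of "\<lambda>x. x" N fst P] by simp
  then have hz_eq: "distr M N H \<Otimes>\<^sub>M distr M P Z = distr M (N \<Otimes>\<^sub>M P) (\<lambda>\<omega>. (H \<omega>, Z \<omega>))"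
    by (simp add: indep_pair_def)
  have "(distr M N H \<Otimes>\<^sub>M distr M P Z) \<Otimes>\<^sub>M distr M Q X =
    distr M ((N \<Otimes>\<^sub>M P) \<Otimes>\<^sub>M Q) (\<lambda>\<omega>. ((H \<omega>, Z \<omega>), X \<omega>))"
  proof (rule pair_measure_eqI)
    fix A B assume "A \<in> sets (distr M N H \<Otimes>\<^sub>M distr M P Z)" and "B \<in> sets (distr M Q X)"
    then have A[measurable]: "A \<in> sets (N \<Otimes>\<^sub>M P)" and B[measurable]: "B \<in> sets Q"
      by (simp_all cong: sets_pair_measure_cong)
    define S where "S = {(h, z, x). (h, z) \<in> A \<and> x \<in> B} \<inter> space (N \<Otimes>\<^sub>M (P \<Otimes>\<^sub>M Q))"
    have S[measurable]: "S \<in> sets (N \<Otimes>\<^sub>M (P \<Otimes>\<^sub>M Q))"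
    proof -
      have "S = {y \<in> space (N \<Otimes>\<^sub>M (P \<Otimes>\<^sub>M Q)). (fst y, fst (snd y)) \<in> A \<and> snd (snd y) \<in> B}"
        by (auto simp: S_def)
      also have "\<dots> \<in> sets (N \<Otimes>\<^sub>M (P \<Otimes>\<^sub>M Q))" by measurable
      finally show ?thesis .
    qed
    have "emeasure (distr M ((N \<Otimes>\<^sub>M P) \<Otimes>\<^sub>M Q) (\<lambda>\<omega>. ((H \<omega>, Z \<omega>), X \<omega>))) (A \<times> B) =
        emeasure (distr M (N \<Otimes>\<^sub>M (P \<Otimes>\<^sub>M Q)) (\<lambda>\<omega>. (H \<omega>, Z \<omega>, X \<omega>))) S"
      using measurable_space[of H M N] measurable_space[of Z M P] measurable_space[of X M Q]
      by (auto simp: emeasure_distr S_def space_pair_measure intro!: arg_cong2[where f=emeasure])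
    also have "\<dots> = emeasure (distr M N H \<Otimes>\<^sub>M (distr M P Z \<Otimes>\<^sub>M distr M Q X)) S"
      by (simp add: hzx_eq)
    also have "\<dots> = (\<integral>\<^sup>+h. emeasure (distr M P Z \<Otimes>\<^sub>M distr M Q X) (Pair h -` S) \<partial>distr M N H)"
      by (rule zx.emeasure_pair_measure_alt) (simp cong: sets_pair_measure_cong)
    also have "\<dots> = (\<integral>\<^sup>+h. emeasure (distr M P Z) (Pair h -` A) * emeasure (distr M Q X) B \<partial>distr M N H)"
    proof (rule nn_integral_cong)
      fix h assume h: "h \<in> space (distr M N H)"
      have "Pair h -` S = (Pair h -` A) \<times> B"
        using h sets.sets_into_space[OF A] sets.sets_into_space[OF B]
        by (auto simp: S_def space_pair_measure)
      then show "emeasure (distr M P Z \<Otimes>\<^sub>M distr M Q X) (Pair h -` S) =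
          emeasure (distr M P Z) (Pair h -` A) * emeasure (distr M Q X) B"
        by (simp add: x.emeasure_pair_measure_Times sets_Pair1[OF A])
    qed
    also have "\<dots> = emeasure (distr M N H \<Otimes>\<^sub>M distr M P Z) A * emeasure (distr M Q X) B"
    proof -
      have *: "A \<in> sets (distr M N H \<Otimes>\<^sub>M distr M P Z)" by (simp cong: sets_pair_measure_cong)
      show ?thesis
        unfolding z.emeasure_pair_measure_alt[OF *]
        by (rule nn_integral_multc) (rule z.measurable_emeasure_Pair[OF *])
    qed
    finally show "emeasure (distr M N H \<Otimes>\<^sub>M distr M P Z) A * emeasure (distr M Q X) B =
      emeasure (distr M ((N \<Otimes>\<^sub>M P) \<Otimes>\<^sub>M Q) (\<lambda>\<omega>. ((H \<omega>, Z \<omega>), X \<omega>))) (A \<times> B)" by simp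
  qed (auto intro: prob_space_imp_sigma_finite hz.prob_space_axioms x.prob_space_axioms cong: sets_pair_measure_cong)
  then show ?thesis
    unfolding indep_pair_def hz_eq by simp
qed

section \<open>The standard normal distribution function and its inverse\<close>

interpretation std_normal: real_distribution "density lborel std_normal_density"
  using prob_space_normal_density[of 1 0] by (auto simp: real_distribution_def real_distribution_axioms_def)

lemma Phi_mono: "x \<le> y \<Longrightarrow> Phi x \<le> Phi y"
  unfolding Phi_def by (rule std_normal.cdf_nondecreasing)

lemma isCont_Phi: "isCont Phi x"
proof -
  have "emeasure (density lborel std_normal_density) {x} = 0"
    by (simp add: emeasure_density nn_integral_0_iff_AE)
  then show ?thesis
    unfolding Phi_def std_normal.isCont_cdf by (simp add: measure_def)
qed

text \<open>Continuity and the two tail limits give a preimage by the intermediate value theorem.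
  \<open>inv\<close> returns some preimage, and whichever it is, \<open>Phi\<close> sends it back to
  \<open>p\<close>. The argument needs \<open>p\<close> strictly between the tail limits.\<close>

lemma Phi_inv: assumes "0 < p" "p < 1" shows "Phi (inv Phi p) = p"
proof -
  have "eventually (\<lambda>x. Phi x < p) at_bot"
    using std_normal.cdf_lim_at_bot assms(1) unfolding Phi_def by (rule order_tendstoD)
  then obtain a where a: "\<And>x. x \<le> a \<Longrightarrow> Phi x < p"
    by (auto simp: eventually_at_bot_linorder)
  have "eventually (\<lambda>x. Phi x > p) at_top"
    using std_normal.cdf_lim_at_top_prob assms(2) unfolding Phi_def by (rule order_tendstoD)
  then obtain c where c: "\<And>x. x \<ge> c \<Longrightarrow> Phi x > p"
    by (auto simp: eventually_at_top_linorder)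
  have "\<exists>x\<ge>min a c. x \<le> c \<and> Phi x = p"
    using a[of "min a c"] c[of c] isCont_Phi by (intro IVT) (auto simp: less_imp_le)
  then show ?thesis by (auto intro: f_inv_into_f)
qed

lemma (in prob_space) prob_normal_le:
  assumes X: "distributed M lborel X (normal_density 0 s)" and s: "0 < s"
  shows "prob {\<omega> \<in> space M. X \<omega> \<le> r} = Phi (r / s)"
proof -
  have "distributed M lborel (\<lambda>\<omega>. (X \<omega> - 0) / s) (\<lambda>x. ennreal (std_normal_density x))"
    using X normal_standard_normal_convert[OF s, of X 0] by simp
  then have D: "distr M lborel (\<lambda>\<omega>. X \<omega> / s) = density lborel std_normal_density"
    and [measurable]: "(\<lambda>\<omega>. X \<omega> / s) \<in> borel_measurable M"
    by (auto simp: distributed_def)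
  have "Phi (r / s) = measure (distr M lborel (\<lambda>\<omega>. X \<omega> / s)) {..r / s}"
    by (simp add: Phi_def cdf_def D)
  also have "\<dots> = prob {\<omega> \<in> space M. X \<omega> \<le> r}"
    using s by (subst measure_distr) (auto simp: divide_simps intro!: arg_cong[where f=prob])
  finally show ?thesis by simp
qed

section \<open>The conjugate Gaussian model\<close>

lemma sets_diag_gaussian [simp, measurable_cong]: "sets (diag_gaussian \<mu> \<sigma>) = sets borel"
  unfolding diag_gaussian_def borel_prod[symmetric] by (intro sets_pair_measure_cong) auto

lemma space_diag_gaussian [simp]: "space (diag_gaussian \<mu> \<sigma>) = UNIV"
  using sets_eq_imp_space_eq[OF sets_diag_gaussian] by simp

lemma prob_space_diag_gaussian:
  assumes "\<And>w. 0 < \<sigma> w" shows "prob_space (diag_gaussian \<mu> \<sigma>)"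
proof -
  interpret a: prob_space "density lborel (normal_density (\<mu> False) (\<sigma> False))"
    using assms by (rule prob_space_normal_density)
  interpret b: prob_space "density lborel (normal_density (\<mu> True) (\<sigma> True))"
    using assms by (rule prob_space_normal_density)
  interpret p: pair_prob_space "density lborel (normal_density (\<mu> False) (\<sigma> False))"
     "density lborel (normal_density (\<mu> True) (\<sigma> True))" ..
  show ?thesis unfolding diag_gaussian_def by (rule p.prob_space_axioms)
qed

lemma normal_shift:
  assumes s: "0 < s"
  shows "density lborel (normal_density \<mu> s) = distr (density lborel (normal_density 0 s)) borel (\<lambda>x. \<mu> + x)"
proof -
  interpret prob_space "density lborel (normal_density 0 s)"
    using s by (rule prob_space_normal_density)
  have "distributed (density lborel (normal_density 0 s)) lborel (\<lambda>x. x) (normal_density 0 s)"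
    by (auto simp: distributed_def intro!: measure_eqI simp: emeasure_distr)
  from normal_density_affine[OF this s, of 1 \<mu>]
  have "distr (density lborel (normal_density 0 s)) lborel (\<lambda>x. \<mu> + x) = density lborel (normal_density \<mu> s)"
    by (simp add: distributed_def)
  then show ?thesis by (simp cong: distr_cong)
qed

text \<open>Separates the unknown mean from the randomness: a law that moves with the parameter
  becomes a translate of one fixed noise law. This is what later makes the residuals independent of
  the parameters.\<close>

lemma diag_gaussian_shift:
  assumes s: "\<And>w. 0 < \<sigma> w"
  shows "diag_gaussian \<mu> \<sigma> = distr (diag_gaussian (\<lambda>_. 0) \<sigma>) borel (\<lambda>e. (\<mu> False, \<mu> True) + e)"
proof -
  have sf: "sigma_finite_measure (distr (density lborel (normal_density 0 (\<sigma> True))) borel (\<lambda>x. \<mu> True + x))"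
    using prob_space_normal_density[OF s] by (intro prob_space_imp_sigma_finite prob_space.prob_space_distr) auto
  show ?thesis
    unfolding diag_gaussian_def normal_shift[OF s, of "\<mu> _"] borel_prod[symmetric]
    by (subst pair_measure_distr[OF _ _ sf]) (auto intro!: distr_cong simp: case_prod_beta plus_prod_def)
qed

lemma emeasure_diag_gaussian_times:
  assumes s: "\<And>w. 0 < \<sigma> w" and [measurable]: "A \<in> sets borel" "B \<in> sets borel"
  shows "emeasure (diag_gaussian \<mu> \<sigma>) (A \<times> B) =
    emeasure (density lborel (normal_density (\<mu> False) (\<sigma> False))) A *
    emeasure (density lborel (normal_density (\<mu> True) (\<sigma> True))) B"
proof -
  interpret b: prob_space "density lborel (normal_density (\<mu> True) (\<sigma> True))"
    using s by (rule prob_space_normal_density)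
  show ?thesis unfolding diag_gaussian_def by (rule b.emeasure_pair_measure_Times) auto
qed

lemma measurable_fst_borel [measurable]: "fst \<in> borel_measurable (borel :: (real \<times> real) measure)"
  and measurable_snd_borel [measurable]: "snd \<in> borel_measurable (borel :: (real \<times> real) measure)"
  by (auto intro!: borel_measurable_continuous_onI continuous_intros)

lemma diag_gaussian_density:
  assumes s: "\<And>w. 0 < s w"
  shows "diag_gaussian m s = density lborel (\<lambda>p. ennreal (normal_density (m False) (s False) (fst p) * normal_density (m True) (s True) (snd p)))"
proof -
  interpret b: prob_space "density lborel (normal_density (m True) (s True))"
    using s by (rule prob_space_normal_density)
  have "diag_gaussian m s = density (lborel \<Otimes>\<^sub>M lborel) (\<lambda>(x, y). ennreal (normal_density (m False) (s False) x) * ennreal (normal_density (m True) (s True) y))"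
    unfolding diag_gaussian_def
    by (rule pair_measure_density) (simp_all add: b.sigma_finite_measure_axioms lborel.sigma_finite_measure_axioms)
  also have "(\<lambda>(x, y). ennreal (normal_density (m False) (s False) x) * ennreal (normal_density (m True) (s True) y)) =
      (\<lambda>p. ennreal (normal_density (m False) (s False) (fst p) * normal_density (m True) (s True) (snd p)))"
    by (simp add: fun_eq_iff ennreal_mult)
  finally show ?thesis by (simp only: lborel_prod)
qed

section \<open>Potential outcomes as parameter plus independent noise, before any assignment\<close>

locale gaussian_experiment = prob_space M for M :: "'a measure" +
  fixes \<N> :: "nat \<Rightarrow> 'u set" and \<mu>0 \<sigma>0 \<sigma> :: "bool \<Rightarrow> real"
    and \<theta> :: "bool \<Rightarrow> 'a \<Rightarrow> real" and Y :: "'u \<Rightarrow> nat \<Rightarrow> bool \<Rightarrow> 'a \<Rightarrow> real"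
  assumes prior_sd_pos: "0 < \<sigma>0 w" and sd_pos: "0 < \<sigma> w"
    and model: "conjugate_gaussian_model M \<N> \<mu>0 \<sigma>0 \<sigma> \<theta> Y"
begin

definition units :: "('u \<times> nat) set" where "units = {(i, t). 1 \<le> t \<and> i \<in> \<N> t}"

definition params :: "'a \<Rightarrow> real \<times> real" where "params \<omega> = (\<theta> False \<omega>, \<theta> True \<omega>)"

definition outcomes :: "'u \<times> nat \<Rightarrow> 'a \<Rightarrow> real \<times> real" where
  "outcomes j \<omega> = (Y (fst j) (snd j) False \<omega>, Y (fst j) (snd j) True \<omega>)"

abbreviation prior :: "(real \<times> real) measure" where "prior \<equiv> diag_gaussian \<mu>0 \<sigma>0"
abbreviation noise :: "(real \<times> real) measure" where "noise \<equiv> diag_gaussian (\<lambda>_. 0) \<sigma>"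

lemma measurable_theta [measurable]: "\<theta> w \<in> borel_measurable M"
  using model by (auto simp: conjugate_gaussian_model_def distributed_def)

lemma measurable_Y: "(i, t) \<in> units \<Longrightarrow> Y i t w \<in> borel_measurable M"
  using model by (auto simp: conjugate_gaussian_model_def units_def)

lemma measurable_params [measurable]: "params \<in> borel_measurable M"
  unfolding params_def by measurable

lemma measurable_outcomes: "j \<in> units \<Longrightarrow> outcomes j \<in> borel_measurable M"
  unfolding outcomes_def using measurable_Y[of "fst j" "snd j"] by simp

lemma distr_params: "distr M borel params = prior"
proof -
  have "indep_pair M borel (\<theta> False) borel (\<theta> True)"
    using model by (simp add: conjugate_gaussian_model_def indep_var_iff_indep_pair)
  moreover have "distr M borel (\<theta> w) = density lborel (normal_density (\<mu>0 w) (\<sigma>0 w))" for w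
    using model by (auto simp: conjugate_gaussian_model_def distributed_def cong: distr_cong)
  ultimately show ?thesis
    by (auto simp: indep_pair_def params_def[abs_def] diag_gaussian_def borel_prod)
qed

text \<open>Turns the conditional law of the model into a plain integral:
  \<open>params \<in> F\<close> is an event of the \<sigma>-algebra of the parameters, so its
  indicator can be moved past the conditional expectation.\<close>

lemma emeasure_box:
  assumes J: "finite J" "J \<subseteq> units" and F: "F \<in> sets borel" and E: "\<And>j. j \<in> J \<Longrightarrow> E j \<in> sets borel"
  shows "emeasure M {\<omega> \<in> space M. params \<omega> \<in> F \<and> (\<forall>j\<in>J. outcomes j \<omega> \<in> E j)} =
    (\<integral>\<^sup>+\<omega>. indicator F (params \<omega>) * (\<Prod>j\<in>J. emeasure (diag_gaussian (\<lambda>w. \<theta> w \<omega>) \<sigma>) (E j)) \<partial>M)"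
proof -
  define P where "P = sigma (space M) (param_events M \<theta>)"
  define U where "U = {\<omega> \<in> space M. \<forall>j\<in>J. outcomes j \<omega> \<in> E j}"
  have sub: "param_events M \<theta> \<subseteq> sets M" by (auto simp: param_events_def)
  have "subalgebra M P"
    unfolding subalgebra_def P_def using sub sets.space_closed[of M]
    by (auto simp: space_measure_of_conv sets_measure_of intro!: sets.sigma_sets_subset dest: subsetD)
  then interpret finite_measure_subalgebra M P
    by unfold_locales
  have spP: "space P = space M" by (simp add: P_def space_measure_of_conv)
  have thP: "\<theta> w \<in> borel_measurable P" for w
  proof (rule measurableI)
    fix A :: "real set" assume "A \<in> sets borel"
    then have "\<theta> w -` A \<inter> space M \<in> param_events M \<theta>" by (auto simp: param_events_def)
    then show "\<theta> w -` A \<inter> space P \<in> sets P"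
      using sub sets.space_closed[of M] unfolding spP by (auto simp: P_def)
  qed simp
  have "params \<in> borel_measurable P"
    unfolding params_def using thP by simp
  then have [measurable]: "(\<lambda>\<omega>. indicator F (params \<omega>) :: real) \<in> borel_measurable P"
    using F by measurable
  have [measurable]: "U \<in> sets M"
    unfolding U_def
  proof (rule sets.sets_Collect_finite_All[OF _ J(1)])
    show "{\<omega> \<in> space M. outcomes j \<omega> \<in> E j} \<in> sets M" if "j \<in> J" for j
      using measurable_sets[OF measurable_outcomes[OF subsetD[OF J(2) that]] E[OF that]]
      by (simp add: vimage_def Int_def conj_commute)
  qed
  have ae: "AE \<omega> in M. real_cond_exp M P (indicator U) \<omega> =
      (\<Prod>j\<in>J. measure (diag_gaussian (\<lambda>w. \<theta> w \<omega>) \<sigma>) (E j))"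
    using model[unfolded conjugate_gaussian_model_def] J E
    unfolding P_def U_def units_def outcomes_def by (auto simp: case_prod_beta)
  have "prob {\<omega> \<in> space M. params \<omega> \<in> F \<and> (\<forall>j\<in>J. outcomes j \<omega> \<in> E j)} =
      (\<integral>\<omega>. indicator F (params \<omega>) * indicator U \<omega> \<partial>M)"
  proof -
    have *: "{\<omega> \<in> space M. params \<omega> \<in> F \<and> (\<forall>j\<in>J. outcomes j \<omega> \<in> E j)} = {\<omega> \<in> space M. params \<omega> \<in> F} \<inter> U"
      by (auto simp: U_def)
    have "prob ({\<omega> \<in> space M. params \<omega> \<in> F} \<inter> U) = (\<integral>\<omega>. indicator ({\<omega> \<in> space M. params \<omega> \<in> F} \<inter> U) \<omega> \<partial>M)"
      using F by simp
    also have "\<dots> = (\<integral>\<omega>. indicator F (params \<omega>) * indicator U \<omega> \<partial>M)"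
      by (rule Bochner_Integration.integral_cong) (auto split: split_indicator)
    finally show ?thesis unfolding * .
  qed
  also have "\<dots> = (\<integral>\<omega>. indicator F (params \<omega>) * real_cond_exp M P (indicator U) \<omega> \<partial>M)"
    using F by (intro real_cond_exp_intg(2)[symmetric] integrable_const_bound[where B=1]) (auto split: split_indicator)
  finally have 1: "prob {\<omega> \<in> space M. params \<omega> \<in> F \<and> (\<forall>j\<in>J. outcomes j \<omega> \<in> E j)} =
      (\<integral>\<omega>. indicator F (params \<omega>) * real_cond_exp M P (indicator U) \<omega> \<partial>M)" .
  have int: "integrable M (\<lambda>\<omega>. indicator F (params \<omega>) * real_cond_exp M P (indicator U) \<omega>)"
    using F by (intro real_cond_exp_intg(1) integrable_const_bound[where B=1]) (auto split: split_indicator)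
  have em: "emeasure (diag_gaussian (\<lambda>w. \<theta> w \<omega>) \<sigma>) (E j) = ennreal (measure (diag_gaussian (\<lambda>w. \<theta> w \<omega>) \<sigma>) (E j))" for \<omega> j
  proof -
    interpret d: prob_space "diag_gaussian (\<lambda>w. \<theta> w \<omega>) \<sigma>" by (rule prob_space_diag_gaussian[OF sd_pos])
    show ?thesis by (rule d.emeasure_eq_measure)
  qed
  have "ennreal (\<integral>\<omega>. indicator F (params \<omega>) * real_cond_exp M P (indicator U) \<omega> \<partial>M) =
      (\<integral>\<^sup>+\<omega>. indicator F (params \<omega>) * real_cond_exp M P (indicator U) \<omega> \<partial>M)"
    using ae by (intro nn_integral_eq_integral[OF int, symmetric])
      (auto elim!: eventually_mono intro!: mult_nonneg_nonneg prod_nonneg)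
  also have "\<dots> = (\<integral>\<^sup>+\<omega>. indicator F (params \<omega>) * (\<Prod>j\<in>J. emeasure (diag_gaussian (\<lambda>w. \<theta> w \<omega>) \<sigma>) (E j)) \<partial>M)"
    using ae by (intro nn_integral_cong_AE)
      (auto elim!: eventually_mono simp: em prod_ennreal prod_nonneg split: split_indicator)
  finally show ?thesis
    unfolding emeasure_eq_measure 1 .
qed

text \<open>Given the parameter \<open>p\<close>, the outcomes are translates by \<open>p\<close> of
  i.i.d. noise. Both sides are compared on boxes: for fixed \<open>p\<close> the section of the
  preimage of a box is again a box, with translated sides, and its mass is the conditional
  probability of the model.\<close>

lemma joint_law:
  assumes J: "finite J" "J \<subseteq> units"
  shows "distr M (borel \<Otimes>\<^sub>M PiM J (\<lambda>_. borel)) (\<lambda>\<omega>. (params \<omega>, \<lambda>j\<in>J. outcomes j \<omega>)) =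
    distr (prior \<Otimes>\<^sub>M PiM J (\<lambda>_. noise)) (borel \<Otimes>\<^sub>M PiM J (\<lambda>_. borel)) (\<lambda>(p, e). (p, \<lambda>j\<in>J. p + e j))"
    (is "?L = ?R")
proof (rule measure_eqI_pair_PiM[OF J(1), where N=borel and K="\<lambda>_. borel"])
  note [measurable] = measurable_outcomes[OF subsetD[OF J(2)]]
  interpret noise: prob_space noise by (rule prob_space_diag_gaussian[OF sd_pos])
  interpret prodN: product_prob_space "\<lambda>_. noise" J ..
  interpret prodF: finite_product_prob_space "\<lambda>_. noise" J by standard (rule J)
  have P: "sigma_finite_measure (PiM J (\<lambda>_. noise))"
    by (intro prob_space_imp_sigma_finite prob_space_PiM noise.prob_space_axioms)
  show "sets ?L = sets (borel \<Otimes>\<^sub>M PiM J (\<lambda>_. borel))" "sets ?R = sets (borel \<Otimes>\<^sub>M PiM J (\<lambda>_. borel))"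
    by auto
  interpret L: prob_space ?L by (rule prob_space_distr) measurable
  show "emeasure ?L (space ?L) \<noteq> \<infinity>" by simp
  fix F :: "(real \<times> real) set" and E :: "'u \<times> nat \<Rightarrow> (real \<times> real) set"
  assume F[measurable]: "F \<in> sets borel" and E: "\<And>j. j \<in> J \<Longrightarrow> E j \<in> sets borel"
  then have E'[measurable]: "PiE J E \<in> sets (PiM J (\<lambda>_. borel))"
    using J by (intro sets_PiM_I_finite) auto
  have "emeasure ?L (F \<times> PiE J E) = emeasure M {\<omega> \<in> space M. params \<omega> \<in> F \<and> (\<forall>j\<in>J. outcomes j \<omega> \<in> E j)}"
    by (subst emeasure_distr) (auto intro!: arg_cong[where f="emeasure M"] simp: PiE_iff)
  also have "\<dots> = (\<integral>\<^sup>+\<omega>. indicator F (params \<omega>) * (\<Prod>j\<in>J. emeasure (diag_gaussian (\<lambda>w. \<theta> w \<omega>) \<sigma>) (E j)) \<partial>M)"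
    by (rule emeasure_box[OF J F E])
  also have "\<dots> = (\<integral>\<^sup>+\<omega>. indicator F (params \<omega>) * (\<Prod>j\<in>J. emeasure noise ((\<lambda>e. params \<omega> + e) -` E j)) \<partial>M)"
    using E by (simp add: diag_gaussian_shift[OF sd_pos, of "\<lambda>w. \<theta> w _"] emeasure_distr params_def)
  also have "\<dots> = (\<integral>\<^sup>+p. indicator F p * (\<Prod>j\<in>J. emeasure noise ((\<lambda>e. p + e) -` E j)) \<partial>prior)"
  proof -
    have "(\<lambda>p. emeasure noise ((\<lambda>e. p + e) -` E j)) \<in> borel_measurable borel" if "j \<in> J" for j
    proof -
      have "(\<lambda>x. fst x + snd x) -` E j \<inter> space (borel \<Otimes>\<^sub>M noise) \<in> sets (borel \<Otimes>\<^sub>M noise)"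
        by (rule measurable_sets[OF _ E[OF that]]) measurable
      from noise.measurable_emeasure_Pair[OF this] show ?thesis
        by (simp add: space_pair_measure vimage_def)
    qed
    then show ?thesis
      by (subst distr_params[symmetric]) (simp add: nn_integral_distr)
  qed
  also have "\<dots> = (\<integral>\<^sup>+p. emeasure (PiM J (\<lambda>_. noise)) (Pair p -` ((\<lambda>(p, e). (p, \<lambda>j\<in>J. p + e j)) -` (F \<times> PiE J E) \<inter> space (prior \<Otimes>\<^sub>M PiM J (\<lambda>_. noise)))) \<partial>prior)"
  proof (rule nn_integral_cong)
    fix p
    have "emeasure (PiM J (\<lambda>_. noise)) (Pair p -` ((\<lambda>(p, e). (p, \<lambda>j\<in>J. p + e j)) -` (F \<times> PiE J E) \<inter> space (prior \<Otimes>\<^sub>M PiM J (\<lambda>_. noise))))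
       = emeasure (PiM J (\<lambda>_. noise)) (if p \<in> F then PiE J (\<lambda>j. (\<lambda>e. p + e) -` E j) else {})"
      by (rule arg_cong[where f="emeasure _"]) (auto simp: space_pair_measure space_PiM PiE_iff)
    also have "\<dots> = indicator F p * (\<Prod>j\<in>J. emeasure noise ((\<lambda>e. p + e) -` E j))"
    proof -
      have "(\<lambda>e. p + e) -` E j \<in> sets noise" if "j \<in> J" for j
        using measurable_sets[of "\<lambda>e. p + e" borel borel "E j"] E[OF that]
        by (simp del: borel_open)
      then show ?thesis by (auto intro!: prodF.measure_times split: split_indicator)
    qed
    finally show "indicator F p * (\<Prod>j\<in>J. emeasure noise ((\<lambda>e. p + e) -` E j)) = emeasure (PiM J (\<lambda>_. noise)) (Pair p -` ((\<lambda>(p, e). (p, \<lambda>j\<in>J. p + e j)) -` (F \<times> PiE J E) \<inter> space (prior \<Otimes>\<^sub>M PiM J (\<lambda>_. noise))))"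
      by simp
  qed
  also have "\<dots> = emeasure (prior \<Otimes>\<^sub>M PiM J (\<lambda>_. noise)) ((\<lambda>(p, e). (p, \<lambda>j\<in>J. p + e j)) -` (F \<times> PiE J E) \<inter> space (prior \<Otimes>\<^sub>M PiM J (\<lambda>_. noise)))"
    by (rule sigma_finite_measure.emeasure_pair_measure_alt[OF P, symmetric], rule measurable_sets[where A="borel \<Otimes>\<^sub>M PiM J (\<lambda>_. borel)"]) measurable
  also have "\<dots> = emeasure ?R (F \<times> PiE J E)"
    by (subst emeasure_distr) auto
  finally show "emeasure ?L (F \<times> PiE J E) = emeasure ?R (F \<times> PiE J E)" .
qed

text \<open>Reads \<open>joint_law\<close> backwards: subtracting the parameter undoes the shift, so
  the event becomes a box under the product of prior and noise laws.\<close>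

lemma emeasure_noise_box:
  assumes J: "finite J" "J \<subseteq> units" and F: "F \<in> sets borel" and E: "\<And>j. j \<in> J \<Longrightarrow> E j \<in> sets borel"
  shows "emeasure M {\<omega> \<in> space M. params \<omega> \<in> F \<and> (\<forall>j\<in>J. outcomes j \<omega> - params \<omega> \<in> E j)} =
    emeasure prior F * (\<Prod>j\<in>J. emeasure noise (E j))"
proof -
  note [measurable] = measurable_outcomes[OF subsetD[OF J(2)]] F E
  interpret noise: prob_space noise by (rule prob_space_diag_gaussian[OF sd_pos])
  interpret prodN: product_prob_space "\<lambda>_. noise" J ..
  interpret prodF: finite_product_prob_space "\<lambda>_. noise" J by standard (rule J)
  have P: "sigma_finite_measure (PiM J (\<lambda>_. noise))"
    by (intro prob_space_imp_sigma_finite prob_space_PiM noise.prob_space_axioms)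
  define S where "S = {x \<in> space (borel \<Otimes>\<^sub>M PiM J (\<lambda>_. borel :: (real \<times> real) measure)). fst x \<in> F \<and> (\<forall>j\<in>J. snd x j - fst x \<in> E j)}"
  have S: "S \<in> sets (borel \<Otimes>\<^sub>M PiM J (\<lambda>_. borel))"
    unfolding S_def using J by measurable
  have "emeasure M {\<omega> \<in> space M. params \<omega> \<in> F \<and> (\<forall>j\<in>J. outcomes j \<omega> - params \<omega> \<in> E j)} =
      emeasure (distr M (borel \<Otimes>\<^sub>M PiM J (\<lambda>_. borel)) (\<lambda>\<omega>. (params \<omega>, \<lambda>j\<in>J. outcomes j \<omega>))) S"
    by (subst emeasure_distr[OF _ S]) (auto intro!: arg_cong[where f="emeasure M"] simp: S_def space_pair_measure space_PiM)
  also have "\<dots> = emeasure (prior \<Otimes>\<^sub>M PiM J (\<lambda>_. noise)) (F \<times> PiE J E)"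
    unfolding joint_law[OF J]
    by (subst emeasure_distr[OF _ S])
       (use sets.sets_into_space[OF E] in \<open>auto intro!: arg_cong[where f="emeasure _"] simp: S_def space_pair_measure space_PiM PiE_iff\<close>)
  also have "\<dots> = emeasure prior F * (\<Prod>j\<in>J. emeasure noise (E j))"
    using E J F by (subst sigma_finite_measure.emeasure_pair_measure_Times[OF P]) (auto intro!: sets_PiM_I_finite simp: prodF.measure_times)
  finally show ?thesis .
qed

text \<open>One family for all sources of randomness: key \<open>None\<close> is the parameter, key
  \<open>Some j\<close> the deviation of an outcome of unit \<open>j\<close> from its mean, in
  either arm. Independence of two groups of quantities then follows from disjointness of their key
  sets.\<close>

definition residual :: "('u \<times> nat) option \<times> bool \<Rightarrow> 'a \<Rightarrow> real" where
  "residual k \<omega> = (case fst k of None \<Rightarrow> \<theta> (snd k) \<omega>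
     | Some j \<Rightarrow> Y (fst j) (snd j) (snd k) \<omega> - \<theta> (snd k) \<omega>)"

lemma residual_simps [simp]:
  "residual (None, w) \<omega> = \<theta> w \<omega>"
  "residual (Some j, w) \<omega> = Y (fst j) (snd j) w \<omega> - \<theta> w \<omega>"
  by (simp_all add: residual_def)

lemma measurable_residual:
  assumes "J \<subseteq> units" "k \<in> (insert None (Some ` J)) \<times> UNIV"
  shows "residual k \<in> borel_measurable M"
  using assms measurable_Y by (cases k) (auto simp: residual_def[abs_def])

lemma emeasure_prior_UNIV: "emeasure prior UNIV = 1"
  using prob_space.emeasure_space_1[OF prob_space_diag_gaussian[OF prior_sd_pos, of \<mu>0]] by simp

lemma distributed_residual:
  assumes j: "j \<in> units"
  shows "distributed M lborel (residual (Some j, w)) (normal_density 0 (\<sigma> w))"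
proof -
  have m: "residual (Some j, w) \<in> borel_measurable M"
    using j by (intro measurable_residual[of "{j}"]) auto
  have "distr M borel (residual (Some j, w)) = density lborel (normal_density 0 (\<sigma> w))"
  proof (rule measure_eqI)
    fix A assume "A \<in> sets (distr M borel (residual (Some j, w)))"
    then have A: "A \<in> sets borel" by simp
    define E where "E = (if w then UNIV \<times> A else A \<times> UNIV)"
    have E: "E \<in> sets borel"
      using A unfolding E_def borel_prod[symmetric] by auto
    interpret p: prob_space "density lborel (normal_density 0 (\<sigma> v))" for v
      using sd_pos by (rule prob_space_normal_density)
    have u: "emeasure (density lborel (normal_density 0 (\<sigma> w))) UNIV = 1" for w
      using p.emeasure_space_1[of w] by simp
    have "emeasure (distr M borel (residual (Some j, w))) A =
        emeasure M {\<omega> \<in> space M. params \<omega> \<in> UNIV \<and> (\<forall>j\<in>{j}. outcomes j \<omega> - params \<omega> \<in> E)}"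
    proof -
      have "emeasure (distr M borel (residual (Some j, w))) A = emeasure M (residual (Some j, w) -` A \<inter> space M)"
        using emeasure_distr[OF m A] by simp
      also have "residual (Some j, w) -` A \<inter> space M = {\<omega> \<in> space M. params \<omega> \<in> UNIV \<and> (\<forall>j\<in>{j}. outcomes j \<omega> - params \<omega> \<in> E)}"
        by (cases w) (auto simp: E_def outcomes_def params_def)
      finally show ?thesis .
    qed
    also have "\<dots> = emeasure noise E"
      using j E by (subst emeasure_noise_box) (auto simp: emeasure_prior_UNIV)
    also have "\<dots> = emeasure (density lborel (normal_density 0 (\<sigma> w))) A"
      using A by (auto simp: E_def emeasure_diag_gaussian_times[OF sd_pos] u)
    finally show "emeasure (distr M borel (residual (Some j, w))) A = emeasure (density lborel (normal_density 0 (\<sigma> w))) A" .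
  qed simp
  with m show ?thesis by (simp add: distributed_def cong: distr_cong)
qed

text \<open>A product event over these keys is a box for \<open>emeasure_noise_box\<close>. Its mass
  factors over units, and then over the two arms of each unit and of the prior, because both
  Gaussian laws are product measures (diagonal covariance).\<close>

lemma indep_residuals:
  assumes J: "finite J" "J \<subseteq> units"
  shows "indep_vars (\<lambda>_. borel) residual ((insert None (Some ` J)) \<times> UNIV)"
proof (subst indep_vars_finite[where E="\<lambda>_. sets borel"])
  let ?I = "(insert None (Some ` J)) \<times> (UNIV :: bool set)"
  define s :: "('u \<times> nat) option \<times> bool \<Rightarrow> real measure" where "s = (\<lambda>k. case k of (None, w) \<Rightarrow> density lborel (normal_density (\<mu>0 w) (\<sigma>0 w))
    | (Some j, w) \<Rightarrow> density lborel (normal_density 0 (\<sigma> w)))"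
  show "\<forall>A\<in>?I \<rightarrow> sets (borel :: real measure). prob (\<Inter>j\<in>?I. residual j -` A j \<inter> space M) =
     (\<Prod>j\<in>?I. prob (residual j -` A j \<inter> space M))"
  proof
    fix A assume A: "A \<in> ?I \<rightarrow> sets (borel :: real measure)"
    have marg: "emeasure M (residual k -` A k \<inter> space M) = emeasure (s k) (A k)" if "k \<in> ?I" for k
    proof -
      have "distr M lborel (residual k) = s k"
      proof (cases "fst k")
        case None
        then show ?thesis
          using model by (cases k) (simp add: s_def conjugate_gaussian_model_def distributed_def residual_def[abs_def])
      next
        case (Some j)
        then have "j \<in> units" using that J by auto
        then show ?thesis using Some distributed_residual[of j "snd k"]
          by (cases k) (auto simp: s_def distributed_def)
      qed
      moreover have "A k \<in> sets borel" using A that by auto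
      ultimately show ?thesis
        using measurable_residual[OF J(2) that] by (metis emeasure_distr measurable_lborel1 sets_lborel)
    qed
    have "emeasure M (\<Inter>j\<in>?I. residual j -` A j \<inter> space M) =
      emeasure M {\<omega> \<in> space M. params \<omega> \<in> A (None, False) \<times> A (None, True) \<and>
        (\<forall>j\<in>J. outcomes j \<omega> - params \<omega> \<in> A (Some j, False) \<times> A (Some j, True))}"
    proof (rule arg_cong[where f="emeasure M"])
      have "(\<Inter>k\<in>?I. residual k -` A k \<inter> space M) =
          {\<omega> \<in> space M. \<forall>k\<in>insert None (Some ` J). \<forall>w. residual (k, w) \<omega> \<in> A (k, w)}"
        by blast
      also have "\<dots> = {\<omega> \<in> space M. params \<omega> \<in> A (None, False) \<times> A (None, True) \<and>
        (\<forall>j\<in>J. outcomes j \<omega> - params \<omega> \<in> A (Some j, False) \<times> A (Some j, True))}"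
        by (simp add: all_bool_eq outcomes_def params_def conj_commute)
      finally show "(\<Inter>k\<in>?I. residual k -` A k \<inter> space M) = {\<omega> \<in> space M. params \<omega> \<in> A (None, False) \<times> A (None, True) \<and>
        (\<forall>j\<in>J. outcomes j \<omega> - params \<omega> \<in> A (Some j, False) \<times> A (Some j, True))}" .
    qed
    also have "\<dots> = emeasure prior (A (None, False) \<times> A (None, True)) * (\<Prod>j\<in>J. emeasure noise (A (Some j, False) \<times> A (Some j, True)))"
    proof (rule emeasure_noise_box[OF J])
      have "A (None, w) \<in> sets borel" for w using A by auto
      then show "A (None, False) \<times> A (None, True) \<in> sets borel"
        unfolding borel_prod[symmetric] by auto
      have "A (Some j, w) \<in> sets borel" if "j \<in> J" for w j using A that by auto
      then show "A (Some j, False) \<times> A (Some j, True) \<in> sets borel" if "j \<in> J" for j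
        using that unfolding borel_prod[symmetric] by auto
    qed
    also have "emeasure prior (A (None, False) \<times> A (None, True)) = (\<Prod>w\<in>UNIV. emeasure (s (None, w)) (A (None, w)))"
    proof -
      have "A (None, w) \<in> sets borel" for w using A by auto
      then show ?thesis
        by (simp add: emeasure_diag_gaussian_times[OF prior_sd_pos] UNIV_bool s_def)
    qed
    also have "(\<Prod>j\<in>J. emeasure noise (A (Some j, False) \<times> A (Some j, True))) =
        (\<Prod>j\<in>J. \<Prod>w\<in>UNIV. emeasure (s (Some j, w)) (A (Some j, w)))"
    proof (rule prod.cong[OF refl])
      fix j assume "j \<in> J"
      then have "A (Some j, w) \<in> sets borel" for w using A by auto
      then show "emeasure noise (A (Some j, False) \<times> A (Some j, True)) = (\<Prod>w\<in>UNIV. emeasure (s (Some j, w)) (A (Some j, w)))"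
        by (simp add: emeasure_diag_gaussian_times[OF sd_pos] UNIV_bool s_def)
    qed
    also have "(\<Prod>w\<in>UNIV. emeasure (s (None, w)) (A (None, w))) * (\<Prod>j\<in>J. \<Prod>w\<in>UNIV. emeasure (s (Some j, w)) (A (Some j, w))) =
       (\<Prod>k\<in>insert None (Some ` J). \<Prod>w\<in>UNIV. emeasure (s (k, w)) (A (k, w)))"
      using J by (subst prod.insert) (auto simp: prod.reindex)
    also have "\<dots> = (\<Prod>k\<in>?I. emeasure (s k) (A k))"
      by (subst prod.cartesian_product) (rule prod.cong, auto)
    also have "\<dots> = (\<Prod>k\<in>?I. ennreal (prob (residual k -` A k \<inter> space M)))"
      by (intro prod.cong refl) (simp only: marg[symmetric] emeasure_eq_measure)
    finally show "prob (\<Inter>j\<in>?I. residual j -` A j \<inter> space M) =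
       (\<Prod>j\<in>?I. prob (residual j -` A j \<inter> space M))"
      unfolding emeasure_eq_measure by (subst (asm) prod_ennreal) (auto simp: prod_nonneg)
  qed
next
  show "insert None (Some ` J) \<times> UNIV \<noteq> {}" "finite (insert None (Some ` J) \<times> (UNIV :: bool set))"
    using J by auto
  show "sets (borel :: real measure) = sigma_sets (space borel) (sets borel)"
    by (rule sets.sigma_sets_eq[symmetric])
  show "residual k \<in> borel_measurable M" if "k \<in> insert None (Some ` J) \<times> UNIV" for k
    using measurable_residual[OF J(2) that] .
  show "Int_stable (sets (borel :: real measure))" by (rule sets.Int_stable)
  show "space (borel :: real measure) \<in> sets borel" by (rule sets.top)
  show "sets (borel :: real measure) \<subseteq> Pow (space borel)" by (rule sets.space_closed)
qed

end

section \<open>Posterior and predictive distributions\<close>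

text \<open>For fixed \<open>y\<close>, translation invariance of Lebesgue measure removes
  \<open>m y\<close> from the inner integral, which leaves \<open>c y\<close> times the mass under
  \<open>g\<close>. So \<open>c\<close> is automatically the density of \<open>X\<close> with
  respect to \<open>L\<close>, and no normalising constant has to be computed.\<close>

lemma (in prob_space) indep_pair_of_shift_density:
  fixes V :: "'a \<Rightarrow> 'e::euclidean_space" and g :: "'e \<Rightarrow> ennreal"
  assumes law: "distr M (borel \<Otimes>\<^sub>M Q) (\<lambda>\<omega>. (V \<omega>, X \<omega>)) = density (lborel \<Otimes>\<^sub>M L) (\<lambda>(v, y). c y * g (v - m y))"
    and L: "sigma_finite_measure L" "sets L = sets Q"
    and [measurable]: "V \<in> borel_measurable M" "X \<in> measurable M Q"
      "c \<in> borel_measurable Q" "m \<in> borel_measurable Q" "g \<in> borel_measurable borel"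
    and g1: "(\<integral>\<^sup>+v. g v \<partial>lborel) = 1"
  shows "indep_pair M borel (\<lambda>\<omega>. V \<omega> - m (X \<omega>)) Q X"
    and "distr M borel (\<lambda>\<omega>. V \<omega> - m (X \<omega>)) = density lborel g"
proof -
  note [measurable_cong] = L(2)
  have spL: "space L = space Q" using L(2) by (rule sets_eq_imp_space_eq)
  interpret L: sigma_finite_measure L by (rule L)
  interpret pr: pair_sigma_finite "lborel :: 'e measure" L ..
  have key: "emeasure M {\<omega> \<in> space M. V \<omega> - m (X \<omega>) \<in> F \<and> X \<omega> \<in> E} =
      emeasure (density lborel g) F * (\<integral>\<^sup>+y. c y * indicator E y \<partial>L)"
    if [measurable]: "F \<in> sets borel" "E \<in> sets Q" for F E
  proof -
    define S where "S = {x \<in> space (borel \<Otimes>\<^sub>M Q). fst x - m (snd x) \<in> F \<and> snd x \<in> E}"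
    have S[measurable]: "S \<in> sets (borel \<Otimes>\<^sub>M Q)" unfolding S_def by measurable
    have "emeasure M {\<omega> \<in> space M. V \<omega> - m (X \<omega>) \<in> F \<and> X \<omega> \<in> E} =
        emeasure (distr M (borel \<Otimes>\<^sub>M Q) (\<lambda>\<omega>. (V \<omega>, X \<omega>))) S"
      using measurable_space[of X M Q]
      by (subst emeasure_distr) (auto intro!: arg_cong[where f="emeasure M"] simp: S_def space_pair_measure)
    also have "\<dots> = (\<integral>\<^sup>+z. (case z of (v, y) \<Rightarrow> c y * g (v - m y)) * indicator S z \<partial>(lborel \<Otimes>\<^sub>M L))"
      unfolding law by (rule emeasure_density) (auto cong: sets_pair_measure_cong)
    also have "\<dots> = (\<integral>\<^sup>+y. \<integral>\<^sup>+v. c y * g (v - m y) * indicator S (v, y) \<partial>lborel \<partial>L)"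
      by (subst pr.nn_integral_snd[symmetric]) (auto cong: sets_pair_measure_cong)
    also have "\<dots> = (\<integral>\<^sup>+y. c y * indicator E y * emeasure (density lborel g) F \<partial>L)"
    proof (rule nn_integral_cong)
      fix y assume "y \<in> space L"
      then have y: "y \<in> space Q" by (simp add: spL)
      have "(\<integral>\<^sup>+v. c y * g (v - m y) * indicator S (v, y) \<partial>lborel) =
          (\<integral>\<^sup>+v. (c y * indicator E y) * (g (v - m y) * indicator F (v - m y)) \<partial>lborel)"
        using y by (intro nn_integral_cong) (auto simp: S_def space_pair_measure split: split_indicator)
      also have "\<dots> = (c y * indicator E y) * (\<integral>\<^sup>+v. g (v - m y) * indicator F (v - m y) \<partial>lborel)"
        by (rule nn_integral_cmult) measurable
      also have "(\<integral>\<^sup>+v. g (v - m y) * indicator F (v - m y) \<partial>lborel) =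
          (\<integral>\<^sup>+v. g v * indicator F v \<partial>distr lborel borel (\<lambda>v. - m y + v))"
        by (subst nn_integral_distr) (auto simp: algebra_simps)
      also have "distr lborel borel (\<lambda>v. - m y + v) = lborel"
        by (rule lborel_distr_plus)
      also have "(\<integral>\<^sup>+v. g v * indicator F v \<partial>lborel) = emeasure (density lborel g) F"
        by (simp add: emeasure_density)
      finally show "(\<integral>\<^sup>+v. c y * g (v - m y) * indicator S (v, y) \<partial>lborel) =
          c y * indicator E y * emeasure (density lborel g) F" .
    qed
    also have "\<dots> = (\<integral>\<^sup>+y. c y * indicator E y \<partial>L) * emeasure (density lborel g) F"
      by (rule nn_integral_multc) measurable
    finally show ?thesis by (simp add: mult.commute)
  qed
  have gU: "emeasure (density lborel g) UNIV = 1"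
    using g1 by (simp add: emeasure_density)
  have marg: "emeasure (distr M Q X) E = (\<integral>\<^sup>+y. c y * indicator E y \<partial>L)" if [measurable]: "E \<in> sets Q" for E
    using key[of UNIV E] gU by (simp add: emeasure_distr vimage_def Int_def conj_commute)
  interpret X: prob_space "distr M Q X" by (rule prob_space_distr) simp
  have c1: "(\<integral>\<^sup>+y. c y * indicator (space Q) y \<partial>L) = 1"
    using marg[of "space Q"] X.emeasure_space_1 by simp
  show dist: "distr M borel (\<lambda>\<omega>. V \<omega> - m (X \<omega>)) = density lborel g"
  proof (rule measure_eqI)
    fix F assume "F \<in> sets (distr M borel (\<lambda>\<omega>. V \<omega> - m (X \<omega>)))"
    then have F: "F \<in> sets borel" by simp
    have "{\<omega> \<in> space M. V \<omega> - m (X \<omega>) \<in> F \<and> X \<omega> \<in> space Q} = (\<lambda>\<omega>. V \<omega> - m (X \<omega>)) -` F \<inter> space M"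
      using measurable_space[of X M Q] by auto
    with key[OF F sets.top] c1
    show "emeasure (distr M borel (\<lambda>\<omega>. V \<omega> - m (X \<omega>))) F = emeasure (density lborel g) F"
      using F by (simp add: emeasure_distr)
  qed simp
  show "indep_pair M borel (\<lambda>\<omega>. V \<omega> - m (X \<omega>)) Q X"
    unfolding indep_pair_def
  proof (intro conjI)
    interpret Z: prob_space "distr M borel (\<lambda>\<omega>. V \<omega> - m (X \<omega>))" by (rule prob_space_distr) measurable
    have "distr M borel (\<lambda>\<omega>. V \<omega> - m (X \<omega>)) \<Otimes>\<^sub>M distr M Q X = distr M (borel \<Otimes>\<^sub>M Q) (\<lambda>\<omega>. (V \<omega> - m (X \<omega>), X \<omega>))"
    proof (rule pair_measure_eqI)
      fix F E assume "F \<in> sets (distr M borel (\<lambda>\<omega>. V \<omega> - m (X \<omega>)))" "E \<in> sets (distr M Q X)"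
      then have [measurable]: "F \<in> sets borel" "E \<in> sets Q" by simp_all
      show "emeasure (distr M borel (\<lambda>\<omega>. V \<omega> - m (X \<omega>))) F * emeasure (distr M Q X) E =
        emeasure (distr M (borel \<Otimes>\<^sub>M Q) (\<lambda>\<omega>. (V \<omega> - m (X \<omega>), X \<omega>))) (F \<times> E)"
        unfolding dist marg[OF \<open>E \<in> sets Q\<close>]
        by (subst emeasure_distr) (auto simp: key[symmetric] intro!: arg_cong[where f="emeasure M"])
    qed (auto intro: Z.sigma_finite_measure_axioms X.sigma_finite_measure_axioms cong: sets_pair_measure_cong)
    then show "distr M (borel \<Otimes>\<^sub>M Q) (\<lambda>\<omega>. (V \<omega> - m (X \<omega>), X \<omega>)) = distr M borel (\<lambda>\<omega>. V \<omega> - m (X \<omega>)) \<Otimes>\<^sub>M distr M Q X" ..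
  qed measurable
qed

lemma post_var_pos: "0 < s0 \<Longrightarrow> 0 < s \<Longrightarrow> 0 \<le> n \<Longrightarrow> 0 < post_var s0 s n"
  unfolding post_var_def by (intro positive_imp_inverse_positive add_pos_nonneg) auto

text \<open>In \<open>t\<close> the exponent is a quadratic with leading coefficient
  \<open>1 / (2 * v)\<close> and minimum at \<open>p\<close>, so completing the square leaves a
  Gaussian factor. The factor free of \<open>t\<close> is found by putting \<open>t = p\<close>;
  hence the division by the peak value \<open>normal_density 0 (sqrt v) 0\<close>.\<close>

lemma normal_posterior:
  fixes x :: "'j \<Rightarrow> real" and m0 :: real
  assumes s: "0 < s0" "0 < s" and I: "finite I"
  defines "v \<equiv> post_var s0 s (real (card I))" and "p \<equiv> post_mean m0 s0 s (real (card I)) (\<Sum>j\<in>I. x j)"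
  shows "normal_density m0 s0 t * (\<Prod>j\<in>I. normal_density t s (x j)) =
    (normal_density m0 s0 p * (\<Prod>j\<in>I. normal_density p s (x j)) / normal_density 0 (sqrt v) 0)
      * normal_density 0 (sqrt v) (t - p)"
proof -
  define a b S n where "a = 1 / s0\<^sup>2" and "b = 1 / s\<^sup>2" and "S = (\<Sum>j\<in>I. x j)" and "n = real (card I)"
  define e where "e t = a * (t - m0)\<^sup>2 / 2 + b * (\<Sum>j\<in>I. (x j - t)\<^sup>2) / 2" for t
  have v: "0 < v" unfolding v_def using s by (intro post_var_pos) auto
  have v1: "v * (a + n * b) = 1"
  proof -
    have "0 < a + n * b" using s by (auto simp: a_def b_def n_def intro!: add_pos_nonneg)
    then show ?thesis by (simp add: v_def post_var_def a_def b_def n_def)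
  qed
  have p: "p = v * (a * m0 + b * S)" by (simp add: p_def v_def post_mean_def a_def b_def S_def n_def)
  have sq: "(\<Sum>j\<in>I. (x j - t)\<^sup>2) = (\<Sum>j\<in>I. (x j)\<^sup>2) - 2 * t * S + n * t\<^sup>2" for t
    by (simp add: power2_diff sum.distrib sum_subtractf S_def n_def sum_distrib_left sum_distrib_right algebra_simps)
  have e: "e t = e p + (t - p)\<^sup>2 / (2 * v)"
  proof -
    \<comment> \<open>The squares of the data cancel in the difference; what remains is governed by
      \<open>v * (a + n * b) = 1\<close> and the formula for \<open>p\<close>.\<close>
    have "2 * v * e t - 2 * v * e p = v * (a + n * b) * (t\<^sup>2 - p\<^sup>2) - 2 * (v * (a * m0 + b * S)) * (t - p)"
      unfolding e_def sq by (simp add: power2_eq_square field_simps)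
    also have "\<dots> = (t - p)\<^sup>2"
      unfolding v1 p[symmetric] by (simp add: power2_eq_square algebra_simps)
    finally show ?thesis using v by (simp add: field_simps)
  qed
  define k where "k = (1 / sqrt (2 * pi * s0\<^sup>2)) * (1 / sqrt (2 * pi * s\<^sup>2)) ^ card I"
  have prod: "normal_density m0 s0 t * (\<Prod>j\<in>I. normal_density t s (x j)) = k * exp (- e t)" for t
  proof -
    have "(\<Prod>j\<in>I. normal_density t s (x j)) = (1 / sqrt (2 * pi * s\<^sup>2)) ^ card I * exp (- (b * (\<Sum>j\<in>I. (x j - t)\<^sup>2) / 2))"
      unfolding normal_density_def prod.distrib using I
      by (simp add: exp_sum[symmetric] sum_negf sum_divide_distrib[symmetric] b_def)
    moreover have "exp (- e t) = exp (- (t - m0)\<^sup>2 / (2 * s0\<^sup>2)) * exp (- (b * (\<Sum>j\<in>I. (x j - t)\<^sup>2) / 2))"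
      unfolding exp_add[symmetric] e_def a_def by simp
    ultimately show ?thesis
      by (simp add: normal_density_def k_def)
  qed
  have "normal_density 0 (sqrt v) (t - p) = normal_density 0 (sqrt v) 0 * exp (- ((t - p)\<^sup>2 / (2 * v)))"
    using v by (simp add: normal_density_def)
  moreover have "0 < normal_density 0 (sqrt v) 0"
    using v by (intro normal_density_pos) simp
  ultimately show ?thesis
    unfolding prod by (subst e) (simp add: exp_add exp_minus exp_diff field_simps)
qed

section \<open>Joint density of the parameters and of the outcomes seen under fixed arms\<close>

context gaussian_experiment begin

abbreviation par :: "real \<times> real \<Rightarrow> bool \<Rightarrow> real" where
  "par p w \<equiv> (if w then snd p else fst p)"

text \<open>\<open>arm\<close> is a fixed function and not the random assignment: the vector
  consists of potential outcomes alone, so Gaussian computations apply to it without selection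
  effects.\<close>

definition obs :: "('u \<times> nat) set \<Rightarrow> ('u \<times> nat \<Rightarrow> bool) \<Rightarrow> 'a \<Rightarrow> 'u \<times> nat \<Rightarrow> real" where
  "obs K arm \<omega> = (\<lambda>j\<in>K. Y (fst j) (snd j) (arm j) \<omega>)"

lemma measurable_obs:
  assumes "K \<subseteq> units" shows "obs K arm \<in> measurable M (PiM K (\<lambda>_. borel))"
  unfolding obs_def[abs_def]
proof (rule measurable_restrict)
  show "Y (fst j) (snd j) (arm j) \<in> borel_measurable M" if "j \<in> K" for j
    using assms that by (intro measurable_Y) auto
qed

text \<open>Prior density times likelihood, where each unit contributes the factor of the arm it is
  seen under. Checked on boxes: \<open>emeasure_box\<close> gives the mass as an integral over the
  parameters, and Tonelli merges it with the integrals over the outcomes.\<close>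

lemma law_obs:
  assumes K: "finite K" "K \<subseteq> units"
  shows "distr M (borel \<Otimes>\<^sub>M PiM K (\<lambda>_. borel)) (\<lambda>\<omega>. (params \<omega>, obs K arm \<omega>)) =
    density (lborel \<Otimes>\<^sub>M PiM K (\<lambda>_. lborel)) (\<lambda>(p, x). ennreal
      (normal_density (\<mu>0 False) (\<sigma>0 False) (fst p) * normal_density (\<mu>0 True) (\<sigma>0 True) (snd p) *
       (\<Prod>j\<in>K. normal_density (par p (arm j)) (\<sigma> (arm j)) (x j))))"
    (is "?L = ?R")
proof (rule measure_eqI_pair_PiM[OF K(1), where N=borel and K="\<lambda>_. borel"])
  note [measurable] = measurable_obs[OF K(2)]
  interpret product_sigma_finite "\<lambda>_. lborel :: real measure" ..
  interpret P: finite_product_sigma_finite "\<lambda>_. lborel :: real measure" K by standard (rule K)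
  have P: "sigma_finite_measure (PiM K (\<lambda>_. lborel :: real measure))" by (rule P.sigma_finite_measure_axioms)
  define d where "d p = normal_density (\<mu>0 False) (\<sigma>0 False) (fst p) * normal_density (\<mu>0 True) (\<sigma>0 True) (snd p)" for p
  have [measurable]: "d \<in> borel_measurable borel" unfolding d_def[abs_def] by measurable
  have par[measurable]: "(\<lambda>p. par p w) \<in> borel_measurable borel" for w by (cases w) auto
  have nd': "(\<lambda>z. normal_density (par (fst z) w) s (snd z j)) \<in> borel_measurable (borel \<Otimes>\<^sub>M PiM K (\<lambda>_. lborel :: real measure))"
    if "j \<in> K" for w s j
  proof -
    have [measurable]: "(\<lambda>z. snd z j) \<in> borel_measurable ((borel :: (real \<times> real) measure) \<Otimes>\<^sub>M PiM K (\<lambda>_. lborel :: real measure))"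
    proof -
      have "(\<lambda>z. snd z j) \<in> measurable ((borel :: (real \<times> real) measure) \<Otimes>\<^sub>M PiM K (\<lambda>_. lborel :: real measure)) (lborel :: real measure)"
        by (rule measurable_compose[OF measurable_snd measurable_component_singleton[OF that]])
      then show ?thesis by simp
    qed
    have "(\<lambda>z. par (fst z) w) \<in> borel_measurable (borel \<Otimes>\<^sub>M PiM K (\<lambda>_. lborel))"
      by (rule measurable_compose[OF measurable_fst par])
    then show ?thesis
      unfolding normal_density_def by (intro borel_measurable_times borel_measurable_divide borel_measurable_diff
        borel_measurable_exp borel_measurable_uminus borel_measurable_power borel_measurable_const) auto
  qed
  have nd[measurable]: "(\<lambda>z. normal_density (par (fst z) w) s (snd z)) \<in> borel_measurable (borel \<Otimes>\<^sub>M borel)" for w s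
  proof -
    have "(\<lambda>z. par (fst z) w) \<in> borel_measurable (borel \<Otimes>\<^sub>M borel)"
      by (rule measurable_compose[OF measurable_fst par])
    then show ?thesis
      unfolding normal_density_def by (intro borel_measurable_times borel_measurable_divide borel_measurable_diff
        borel_measurable_exp borel_measurable_uminus borel_measurable_power borel_measurable_const) auto
  qed
  have d_nonneg: "0 \<le> d p" for p by (simp add: d_def)
  show "sets ?L = sets (borel \<Otimes>\<^sub>M PiM K (\<lambda>_. borel))" by simp
  show "sets ?R = sets (borel \<Otimes>\<^sub>M PiM K (\<lambda>_. borel))"
    using sets_pair_measure_cong[of "lborel :: (real \<times> real) measure" borel "PiM K (\<lambda>_. lborel :: real measure)" "PiM K (\<lambda>_. borel)"]
      sets_PiM_cong[of K K "\<lambda>_. lborel :: real measure" "\<lambda>_. borel"] by simp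
  interpret L: prob_space ?L by (rule prob_space_distr) measurable
  show "emeasure ?L (space ?L) \<noteq> \<infinity>" by simp
  fix F :: "(real \<times> real) set" and E :: "'u \<times> nat \<Rightarrow> real set"
  assume F[measurable]: "F \<in> sets borel" and E: "\<And>j. j \<in> K \<Longrightarrow> E j \<in> sets borel"
  then have E'[measurable]: "PiE K E \<in> sets (PiM K (\<lambda>_. borel))"
    using K by (intro sets_PiM_I_finite) auto
  have "(\<lambda>z. d (fst z) * (\<Prod>j\<in>K. normal_density (par (fst z) (arm j)) (\<sigma> (arm j)) (snd z j))) \<in> borel_measurable (borel \<Otimes>\<^sub>M PiM K (\<lambda>_. lborel))"
    by (intro borel_measurable_times borel_measurable_prod nd') measurable
  then have dens_meas: "(\<lambda>z. ennreal (d (fst z) * (\<Prod>j\<in>K. normal_density (par (fst z) (arm j)) (\<sigma> (arm j)) (snd z j)))) \<in> borel_measurable (lborel \<Otimes>\<^sub>M PiM K (\<lambda>_. lborel))"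
    by measurable
  have box_meas: "F \<times> PiE K E \<in> sets (lborel \<Otimes>\<^sub>M PiM K (\<lambda>_. lborel))"
    using F E K by (intro pair_measureI sets_PiM_I_finite) auto
  \<comment> \<open>The arm that is not seen is left unrestricted, so its normal factor has mass
    one.\<close>
  define E2 where "E2 j = (if arm j then UNIV \<times> E j else E j \<times> UNIV)" for j
  have E2: "E2 j \<in> sets borel" if "j \<in> K" for j
    using E[OF that] unfolding E2_def borel_prod[symmetric] by auto
  have nU: "emeasure (density lborel (normal_density m (\<sigma> w))) UNIV = 1" for m w
    using prob_space.emeasure_space_1[OF prob_space_normal_density[OF sd_pos[of w], of m]] by simp
  have in_E2: "outcomes j \<omega> \<in> E2 j \<longleftrightarrow> Y (fst j) (snd j) (arm j) \<omega> \<in> E j" for j \<omega>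
    by (cases "arm j") (simp_all add: E2_def outcomes_def)
  have box: "(\<lambda>\<omega>. (params \<omega>, obs K arm \<omega>)) -` (F \<times> PiE K E) \<inter> space M =
      {\<omega> \<in> space M. params \<omega> \<in> F \<and> (\<forall>j\<in>K. outcomes j \<omega> \<in> E2 j)}"
  proof (rule set_eqI)
    fix \<omega>
    show "\<omega> \<in> (\<lambda>\<omega>. (params \<omega>, obs K arm \<omega>)) -` (F \<times> PiE K E) \<inter> space M \<longleftrightarrow>
        \<omega> \<in> {\<omega> \<in> space M. params \<omega> \<in> F \<and> (\<forall>j\<in>K. outcomes j \<omega> \<in> E2 j)}"
      by (simp add: in_E2 obs_def PiE_iff conj_ac cong: conj_cong)
  qed
  have marg: "emeasure (diag_gaussian (\<lambda>w. \<theta> w \<omega>) \<sigma>) (E2 j) =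
        (\<integral>\<^sup>+y. ennreal (normal_density (par (params \<omega>) (arm j)) (\<sigma> (arm j)) y) * indicator (E j) y \<partial>lborel)"
    if j: "j \<in> K" for j \<omega>
  proof -
    have "emeasure (diag_gaussian (\<lambda>w. \<theta> w \<omega>) \<sigma>) (E2 j) = emeasure (density lborel (normal_density (par (params \<omega>) (arm j)) (\<sigma> (arm j)))) (E j)"
    proof (cases "arm j")
      case True
      then show ?thesis
        using emeasure_diag_gaussian_times[OF sd_pos, of UNIV "E j" "\<lambda>w. \<theta> w \<omega>"] E[OF j] by (simp add: E2_def nU params_def)
    next
      case False
      then show ?thesis
        using emeasure_diag_gaussian_times[OF sd_pos, of "E j" UNIV "\<lambda>w. \<theta> w \<omega>"] E[OF j] by (simp add: E2_def nU params_def)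
    qed
    then show "emeasure (diag_gaussian (\<lambda>w. \<theta> w \<omega>) \<sigma>) (E2 j) =
        (\<integral>\<^sup>+y. ennreal (normal_density (par (params \<omega>) (arm j)) (\<sigma> (arm j)) y) * indicator (E j) y \<partial>lborel)"
      using E[OF j] by (simp add: emeasure_density)
  qed
  have "emeasure ?L (F \<times> PiE K E) = emeasure M {\<omega> \<in> space M. params \<omega> \<in> F \<and> (\<forall>j\<in>K. outcomes j \<omega> \<in> E2 j)}"
    unfolding box[symmetric] by (rule emeasure_distr) measurable
  also have "\<dots> = (\<integral>\<^sup>+\<omega>. indicator F (params \<omega>) * (\<Prod>j\<in>K. emeasure (diag_gaussian (\<lambda>w. \<theta> w \<omega>) \<sigma>) (E2 j)) \<partial>M)"
    by (rule emeasure_box[OF K F E2])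
  also have "\<dots> = (\<integral>\<^sup>+\<omega>. indicator F (params \<omega>) * (\<Prod>j\<in>K. \<integral>\<^sup>+y. ennreal (normal_density (par (params \<omega>) (arm j)) (\<sigma> (arm j)) y) * indicator (E j) y \<partial>lborel) \<partial>M)"
    by (simp only: marg cong: prod.cong)
  also have "\<dots> = (\<integral>\<^sup>+p. indicator F p * (\<Prod>j\<in>K. \<integral>\<^sup>+y. ennreal (normal_density (par p (arm j)) (\<sigma> (arm j)) y) * indicator (E j) y \<partial>lborel) \<partial>prior)"
  proof -
    have "(\<lambda>p. \<integral>\<^sup>+y. ennreal (normal_density (par p (arm j)) (\<sigma> (arm j)) y) * indicator (E j) y \<partial>lborel) \<in> borel_measurable borel" if "j \<in> K" for j
    proof -
      note [measurable] = E[OF that]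
      show ?thesis by (rule lborel.borel_measurable_nn_integral) measurable
    qed
    then show ?thesis
      by (subst distr_params[symmetric]) (simp add: nn_integral_distr)
  qed
  also have "\<dots> = (\<integral>\<^sup>+p. ennreal (d p) * (indicator F p * (\<Prod>j\<in>K. \<integral>\<^sup>+y. ennreal (normal_density (par p (arm j)) (\<sigma> (arm j)) y) * indicator (E j) y \<partial>lborel)) \<partial>lborel)"
  proof -
    have "(\<lambda>p. \<integral>\<^sup>+y. ennreal (normal_density (par p (arm j)) (\<sigma> (arm j)) y) * indicator (E j) y \<partial>lborel) \<in> borel_measurable borel" if "j \<in> K" for j
    proof -
      note [measurable] = E[OF that]
      show ?thesis by (rule lborel.borel_measurable_nn_integral) measurable
    qed
    then show ?thesis
      unfolding diag_gaussian_density[OF prior_sd_pos] d_def by (subst nn_integral_density) auto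
  qed
  also have "\<dots> = (\<integral>\<^sup>+p. \<integral>\<^sup>+x. ennreal (d p * (\<Prod>j\<in>K. normal_density (par p (arm j)) (\<sigma> (arm j)) (x j))) * indicator (F \<times> PiE K E) (p, x) \<partial>PiM K (\<lambda>_. lborel) \<partial>lborel)"
  proof (rule nn_integral_cong)
    fix p
    have "(\<integral>\<^sup>+x. ennreal (d p * (\<Prod>j\<in>K. normal_density (par p (arm j)) (\<sigma> (arm j)) (x j))) * indicator (F \<times> PiE K E) (p, x) \<partial>PiM K (\<lambda>_. lborel)) =
      (\<integral>\<^sup>+x. (ennreal (d p) * indicator F p) * (\<Prod>j\<in>K. ennreal (normal_density (par p (arm j)) (\<sigma> (arm j)) (x j)) * indicator (E j) (x j)) \<partial>PiM K (\<lambda>_. lborel))"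
    proof (rule nn_integral_cong)
      fix x assume "x \<in> space (PiM K (\<lambda>_. lborel :: real measure))"
      then have "x \<in> extensional K" by (auto simp: space_PiM PiE_def)
      have ind: "indicator (PiE K E) x = (\<Prod>j\<in>K. indicator (E j) (x j) :: ennreal)"
      proof (cases "\<forall>j\<in>K. x j \<in> E j")
        case True
        then show ?thesis using \<open>x \<in> extensional K\<close> by (subst prod.neutral) (auto simp: PiE_def)
      next
        case False
        then obtain j where j: "j \<in> K" "x j \<notin> E j" by blast
        then have "x \<notin> PiE K E" by (metis PiE_mem)
        with j show ?thesis using K by (simp add: prod_zero[OF K(1)] bexI[of _ j])
      qed
      have dP: "ennreal (d p * (\<Prod>j\<in>K. normal_density (par p (arm j)) (\<sigma> (arm j)) (x j))) =
          ennreal (d p) * (\<Prod>j\<in>K. ennreal (normal_density (par p (arm j)) (\<sigma> (arm j)) (x j)))"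
        by (subst prod_ennreal) (simp_all add: ennreal_mult d_nonneg prod_nonneg)
      show "ennreal (d p * (\<Prod>j\<in>K. normal_density (par p (arm j)) (\<sigma> (arm j)) (x j))) * indicator (F \<times> PiE K E) (p, x) =
        (ennreal (d p) * indicator F p) * (\<Prod>j\<in>K. ennreal (normal_density (par p (arm j)) (\<sigma> (arm j)) (x j)) * indicator (E j) (x j))"
        unfolding dP prod.distrib indicator_times ind fst_conv snd_conv by (simp only: mult_ac)
    qed
    also have "\<dots> = (ennreal (d p) * indicator F p) * (\<integral>\<^sup>+x. (\<Prod>j\<in>K. ennreal (normal_density (par p (arm j)) (\<sigma> (arm j)) (x j)) * indicator (E j) (x j)) \<partial>PiM K (\<lambda>_. lborel))"
    proof (rule nn_integral_cmult, rule borel_measurable_prod_ennreal)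
      fix j assume j: "j \<in> K"
      note [measurable] = E[OF j] measurable_component_singleton[OF j, of "\<lambda>_. lborel :: real measure"]
      show "(\<lambda>x. ennreal (normal_density (par p (arm j)) (\<sigma> (arm j)) (x j)) * indicator (E j) (x j)) \<in> borel_measurable (PiM K (\<lambda>_. lborel))"
        using j by measurable
    qed
    also have "(\<integral>\<^sup>+x. (\<Prod>j\<in>K. ennreal (normal_density (par p (arm j)) (\<sigma> (arm j)) (x j)) * indicator (E j) (x j)) \<partial>PiM K (\<lambda>_. lborel)) =
        (\<Prod>j\<in>K. \<integral>\<^sup>+y. ennreal (normal_density (par p (arm j)) (\<sigma> (arm j)) y) * indicator (E j) y \<partial>lborel)"
    proof (rule product_nn_integral_prod[OF K(1)])
      fix j assume j: "j \<in> K"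
      note [measurable] = E[OF j]
      show "(\<lambda>y. ennreal (normal_density (par p (arm j)) (\<sigma> (arm j)) y) * indicator (E j) y) \<in> borel_measurable lborel"
        by measurable
    qed
    finally show "ennreal (d p) * (indicator F p * (\<Prod>j\<in>K. \<integral>\<^sup>+y. ennreal (normal_density (par p (arm j)) (\<sigma> (arm j)) y) * indicator (E j) y \<partial>lborel)) =
      (\<integral>\<^sup>+x. ennreal (d p * (\<Prod>j\<in>K. normal_density (par p (arm j)) (\<sigma> (arm j)) (x j))) * indicator (F \<times> PiE K E) (p, x) \<partial>PiM K (\<lambda>_. lborel))"
      by (simp add: mult_ac)
  qed
  also have "\<dots> = (\<integral>\<^sup>+z. ennreal (d (fst z) * (\<Prod>j\<in>K. normal_density (par (fst z) (arm j)) (\<sigma> (arm j)) (snd z j))) * indicator (F \<times> PiE K E) z \<partial>(lborel \<Otimes>\<^sub>M PiM K (\<lambda>_. lborel)))"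
    by (subst sigma_finite_measure.nn_integral_fst[OF P, symmetric]) (use dens_meas box_meas in \<open>simp_all only: borel_measurable_times_ennreal borel_measurable_indicator fst_conv snd_conv\<close>)
  also have "\<dots> = emeasure ?R (F \<times> PiE K E)"
    using dens_meas box_meas by (subst emeasure_density) (simp_all add: d_def case_prod_beta)
  finally show "emeasure ?L (F \<times> PiE K E) = emeasure ?R (F \<times> PiE K E)" .
qed

end

lemma borel_measurable_Phi [measurable]: "Phi \<in> borel_measurable borel"
  by (intro borel_measurable_continuous_onI continuous_at_imp_continuous_on ballI isCont_Phi)

lemma Phi_bounds: "0 \<le> Phi x" "Phi x \<le> 1"
  unfolding Phi_def by (rule std_normal.cdf_nonneg, rule std_normal.cdf_bounded_prob)

text \<open>Fixing \<open>X = y\<close> freezes the bound while \<open>W\<close> keeps its law, and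
  Fubini does the rest. Carrying an arbitrary event \<open>E\<close> makes this the defining
  property of a conditional probability given \<open>X\<close>.\<close>

lemma (in prob_space) prob_normal_le_indep:
  assumes WX: "indep_pair M borel W Q X" and W: "distributed M lborel W (normal_density 0 s)" and s: "0 < s"
    and [measurable]: "g \<in> borel_measurable Q" "E \<in> sets Q"
  shows "prob {\<omega> \<in> space M. W \<omega> \<le> g (X \<omega>) \<and> X \<omega> \<in> E} = (\<integral>\<omega>. Phi (g (X \<omega>) / s) * indicator E (X \<omega>) \<partial>M)"
proof -
  have [measurable]: "W \<in> borel_measurable M" "X \<in> measurable M Q"
    and law: "distr M (borel \<Otimes>\<^sub>M Q) (\<lambda>\<omega>. (W \<omega>, X \<omega>)) = distr M borel W \<Otimes>\<^sub>M distr M Q X"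
    using WX by (auto simp: indep_pair_def)
  interpret w: prob_space "distr M borel W" by (rule prob_space_distr) simp
  interpret x: prob_space "distr M Q X" by (rule prob_space_distr) simp
  interpret wx: pair_prob_space "distr M borel W" "distr M Q X" ..
  define S where "S = {z \<in> space (borel \<Otimes>\<^sub>M Q). fst z \<le> g (snd z) \<and> snd z \<in> E}"
  have S[measurable]: "S \<in> sets (borel \<Otimes>\<^sub>M Q)" unfolding S_def by measurable
  have "emeasure M {\<omega> \<in> space M. W \<omega> \<le> g (X \<omega>) \<and> X \<omega> \<in> E} = emeasure (distr M (borel \<Otimes>\<^sub>M Q) (\<lambda>\<omega>. (W \<omega>, X \<omega>))) S"
    using measurable_space[of X M Q]
    by (subst emeasure_distr) (auto intro!: arg_cong[where f="emeasure M"] simp: S_def space_pair_measure)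
  also have "\<dots> = (\<integral>\<^sup>+y. emeasure (distr M borel W) ((\<lambda>w. (w, y)) -` S) \<partial>distr M Q X)"
    unfolding law by (rule wx.emeasure_pair_measure_alt2) (simp cong: sets_pair_measure_cong)
  also have "\<dots> = (\<integral>\<^sup>+y. ennreal (Phi (g y / s) * indicator E y) \<partial>distr M Q X)"
  proof (rule nn_integral_cong)
    fix y assume "y \<in> space (distr M Q X)"
    then have "(\<lambda>w. (w, y)) -` S = (if y \<in> E then {..g y} else {})"
      by (auto simp: S_def space_pair_measure)
    then show "emeasure (distr M borel W) ((\<lambda>w. (w, y)) -` S) = ennreal (Phi (g y / s) * indicator E y)"
      using prob_normal_le[OF W s, of "g y"]
      by (auto simp: emeasure_distr emeasure_eq_measure vimage_def Int_def conj_commute)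
  qed
  also have "\<dots> = (\<integral>\<^sup>+\<omega>. ennreal (Phi (g (X \<omega>) / s) * indicator E (X \<omega>)) \<partial>M)"
    by (subst nn_integral_distr) auto
  also have "\<dots> = ennreal (\<integral>\<omega>. Phi (g (X \<omega>) / s) * indicator E (X \<omega>) \<partial>M)"
    using Phi_bounds
    by (intro nn_integral_eq_integral integrable_const_bound[where B=1]) (auto split: split_indicator)
  finally show ?thesis
    using Phi_bounds by (simp add: emeasure_eq_measure integral_nonneg_AE)
qed

section \<open>Posterior errors and the predictive law of unseen outcomes\<close>

context gaussian_experiment begin

definition count :: "('u \<times> nat) set \<Rightarrow> ('u \<times> nat \<Rightarrow> bool) \<Rightarrow> bool \<Rightarrow> real" where
  "count K arm w = real (card {j \<in> K. arm j = w})"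

definition obs_total :: "('u \<times> nat) set \<Rightarrow> ('u \<times> nat \<Rightarrow> bool) \<Rightarrow> bool \<Rightarrow> ('u \<times> nat \<Rightarrow> real) \<Rightarrow> real" where
  "obs_total K arm w x = (\<Sum>j | j \<in> K \<and> arm j = w. x j)"

definition pvar :: "('u \<times> nat) set \<Rightarrow> ('u \<times> nat \<Rightarrow> bool) \<Rightarrow> bool \<Rightarrow> real" where
  "pvar K arm w = post_var (\<sigma>0 w) (\<sigma> w) (count K arm w)"

definition pmean :: "('u \<times> nat) set \<Rightarrow> ('u \<times> nat \<Rightarrow> bool) \<Rightarrow> bool \<Rightarrow> ('u \<times> nat \<Rightarrow> real) \<Rightarrow> real" where
  "pmean K arm w x = post_mean (\<mu>0 w) (\<sigma>0 w) (\<sigma> w) (count K arm w) (obs_total K arm w x)"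

lemma pvar_pos: "0 < pvar K arm w"
  unfolding pvar_def count_def using prior_sd_pos sd_pos by (intro post_var_pos) auto

lemma measurable_obs_total: "obs_total K arm w \<in> borel_measurable (PiM K (\<lambda>_. borel))"
  unfolding obs_total_def[abs_def] by (intro borel_measurable_sum measurable_component_singleton) auto

lemma measurable_pmean: "pmean K arm w \<in> borel_measurable (PiM K (\<lambda>_. borel))"
  unfolding pmean_def[abs_def] post_mean_def using measurable_obs_total[of K arm w] by measurable

definition post_error :: "('u \<times> nat) set \<Rightarrow> ('u \<times> nat \<Rightarrow> bool) \<Rightarrow> 'a \<Rightarrow> real \<times> real" where
  "post_error K arm \<omega> = params \<omega> - (pmean K arm False (obs K arm \<omega>), pmean K arm True (obs K arm \<omega>))"

text \<open>Prior and likelihood split into the two arms, and \<open>normal_posterior\<close>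
  completes the square in each. The joint density thus has the form \<open>c x * g (p - m x)\<close>
  with \<open>m\<close> the posterior means, so \<open>indep_pair_of_shift_density\<close> applies.
  The posterior is expressed through independence, without regular conditional
  distributions.\<close>

lemma posterior:
  assumes K: "finite K" "K \<subseteq> units"
  shows "indep_pair M borel (post_error K arm) (PiM K (\<lambda>_. borel)) (obs K arm)"
    and "distr M borel (post_error K arm) = diag_gaussian (\<lambda>_. 0) (\<lambda>w. sqrt (pvar K arm w))"
proof -
  define I where "I w = {j \<in> K. arm j = w}" for w
  define c where "c w x = normal_density (\<mu>0 w) (\<sigma>0 w) (pmean K arm w x) *
      (\<Prod>j\<in>I w. normal_density (pmean K arm w x) (\<sigma> w) (x j)) / normal_density 0 (sqrt (pvar K arm w)) 0" for w x
  define m where "m x = (pmean K arm False x, pmean K arm True x)" for x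
  define g where "g p = ennreal (normal_density 0 (sqrt (pvar K arm False)) (fst p) * normal_density 0 (sqrt (pvar K arm True)) (snd p))" for p
  have sp: "0 < sqrt (pvar K arm w)" for w using pvar_pos by simp
  have split: "normal_density (\<mu>0 w) (\<sigma>0 w) t * (\<Prod>j\<in>I w. normal_density t (\<sigma> w) (x j)) =
      c w x * normal_density 0 (sqrt (pvar K arm w)) (t - pmean K arm w x)" for w t x
    using normal_posterior[OF prior_sd_pos[of w] sd_pos[of w], of "I w" "\<mu>0 w" t x] K
    by (simp add: c_def pmean_def pvar_def count_def obs_total_def I_def)
  have c_nonneg: "0 \<le> c w x" for w x
    unfolding c_def by (intro divide_nonneg_nonneg mult_nonneg_nonneg prod_nonneg) auto
  have dens: "(\<lambda>(p, x). ennreal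
      (normal_density (\<mu>0 False) (\<sigma>0 False) (fst p) * normal_density (\<mu>0 True) (\<sigma>0 True) (snd p) *
       (\<Prod>j\<in>K. normal_density (par p (arm j)) (\<sigma> (arm j)) (x j)))) = (\<lambda>(p, x). ennreal (c False x * c True x) * g (p - m x))"
  proof (intro ext, clarify)
    fix p1 p2 :: real and x
    have "(\<Prod>j\<in>K. normal_density (par (p1, p2) (arm j)) (\<sigma> (arm j)) (x j)) =
        (\<Prod>j\<in>I False \<union> I True. normal_density (par (p1, p2) (arm j)) (\<sigma> (arm j)) (x j))"
      by (rule prod.cong) (auto simp: I_def)
    also have "\<dots> = (\<Prod>j\<in>I False. normal_density p1 (\<sigma> False) (x j)) * (\<Prod>j\<in>I True. normal_density p2 (\<sigma> True) (x j))"
      using K by (subst prod.union_disjoint) (auto simp: I_def intro!: arg_cong2[where f="(*)"] prod.cong)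
    finally have "normal_density (\<mu>0 False) (\<sigma>0 False) p1 * normal_density (\<mu>0 True) (\<sigma>0 True) p2 *
        (\<Prod>j\<in>K. normal_density (par (p1, p2) (arm j)) (\<sigma> (arm j)) (x j)) =
        (normal_density (\<mu>0 False) (\<sigma>0 False) p1 * (\<Prod>j\<in>I False. normal_density p1 (\<sigma> False) (x j))) *
        (normal_density (\<mu>0 True) (\<sigma>0 True) p2 * (\<Prod>j\<in>I True. normal_density p2 (\<sigma> True) (x j)))"
      by (simp only: mult_ac)
    also have "\<dots> = (c False x * c True x) * (normal_density 0 (sqrt (pvar K arm False)) (p1 - pmean K arm False x) *
        normal_density 0 (sqrt (pvar K arm True)) (p2 - pmean K arm True x))"
      unfolding split by (simp only: mult_ac)
    finally show "ennreal (normal_density (\<mu>0 False) (\<sigma>0 False) (fst (p1, p2)) * normal_density (\<mu>0 True) (\<sigma>0 True) (snd (p1, p2)) *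
       (\<Prod>j\<in>K. normal_density (par (p1, p2) (arm j)) (\<sigma> (arm j)) (x j))) = ennreal (c False x * c True x) * g ((p1, p2) - m x)"
      by (simp add: g_def m_def ennreal_mult c_nonneg)
  qed
  have law: "distr M (borel \<Otimes>\<^sub>M PiM K (\<lambda>_. borel)) (\<lambda>\<omega>. (params \<omega>, obs K arm \<omega>)) =
    density (lborel \<Otimes>\<^sub>M PiM K (\<lambda>_. lborel)) (\<lambda>(p, x). ennreal (c False x * c True x) * g (p - m x))"
    unfolding law_obs[OF K] dens ..
  interpret product_sigma_finite "\<lambda>_. lborel :: real measure" ..
  interpret P: finite_product_sigma_finite "\<lambda>_. lborel :: real measure" K by standard (rule K)
  have sf: "sigma_finite_measure (PiM K (\<lambda>_. lborel :: real measure))" by (rule P.sigma_finite_measure_axioms)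
  have sets: "sets (PiM K (\<lambda>_. lborel :: real measure)) = sets (PiM K (\<lambda>_. borel))"
    by (rule sets_PiM_cong) auto
  have cm: "c w \<in> borel_measurable (PiM K (\<lambda>_. borel))" for w
  proof -
    have nd: "(\<lambda>x. normal_density (pmean K arm w x) (\<sigma> w) (x j)) \<in> borel_measurable (PiM K (\<lambda>_. borel))" if "j \<in> I w" for j
    proof -
      have "(\<lambda>x. x j) \<in> borel_measurable (PiM K (\<lambda>_. borel :: real measure))"
        using that by (intro measurable_component_singleton) (auto simp: I_def)
      with measurable_pmean[of K arm w] show ?thesis
        unfolding normal_density_def by measurable
    qed
    show ?thesis unfolding c_def[abs_def]
      by (intro borel_measurable_divide borel_measurable_times borel_measurable_prod nd)
         (use measurable_pmean[of K arm w] in measurable)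
  qed
  have cm': "(\<lambda>x. ennreal (c False x * c True x)) \<in> borel_measurable (PiM K (\<lambda>_. borel))"
    using cm by measurable
  have mm: "m \<in> borel_measurable (PiM K (\<lambda>_. borel))"
    unfolding m_def[abs_def] using measurable_pmean[of K arm] by simp
  have gm: "g \<in> borel_measurable borel" unfolding g_def[abs_def] by measurable
  have g_eq: "density lborel g = diag_gaussian (\<lambda>_. 0) (\<lambda>w. sqrt (pvar K arm w))"
    unfolding diag_gaussian_density[OF sp] g_def ..
  have "emeasure (density lborel g) UNIV = 1"
    using prob_space.emeasure_space_1[OF prob_space_diag_gaussian[OF sp, of "\<lambda>_. 0"]] by (simp add: g_eq)
  then have g1: "(\<integral>\<^sup>+v. g v \<partial>lborel) = 1"
    using gm by (simp add: emeasure_density)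
  have e: "post_error K arm = (\<lambda>\<omega>. params \<omega> - m (obs K arm \<omega>))"
    by (simp add: fun_eq_iff post_error_def m_def)
  show "indep_pair M borel (post_error K arm) (PiM K (\<lambda>_. borel)) (obs K arm)"
    unfolding e by (rule indep_pair_of_shift_density[OF law sf sets measurable_params measurable_obs[OF K(2)] cm' mm gm g1])
  show "distr M borel (post_error K arm) = diag_gaussian (\<lambda>_. 0) (\<lambda>w. sqrt (pvar K arm w))"
    unfolding e g_eq[symmetric] by (rule indep_pair_of_shift_density[OF law sf sets measurable_params measurable_obs[OF K(2)] cm' mm gm g1])
qed

text \<open>The keys are pairs of unit and arm because a newly treated unit enters with both of its
  outcomes, with opposite signs.\<close>

definition hidden_sum :: "(('u \<times> nat) \<times> bool) set \<Rightarrow> 'a \<Rightarrow> real" where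
  "hidden_sum H \<omega> = (\<Sum>k\<in>H. (if snd k then 1 else - 1) * Y (fst (fst k)) (snd (fst k)) (snd k) \<omega>)"

text \<open>This is the square of \<open>sigma_tilde\<close> at \<open>n1 = m\<close>,
  \<open>n0 = m + M1\<close>. Parameter uncertainty is shared by all units of an arm and scales
  quadratically, unit noise only linearly.\<close>

definition pred_var :: "('u \<times> nat) set \<Rightarrow> ('u \<times> nat \<Rightarrow> bool) \<Rightarrow> real \<Rightarrow> real \<Rightarrow> real" where
  "pred_var K arm n1 n0 = n1\<^sup>2 * pvar K arm True + n1 * (\<sigma> True)\<^sup>2 + n0\<^sup>2 * pvar K arm False + n0 * (\<sigma> False)\<^sup>2"

text \<open>A hidden outcome is parameter plus noise, and a parameter is posterior mean plus error.
  The hidden sum is thus its predicted value plus a variable \<open>W\<close> made of fresh noise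
  and posterior errors; \<open>W\<close> is Gaussian with variance \<open>pred_var\<close> and
  independent of the data. \<open>disj\<close> keeps the fresh noise apart from the noise contained
  in the data.\<close>

lemma predictive:
  fixes H :: "(('u \<times> nat) \<times> bool) set" and K :: "('u \<times> nat) set" and arm :: "'u \<times> nat \<Rightarrow> bool"
  defines "n w \<equiv> real (card {k \<in> H. snd k = w})"
  assumes K: "finite K" "K \<subseteq> units" and H: "finite H" "fst ` H \<subseteq> units"
    and disj: "\<And>j. j \<in> K \<Longrightarrow> (j, arm j) \<notin> H" and n: "\<And>w. 0 < n w"
    and g: "g \<in> borel_measurable (PiM K (\<lambda>_. borel))" and E: "E \<in> sets (PiM K (\<lambda>_. borel))"
  shows "prob {\<omega> \<in> space M. hidden_sum H \<omega> \<le> g (obs K arm \<omega>) \<and> obs K arm \<omega> \<in> E} =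
    (\<integral>\<omega>. Phi ((g (obs K arm \<omega>) - (n True * pmean K arm True (obs K arm \<omega>) - n False * pmean K arm False (obs K arm \<omega>)))
        / sqrt (pred_var K arm (n True) (n False))) * indicator E (obs K arm \<omega>) \<partial>M)"
proof -
  define J where "J = K \<union> fst ` H"
  have J: "finite J" "J \<subseteq> units" using K H by (auto simp: J_def)
  define I where "I = insert None (Some ` J) \<times> (UNIV :: bool set)"
  define A :: "(('u \<times> nat) option \<times> bool) set" where "A = (\<lambda>k. (Some (fst k), snd k)) ` H"
  define C where "C = {None} \<times> (UNIV :: bool set) \<union> (\<lambda>j. (Some j, arm j)) ` K"
  define sg where "sg k = (if snd k then 1 else - 1 :: real)" for k :: "('u \<times> nat) option \<times> bool"
  define N where "N \<omega> = (\<Sum>k\<in>A. sg k * residual k \<omega>)" for \<omega>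
  have ind: "indep_vars (\<lambda>_. borel) residual I" unfolding I_def by (rule indep_residuals[OF J])
  have AI: "A \<subseteq> I" by (auto simp: A_def I_def J_def)
  have CI: "C \<subseteq> I" by (auto simp: C_def I_def J_def)
  have AC: "A \<inter> C = {}"
  proof (rule ccontr)
    assume "A \<inter> C \<noteq> {}"
    then obtain k where k: "k \<in> A" "k \<in> C" by blast
    from k(1) obtain h where h: "h \<in> H" "k = (Some (fst h), snd h)" unfolding A_def by blast
    have "fst k \<noteq> None" using h(2) by simp
    with k(2) have "k \<in> (\<lambda>j. (Some j, arm j)) ` K" unfolding C_def by force
    then obtain j where j: "j \<in> K" "k = (Some j, arm j)" by blast
    have "h = (j, arm j)" using h(2) j(2) by (simp add: prod_eq_iff)
    with h(1) have "(j, arm j) \<in> H" by simp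
    with disj[OF j(1)] show False ..
  qed
  have finA: "finite A" using H by (simp add: A_def)
  have injA: "inj_on (\<lambda>k. (Some (fst k), snd k)) H" by (auto simp: inj_on_def)
  have sumA: "(\<Sum>k\<in>A. f k) = (\<Sum>k\<in>H. f (Some (fst k), snd k))" for f :: "_ \<Rightarrow> real"
    unfolding A_def by (subst sum.reindex[OF injA]) simp
  have split: "(\<Sum>k\<in>H. f (snd k)) = n True * f True + n False * f False" for f :: "bool \<Rightarrow> real"
  proof -
    have "(\<Sum>k\<in>H. f (snd k)) = (\<Sum>k\<in>{k\<in>H. snd k = True} \<union> {k\<in>H. snd k = False}. f (snd k))"
      by (rule sum.cong) auto
    also have "\<dots> = (\<Sum>k\<in>{k\<in>H. snd k = True}. f (snd k)) + (\<Sum>k\<in>{k\<in>H. snd k = False}. f (snd k))"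
      using H by (intro sum.union_disjoint) auto
    also have "\<dots> = n True * f True + n False * f False"
      by (simp add: n_def)
    finally show ?thesis .
  qed
  have hidden: "hidden_sum H \<omega> = N \<omega> + n True * \<theta> True \<omega> - n False * \<theta> False \<omega>" for \<omega>
  proof -
    have "N \<omega> = hidden_sum H \<omega> - (\<Sum>k\<in>H. (if snd k then 1 else - 1) * \<theta> (snd k) \<omega>)"
      unfolding N_def sumA hidden_sum_def sg_def sum_subtractf[symmetric]
      by (rule sum.cong) (auto simp: algebra_simps)
    then show ?thesis using split[of "\<lambda>w. (if w then 1 else - 1) * \<theta> w \<omega>"] by simp
  qed
  have A_ne: "A \<noteq> {}" using n[of True] by (auto simp: A_def n_def card_gt_0_iff)
  define sN where "sN = sqrt (n True * (\<sigma> True)\<^sup>2 + n False * (\<sigma> False)\<^sup>2)"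
  have distN: "distributed M lborel N (normal_density 0 sN)"
  proof -
    have d: "distributed M lborel (\<lambda>\<omega>. sg k * residual k \<omega>) (normal_density 0 (\<sigma> (snd k)))" if k: "k \<in> A" for k
    proof -
      obtain j where j: "k = (Some j, snd k)" "j \<in> units" using k H by (auto simp: A_def)
      have "distributed M lborel (residual k) (normal_density 0 (\<sigma> (snd k)))"
        by (subst j(1)) (rule distributed_residual[OF j(2)])
      from normal_density_affine[OF this sd_pos, of "sg k" 0] show ?thesis
        by (auto simp: sg_def split: if_splits)
    qed
    have "distributed M lborel (\<lambda>\<omega>. \<Sum>k\<in>A. sg k * residual k \<omega>) (normal_density (\<Sum>k\<in>A. 0) (sqrt (\<Sum>k\<in>A. (\<sigma> (snd k))\<^sup>2)))"
    proof (rule sum_indep_normal[OF finA A_ne])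
      show "indep_vars (\<lambda>_. borel) (\<lambda>k \<omega>. sg k * residual k \<omega>) A"
        by (rule indep_vars_compose2[OF indep_vars_subset[OF ind AI]]) simp
    qed (use sd_pos d in auto)
    then show ?thesis
      unfolding N_def[abs_def] sumA sN_def split[of "\<lambda>w. (\<sigma> w)\<^sup>2", simplified] by (simp add: split[of "\<lambda>w. (\<sigma> w)\<^sup>2"])
  qed
  have sN: "0 < sN" unfolding sN_def using n sd_pos by (intro real_sqrt_gt_zero add_pos_pos mult_pos_pos zero_less_power)
  \<comment> \<open>Rebuild the data (\<open>xf\<close>) and the posterior errors
    (\<open>zf\<close>) from the coordinates in \<open>C\<close>, an observation being parameter
    plus residual; independence of the coordinate groups then passes to them.\<close>
  define xf where "xf y = (\<lambda>j\<in>K. y (None, arm j) + y (Some j, arm j))" for y :: "('u \<times> nat) option \<times> bool \<Rightarrow> real"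
  define zf where "zf y = (y (None, False), y (None, True)) - (pmean K arm False (xf y), pmean K arm True (xf y))"
    for y :: "('u \<times> nat) option \<times> bool \<Rightarrow> real"
  let ?C = "PiM C (\<lambda>_. borel :: real measure)" and ?A = "PiM A (\<lambda>_. borel :: real measure)"
  have comp: "(\<lambda>y. y k) \<in> borel_measurable ?C" if "k \<in> C" for k
    using that by (rule measurable_component_singleton)
  have xf: "xf \<in> measurable ?C (PiM K (\<lambda>_. borel))"
    unfolding xf_def
  proof (rule measurable_restrict)
    fix j assume "j \<in> K"
    then show "(\<lambda>y. y (None, arm j) + y (Some j, arm j)) \<in> borel_measurable ?C"
      by (intro borel_measurable_add comp) (auto simp: C_def)
  qed
  have zf: "zf \<in> borel_measurable ?C"
    unfolding zf_def
    by (intro borel_measurable_diff borel_measurable_Pair comp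
        measurable_compose[OF xf measurable_pmean]) (auto simp: C_def)
  have obs_eq: "xf (restrict (\<lambda>k. residual k \<omega>) C) = obs K arm \<omega>" for \<omega>
    by (rule ext) (auto simp: xf_def obs_def C_def)
  have err_eq: "zf (restrict (\<lambda>k. residual k \<omega>) C) = post_error K arm \<omega>" for \<omega>
    unfolding zf_def obs_eq by (auto simp: post_error_def params_def C_def)
  have N_eq: "(\<Sum>k\<in>A. sg k * restrict (\<lambda>k. residual k \<omega>) A k) = N \<omega>" for \<omega>
    unfolding N_def by (rule sum.cong) auto
  have "indep_pair M ?A (\<lambda>\<omega>. restrict (\<lambda>k. residual k \<omega>) A) ?C (\<lambda>\<omega>. restrict (\<lambda>k. residual k \<omega>) C)"
    using indep_var_restrict[OF ind AC AI CI] unfolding indep_var_iff_indep_pair .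
  from indep_pair_compose[OF this, of "\<lambda>y. \<Sum>k\<in>A. sg k * y k" borel "\<lambda>y. (zf y, xf y)" "borel \<Otimes>\<^sub>M PiM K (\<lambda>_. borel)"]
  have NZX: "indep_pair M borel N (borel \<Otimes>\<^sub>M PiM K (\<lambda>_. borel)) (\<lambda>\<omega>. (post_error K arm \<omega>, obs K arm \<omega>))"
    using xf zf unfolding obs_eq err_eq N_eq
    by (simp add: borel_measurable_sum borel_measurable_times measurable_component_singleton)
  note post = posterior[OF K, of arm]
  \<comment> \<open>The noise is independent of errors and data jointly, and the errors are
    independent of the data; rebracketing makes noise and errors together independent of the data,
    as \<open>W\<close> requires.\<close>
  have NZ_X: "indep_pair M (borel \<Otimes>\<^sub>M borel) (\<lambda>\<omega>. (N \<omega>, post_error K arm \<omega>)) (PiM K (\<lambda>_. borel)) (obs K arm)"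
    by (rule indep_pair_assoc[OF NZX post(1)])
  define L where "L \<omega> = n True * snd (post_error K arm \<omega>) - n False * fst (post_error K arm \<omega>)" for \<omega>
  define W where "W \<omega> = N \<omega> + L \<omega>" for \<omega>
  have WX: "indep_pair M borel W (PiM K (\<lambda>_. borel)) (obs K arm)"
  proof -
    have "(\<lambda>z. fst z + (n True * snd (snd z) - n False * fst (snd z))) \<in> borel_measurable (borel \<Otimes>\<^sub>M (borel :: (real \<times> real) measure))"
      by measurable
    from indep_pair_compose[OF NZ_X this, of "\<lambda>x. x" "PiM K (\<lambda>_. borel)"]
    show ?thesis by (simp add: W_def[abs_def] L_def)
  qed
  have NL: "indep_var borel N borel L"
  proof -
    have "indep_pair M borel N borel L"
      using indep_pair_compose[OF NZX, of "\<lambda>x. x" borel "\<lambda>z. n True * snd (fst z) - n False * fst (fst z)" borel]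
      by (simp add: L_def[abs_def])
    then show ?thesis by (simp add: indep_var_iff_indep_pair)
  qed
  define sL where "sL = sqrt ((n False * sqrt (pvar K arm False))\<^sup>2 + (n True * sqrt (pvar K arm True))\<^sup>2)"
  have sp: "0 < sqrt (pvar K arm w)" for w using pvar_pos by simp
  have sL: "0 < sL" unfolding sL_def using n pvar_pos by (intro real_sqrt_gt_zero add_pos_pos zero_less_power mult_pos_pos)
  have distL: "distributed M lborel L (normal_density 0 sL)"
  proof -
    let ?f = "\<lambda>\<omega>. fst (post_error K arm \<omega>)" and ?s = "\<lambda>\<omega>. snd (post_error K arm \<omega>)"
    let ?d = "\<lambda>w. density lborel (normal_density 0 (sqrt (pvar K arm w)))"
    have [measurable]: "post_error K arm \<in> borel_measurable M"
      using post(1) by (simp add: indep_pair_def)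
    interpret f: prob_space "?d False" using sp by (rule prob_space_normal_density)
    interpret s: prob_space "?d True" using sp by (rule prob_space_normal_density)
    interpret fs: pair_prob_space "?d False" "?d True" ..
    have law: "distr M borel (post_error K arm) = ?d False \<Otimes>\<^sub>M ?d True"
      using post(2) by (simp add: diag_gaussian_def)
    have lf: "distr M borel ?f = ?d False"
    proof -
      have "distr M borel ?f = distr (distr M borel (post_error K arm)) borel fst"
        by (subst distr_distr) (auto simp: comp_def)
      also have "\<dots> = distr (?d False \<Otimes>\<^sub>M ?d True) (?d False) fst"
        unfolding law by (rule distr_cong) auto
      also have "\<dots> = ?d False" by (rule s.distr_pair_fst)
      finally show ?thesis .
    qed
    have ls: "distr M borel ?s = ?d True"
    proof -
      have "distr M borel ?s = distr (distr M borel (post_error K arm)) borel snd"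
        by (subst distr_distr) (auto simp: comp_def)
      also have "\<dots> = distr (?d False \<Otimes>\<^sub>M ?d True) borel snd"
        unfolding law ..
      also have "\<dots> = ?d True"
      proof (rule measure_eqI)
        fix X assume "X \<in> sets (distr (?d False \<Otimes>\<^sub>M ?d True) borel snd)"
        then have X: "X \<in> sets borel" by simp
        have "emeasure (distr (?d False \<Otimes>\<^sub>M ?d True) borel snd) X = emeasure (?d False \<Otimes>\<^sub>M ?d True) (space (?d False) \<times> X)"
          using X by (subst emeasure_distr) (auto intro!: arg_cong2[where f=emeasure] simp: space_pair_measure)
        also have "\<dots> = emeasure (?d True) X"
          using X f.emeasure_space_1 by (subst s.emeasure_pair_measure_Times) auto
        finally show "emeasure (distr (?d False \<Otimes>\<^sub>M ?d True) borel snd) X = emeasure (?d True) X" .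
      qed simp
      finally show ?thesis .
    qed
    have "indep_var borel ?f borel ?s"
      unfolding indep_var_iff_indep_pair indep_pair_def lf ls law[symmetric] borel_prod by simp
    note ind = this
    have "distributed M lborel ?s (normal_density 0 (sqrt (pvar K arm True)))"
      using ls by (simp add: distributed_def cong: distr_cong)
    from normal_density_affine[OF this sp, of "n True" 0] have ds: "distributed M lborel (\<lambda>\<omega>. n True * ?s \<omega>) (normal_density 0 (n True * sqrt (pvar K arm True)))"
      using n[of True] by simp
    have "distributed M lborel ?f (normal_density 0 (sqrt (pvar K arm False)))"
      using lf by (simp add: distributed_def cong: distr_cong)
    from normal_density_affine[OF this sp, of "- n False" 0] have df: "distributed M lborel (\<lambda>\<omega>. - n False * ?f \<omega>) (normal_density 0 (n False * sqrt (pvar K arm False)))"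
      using n[of False] by simp
    have i: "indep_var borel (\<lambda>\<omega>. - n False * ?f \<omega>) borel (\<lambda>\<omega>. n True * ?s \<omega>)"
      using indep_var_compose[OF ind, of "\<lambda>x. - n False * x" borel "\<lambda>x. n True * x" borel] by (simp add: comp_def)
    from add_indep_normal[OF i _ _ df ds] show ?thesis
      using n sp by (simp add: L_def[abs_def] sL_def)
  qed
  have distW: "distributed M lborel W (normal_density 0 (sqrt (pred_var K arm (n True) (n False))))"
  proof -
    have "sN\<^sup>2 + sL\<^sup>2 = pred_var K arm (n True) (n False)"
      using n pvar_pos[of K arm] sd_pos unfolding sN_def sL_def pred_var_def
      by (simp add: power_mult_distrib less_imp_le)
    then show ?thesis
      using add_indep_normal[OF NL sN sL distN distL] by (simp add: W_def[abs_def])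
  qed
  have sW: "0 < sqrt (pred_var K arm (n True) (n False))"
    unfolding pred_var_def using n pvar_pos sd_pos by (intro real_sqrt_gt_zero add_pos_pos mult_pos_pos zero_less_power)
  define h where "h x = g x - (n True * pmean K arm True x - n False * pmean K arm False x)" for x
  have h: "h \<in> borel_measurable (PiM K (\<lambda>_. borel))"
    unfolding h_def[abs_def] using g measurable_pmean[of K arm True] measurable_pmean[of K arm False] by measurable
  have "hidden_sum H \<omega> \<le> g (obs K arm \<omega>) \<longleftrightarrow> W \<omega> \<le> h (obs K arm \<omega>)" for \<omega>
    unfolding hidden W_def L_def h_def post_error_def params_def by (simp add: algebra_simps)
  with prob_normal_le_indep[OF WX distW sW h E] show ?thesis
    by (simp add: h_def)
qed

end

section \<open>The treatment sizes\<close>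

text \<open>Monotone, hence Borel, on the open unit interval. Outside the closed interval there is
  no preimage and \<open>inv\<close> returns one fixed default; the two end points are single
  values. Measurability matters because \<open>\<Delta>\<close> depends on the data.\<close>

lemma borel_measurable_inv_Phi [measurable]: "inv Phi \<in> borel_measurable borel"
proof -
  have "mono_on {0<..<1} (inv Phi)"
  proof (rule mono_onI)
    fix r s :: real assume rs: "r \<in> {0<..<1}" "s \<in> {0<..<1}" "r \<le> s"
    show "inv Phi r \<le> inv Phi s"
    proof (rule ccontr)
      assume "\<not> inv Phi r \<le> inv Phi s"
      then have "Phi (inv Phi s) \<le> Phi (inv Phi r)" by (intro Phi_mono) simp
      then have "s = r" using rs Phi_inv by auto
      then show False using \<open>\<not> inv Phi r \<le> inv Phi s\<close> by simp
    qed
  qed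
  then have 1: "inv Phi \<in> borel_measurable (restrict_space borel {0<..<1})"
    by (rule borel_measurable_mono_on_fnc)
  define c where "c = (SOME x::real. False)"
  have out: "inv Phi p = c" if "p < 0 \<or> p > 1" for p
  proof -
    have "0 \<le> Phi x \<and> Phi x \<le> 1" for x
      unfolding Phi_def using std_normal.cdf_nonneg std_normal.cdf_bounded_prob by auto
    then have "\<not> Phi x = p" for x using that by (metis not_le)
    then show ?thesis by (simp add: inv_into_def c_def)
  qed
  have points: "(\<lambda>p::real. if p \<in> {0} then inv Phi 0 else if p \<in> {1} then inv Phi 1 else c) \<in> borel_measurable borel"
    by (intro measurable_If_set borel_measurable_const) auto
  have "inv Phi = (\<lambda>p. if p \<in> {0<..<1} then inv Phi p else if p \<in> {0} then inv Phi 0 else if p \<in> {1} then inv Phi 1 else c)"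
    using out by (auto simp: fun_eq_iff)
  also have "\<dots> \<in> borel_measurable borel"
  proof (subst measurable_If_restrict_space_iff)
    show "inv Phi \<in> borel_measurable (restrict_space borel {x. x \<in> {0<..<1}}) \<and>
      (\<lambda>p::real. if p \<in> {0} then inv Phi 0 else if p \<in> {1} then inv Phi 1 else c) \<in> borel_measurable (restrict_space borel {x. x \<notin> {0<..<1}})"
    proof
      show "inv Phi \<in> borel_measurable (restrict_space borel {x. x \<in> {0<..<1}})"
        using 1 by (simp only: Collect_mem_eq)
    qed (rule measurable_restrict_space1[OF points])
  qed simp
  finally show ?thesis .
qed

text \<open>Trades the set and its \<open>Max\<close> for a cascade of conditionals, a form in which
  measurability can be read off.\<close>

lemma Max_candidates:
  fixes c d :: int and P :: "int \<Rightarrow> bool"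
  defines "V \<equiv> {m \<in> {c, d}. P m}"
  shows "(if V \<noteq> {} then nat (Max V) else 0) =
    (if P c then if P d then nat (max c d) else nat c else if P d then nat d else 0)"
proof -
  have "V = (if P c then if P d then {c, d} else {c} else if P d then {d} else {})"
    by (auto simp: V_def)
  then show ?thesis by auto
qed

text \<open>Makes the size rule a function of the observations; the passage from fixed to random
  assignments rests on this.\<close>

lemma measurable_treatment_size:
  assumes [measurable]: "\<Delta> \<in> borel_measurable F" "b \<in> borel_measurable F" "\<And>w. p w \<in> borel_measurable F"
    "\<And>w. v w \<in> borel_measurable F" "M1 \<in> borel_measurable F" "S1 \<in> borel_measurable F"
  shows "(\<lambda>\<omega>. treatment_size N (\<Delta> \<omega>) (b \<omega>) (\<lambda>w. p w \<omega>) (\<lambda>w. v w \<omega>) \<sigma> (M1 \<omega>) (S1 \<omega>)) \<in> measurable F (count_space UNIV)"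
proof -
  define q where "q \<omega> = inv Phi (\<Delta> \<omega>)" for \<omega>
  define A where "A \<omega> = (q \<omega>)\<^sup>2 * (v True \<omega> + v False \<omega>) - (p True \<omega> - p False \<omega>)\<^sup>2" for \<omega>
  define B where "B \<omega> = (q \<omega>)\<^sup>2 * ((\<sigma> True)\<^sup>2 + (\<sigma> False)\<^sup>2 + 2 * v False \<omega> * M1 \<omega>)
                + 2 * (b \<omega> - S1 \<omega> + p False \<omega> * M1 \<omega>) * (p True \<omega> - p False \<omega>)" for \<omega>
  define C where "C \<omega> = (q \<omega>)\<^sup>2 * v False \<omega> * (M1 \<omega>)\<^sup>2 + (q \<omega>)\<^sup>2 * (\<sigma> False)\<^sup>2 * M1 \<omega> - (b \<omega> - S1 \<omega> + p False \<omega> * M1 \<omega>)\<^sup>2" for \<omega>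
  define D where "D \<omega> = (B \<omega>)\<^sup>2 - 4 * A \<omega> * C \<omega>" for \<omega>
  define ok where "ok \<omega> m \<longleftrightarrow> (b \<omega> - S1 \<omega> - mu_tilde (\<lambda>w. p w \<omega>) (M1 \<omega>) m) / sigma_tilde (\<lambda>w. v w \<omega>) \<sigma> (M1 \<omega>) m \<le> q \<omega>" for \<omega> and m :: real
  define c where "c \<omega> = \<lfloor>(- B \<omega> + sqrt (D \<omega>)) / (2 * A \<omega>)\<rfloor>" for \<omega>
  define d where "d \<omega> = \<lfloor>(- B \<omega> - sqrt (D \<omega>)) / (2 * A \<omega>)\<rfloor>" for \<omega>
  define P where "P \<omega> m \<longleftrightarrow> 0 \<le> m \<and> real_of_int m \<le> real N / 2 \<and> ok \<omega> (real_of_int m)" for \<omega> m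
  have [measurable]: "q \<in> borel_measurable F" unfolding q_def[abs_def] by measurable
  have [measurable]: "A \<in> borel_measurable F" unfolding A_def[abs_def] by measurable
  have [measurable]: "B \<in> borel_measurable F" unfolding B_def[abs_def] by measurable
  have [measurable]: "C \<in> borel_measurable F" unfolding C_def[abs_def] by measurable
  have [measurable]: "D \<in> borel_measurable F" unfolding D_def[abs_def] by measurable
  have [measurable]: "c \<in> measurable F (count_space UNIV)" unfolding c_def[abs_def] by measurable
  have [measurable]: "d \<in> measurable F (count_space UNIV)" unfolding d_def[abs_def] by measurable
  have ok: "Measurable.pred F (\<lambda>\<omega>. ok \<omega> (r \<omega>))" if [measurable]: "r \<in> borel_measurable F" for r
    unfolding ok_def mu_tilde_def sigma_tilde_def by measurable
  note [measurable] = ok[of "\<lambda>_. real (N div 2)"]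
  have P: "Measurable.pred F (\<lambda>\<omega>. P \<omega> (r \<omega>))" if [measurable]: "r \<in> measurable F (count_space UNIV)" for r
  proof -
    have [measurable]: "(\<lambda>\<omega>. real_of_int (r \<omega>)) \<in> borel_measurable F"
      by (rule measurable_compose[OF that]) simp
    note [measurable] = ok[of "\<lambda>\<omega>. real_of_int (r \<omega>)"]
    show ?thesis unfolding P_def by measurable
  qed
  note [measurable] = P[of c] P[of d]
  have nat [measurable]: "(\<lambda>\<omega>. nat (r \<omega>)) \<in> measurable F (count_space UNIV)" if "r \<in> measurable F (count_space UNIV)" for r
    by (rule measurable_compose[OF that]) simp
  have "(\<lambda>\<omega>. treatment_size N (\<Delta> \<omega>) (b \<omega>) (\<lambda>w. p w \<omega>) (\<lambda>w. v w \<omega>) \<sigma> (M1 \<omega>) (S1 \<omega>)) =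
      (\<lambda>\<omega>. if \<Delta> \<omega> = 0 then 0 else if ok \<omega> (real (N div 2)) then N div 2 else if D \<omega> < 0 then 0
        else if P \<omega> (c \<omega>) then if P \<omega> (d \<omega>) then nat (if c \<omega> \<le> d \<omega> then d \<omega> else c \<omega>) else nat (c \<omega>)
        else if P \<omega> (d \<omega>) then nat (d \<omega>) else 0)"
    unfolding treatment_size_def Let_def Max_candidates P_def ok_def c_def d_def D_def C_def B_def A_def q_def max_def
    ..
  also have "\<dots> \<in> measurable F (count_space UNIV)" by measurable
  finally show ?thesis .
qed

text \<open>A positive result comes from a branch in which the test was applied to that very
  integer: the half size directly, a root only after its floor has been taken. For
  \<open>\<Delta> = 0\<close> the result is \<open>0\<close>, so that case drops out too.\<close>

lemma treatment_size_ok: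
  assumes "m = treatment_size N \<Delta> b p v \<sigma> M1 S1" and "0 < m"
  shows "\<Delta> \<noteq> 0 \<and> (b - S1 - mu_tilde p M1 (real m)) / sigma_tilde v \<sigma> M1 (real m) \<le> inv Phi \<Delta>"
proof -
  \<comment> \<open>The test and the candidate set are kept abstract, so that the case split sees
    only the branching.\<close>
  have *: "\<Delta> \<noteq> 0 \<and> ok (real m)"
    if "m = (if \<Delta> = 0 then 0 else if ok (real n) then n else if D < (0::real) then 0
      else if {m \<in> cs. 0 \<le> m \<and> Q m \<and> ok (real_of_int m)} \<noteq> {}
        then nat (Max {m \<in> cs. 0 \<le> m \<and> Q m \<and> ok (real_of_int m)}) else 0)"
      and "finite cs" for ok :: "real \<Rightarrow> bool" and n D cs Q
  proof (cases "{m \<in> cs. 0 \<le> m \<and> Q m \<and> ok (real_of_int m)} = {}")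
    case True
    with that(1) \<open>0 < m\<close> show ?thesis by (simp split: if_splits)
  next
    case False
    with \<open>finite cs\<close> have "Max {m \<in> cs. 0 \<le> m \<and> Q m \<and> ok (real_of_int m)} \<in> {m \<in> cs. 0 \<le> m \<and> Q m \<and> ok (real_of_int m)}"
      by (intro Max_in) auto
    with that(1) \<open>0 < m\<close> show ?thesis by (auto split: if_splits)
  qed
  show ?thesis
    by (rule *[OF assms(1)[unfolded treatment_size_def Let_def]]) simp
qed

text \<open>The event where the conditional expectation of \<open>f\<close> is positive belongs to
  \<open>F\<close>; testing on it shows that this expectation is nonpositive almost everywhere. The
  weight \<open>h\<close> is then pulled out, the bound \<open>c\<close> making the product
  integrable.\<close>

lemma integral_mult_nonpos_of_set_integral_nonpos:
  fixes f h :: "'a \<Rightarrow> real"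
  assumes "finite_measure_subalgebra M F" and f: "integrable M f"
    and sets: "\<And>G. G \<in> sets F \<Longrightarrow> (\<integral>\<omega>. f \<omega> * indicator G \<omega> \<partial>M) \<le> 0"
    and h: "h \<in> borel_measurable F" "\<And>\<omega>. \<omega> \<in> space M \<Longrightarrow> 0 \<le> h \<omega>" "\<And>\<omega>. \<omega> \<in> space M \<Longrightarrow> h \<omega> \<le> c"
  shows "(\<integral>\<omega>. h \<omega> * f \<omega> \<partial>M) \<le> 0"
proof -
  interpret finite_measure_subalgebra M F by fact
  note [measurable] = measurable_from_subalg[OF subalg h(1)] h(1)
  have spF: "space F = space M" using subalg by (simp add: subalgebra_def)
  let ?g = "real_cond_exp M F f"
  define G where "G = {\<omega> \<in> space M. 0 < ?g \<omega>}"
  have G: "G \<in> sets F" unfolding G_def spF[symmetric] by measurable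
  then have GM: "G \<in> sets M" using subalg by (auto simp: subalgebra_def)
  have int: "integrable M ?g" using f by (rule real_cond_exp_int)
  have intG: "integrable M (\<lambda>\<omega>. ?g \<omega> * indicator G \<omega>)"
    using GM int by (rule integrable_real_mult_indicator)
  have "(\<integral>\<omega>. ?g \<omega> * indicator G \<omega> \<partial>M) \<le> 0"
    using sets[OF G] real_cond_exp_intA[OF f G] by (simp add: set_lebesgue_integral_def mult.commute)
  moreover have nn: "AE \<omega> in M. 0 \<le> ?g \<omega> * indicator G \<omega>"
    by (auto simp: G_def split: split_indicator)
  ultimately have "(\<integral>\<omega>. ?g \<omega> * indicator G \<omega> \<partial>M) = 0"
    by (intro antisym integral_nonneg_AE)
  then have "AE \<omega> in M. ?g \<omega> * indicator G \<omega> = 0"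
    using integral_nonneg_eq_0_iff_AE[OF intG nn] by simp
  then have le: "AE \<omega> in M. ?g \<omega> \<le> 0"
    by (rule AE_mp) (auto intro!: AE_I2 simp: G_def split: split_indicator_asm)
  have hf: "integrable M (\<lambda>\<omega>. h \<omega> * f \<omega>)"
  proof (rule Bochner_Integration.integrable_bound)
    show "integrable M (\<lambda>\<omega>. c * f \<omega>)" using f by simp
    show "(\<lambda>\<omega>. h \<omega> * f \<omega>) \<in> borel_measurable M" using f by measurable
    show "AE \<omega> in M. norm (h \<omega> * f \<omega>) \<le> norm (c * f \<omega>)"
    proof (rule AE_I2)
      fix \<omega> assume "\<omega> \<in> space M"
      then have "\<bar>h \<omega>\<bar> \<le> \<bar>c\<bar>" using h(2,3)[of \<omega>] by linarith
      then show "norm (h \<omega> * f \<omega>) \<le> norm (c * f \<omega>)"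
        by (simp add: abs_mult mult_right_mono)
    qed
  qed
  have "(\<integral>\<omega>. h \<omega> * f \<omega> \<partial>M) = (\<integral>\<omega>. h \<omega> * ?g \<omega> \<partial>M)"
    using hf h(1) f by (intro real_cond_exp_intg(2)[symmetric]) auto
  also have "\<dots> \<le> 0"
  proof -
    have "AE \<omega> in M. 0 \<le> - (h \<omega> * ?g \<omega>)"
      using le AE_space by eventually_elim (use h in \<open>auto simp: mult_nonneg_nonpos\<close>)
    from integral_nonneg_AE[OF this] show ?thesis by simp
  qed
  finally show ?thesis .
qed

section \<open>Observations and random assignment\<close>

definition pairs :: "nat \<Rightarrow> (nat \<Rightarrow> 'u set) \<Rightarrow> ('u \<times> nat) set" where
  "pairs n A = {(i, k). k \<in> {1..n} \<and> i \<in> A k}"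

lemma pairs_eq_image: "pairs n A = prod.swap ` (SIGMA k:{1..n}. A k)"
  by (auto simp: pairs_def)

lemma finite_pairs: "(\<And>k. k \<in> {1..n} \<Longrightarrow> finite (A k)) \<Longrightarrow> finite (pairs n A)"
  unfolding pairs_eq_image by (intro finite_imageI finite_SigmaI) auto

lemma sum_pairs:
  assumes "\<And>k. k \<in> {1..n} \<Longrightarrow> finite (A k)"
  shows "(\<Sum>j\<in>pairs n A. f j) = (\<Sum>k=1..n. \<Sum>i\<in>A k. f (i, k))"
proof -
  have "(\<Sum>j\<in>pairs n A. f j) = (\<Sum>j\<in>(SIGMA k:{1..n}. A k). f (prod.swap j))"
    unfolding pairs_eq_image by (subst sum.reindex) (auto simp: inj_on_def)
  also have "\<dots> = (\<Sum>k=1..n. \<Sum>i\<in>A k. f (i, k))"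
    using assms by (subst sum.Sigma) (auto simp: case_prod_beta prod.swap_def)
  finally show ?thesis .
qed

lemma card_pairs:
  assumes "\<And>k. k \<in> {1..n} \<Longrightarrow> finite (A k)"
  shows "card (pairs n A) = (\<Sum>k=1..n. card (A k))"
  using sum_pairs[of n A "\<lambda>_. 1 :: nat", OF assms] by simp

locale rrc_experiment = gaussian_experiment M \<N> \<mu>0 \<sigma>0 \<sigma> \<theta> Y
  for M :: "'a measure" and \<N> :: "nat \<Rightarrow> 'u set" and \<mu>0 \<sigma>0 \<sigma> \<theta> Y +
  fixes \<Delta> b :: "nat \<Rightarrow> 'a \<Rightarrow> real" and m :: "nat \<Rightarrow> 'a \<Rightarrow> nat"
    and \<T> :: "nat \<Rightarrow> 'a \<Rightarrow> 'u set" and T :: "'a \<Rightarrow> nat" and B \<delta> :: real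
  assumes B: "B < 0" and \<delta>: "0 \<le> \<delta>" "\<delta> < 1"
    and finite_units: "1 \<le> t \<Longrightarrow> finite (\<N> t)"
    and assignment: "random_assignment M \<N> \<theta> Y m \<T> T"
    and stop: "stopping_time (observed M \<N> \<T> Y) T"
    and choices: "1 \<le> t \<Longrightarrow> \<Delta> t \<in> borel_measurable (observed M \<N> \<T> Y (t - 1))"
      "1 \<le> t \<Longrightarrow> b t \<in> borel_measurable (observed M \<N> \<T> Y (t - 1))"
    and algorithm: "\<omega> \<in> space M \<Longrightarrow>
      algorithm_run B \<delta> \<mu>0 \<sigma>0 \<sigma> (\<lambda>t. card (\<N> t)) (\<lambda>t. \<Delta> t \<omega>) (\<lambda>t. b t \<omega>) (\<lambda>t. m t \<omega>)
        (\<lambda>w t. observed_sum \<N> \<T> Y w t \<omega>) (T \<omega>)"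
begin

abbreviation F :: "nat \<Rightarrow> 'a measure" where "F \<equiv> observed M \<N> \<T> Y"

lemma measurable_assignment: "1 \<le> k \<Longrightarrow> \<T> k \<in> measurable M (count_space (Pow (\<N> k)))"
  using assignment by (simp add: random_assignment_def)

lemma assigned_subset: "\<omega> \<in> space M \<Longrightarrow> 1 \<le> k \<Longrightarrow> \<T> k \<omega> \<subseteq> \<N> k"
  using measurable_space[OF measurable_assignment] by auto

lemma finite_assigned: "\<omega> \<in> space M \<Longrightarrow> 1 \<le> k \<Longrightarrow> finite (\<T> k \<omega>)"
  using assigned_subset finite_units finite_subset by blast

lemma card_assigned: "\<omega> \<in> space M \<Longrightarrow> 1 \<le> k \<Longrightarrow> k \<le> T \<omega> \<Longrightarrow> card (\<T> k \<omega>) = m k \<omega>"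
  using assignment by (simp add: random_assignment_def)

lemma sets_assigned_eq: assumes "1 \<le> k" shows "\<T> k -` {A} \<inter> space M \<in> sets M"
proof (cases "A \<subseteq> \<N> k")
  case True
  then show ?thesis by (intro measurable_sets[OF measurable_assignment[OF assms]]) auto
next
  case False
  then have "\<T> k -` {A} \<inter> space M = {}" using assigned_subset[OF _ assms] by auto
  then show ?thesis by simp
qed

lemma sets_assigned_mem: assumes "1 \<le> k" shows "{\<omega> \<in> space M. i \<in> \<T> k \<omega>} \<in> sets M"
proof -
  have "{\<omega> \<in> space M. i \<in> \<T> k \<omega>} = \<T> k -` {A \<in> Pow (\<N> k). i \<in> A} \<inter> space M"
    using assigned_subset[OF _ assms] by auto
  also have "\<dots> \<in> sets M" by (rule measurable_sets[OF measurable_assignment[OF assms]]) auto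
  finally show ?thesis .
qed

lemma measurable_observed_outcome:
  assumes "1 \<le> k" "i \<in> \<N> k" shows "(\<lambda>\<omega>. Y i k (i \<in> \<T> k \<omega>) \<omega>) \<in> borel_measurable M"
proof -
  have "(\<lambda>\<omega>. Y i k (i \<in> \<T> k \<omega>) \<omega>) = (\<lambda>\<omega>. if i \<in> \<T> k \<omega> then Y i k True \<omega> else Y i k False \<omega>)"
    by (simp add: fun_eq_iff)
  also have "\<dots> \<in> borel_measurable M"
    using measurable_Y[of i k] assms sets_assigned_mem[OF assms(1)]
    by (intro measurable_If) (auto simp: units_def)
  finally show ?thesis .
qed

section \<open>The information available after each stage\<close>

definition gens :: "nat \<Rightarrow> 'a set set" where
  "gens t = assignment_events M \<T> t \<union> observed_outcome_events M \<N> \<T> Y t"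

lemma assignment_events_sub: "assignment_events M \<T> t \<subseteq> sets M"
  using sets_assigned_eq by (auto simp: assignment_events_def)

lemma gens_sub: "gens t \<subseteq> sets M"
  using assignment_events_sub measurable_sets[OF measurable_observed_outcome]
  by (auto simp: gens_def observed_outcome_events_def)

lemma gens_Pow: "gens t \<subseteq> Pow (space M)"
  using gens_sub sets.space_closed[of M] by blast

lemma sets_F: "sets (F t) = sigma_sets (space M) (gens t)"
  unfolding observed_def gens_def[symmetric] by (rule sets_measure_of[OF gens_Pow])

lemma space_F [simp]: "space (F t) = space M"
  unfolding observed_def by (simp add: space_measure_of_conv)

lemma sets_F_sub: "sets (F t) \<subseteq> sets M"
  unfolding sets_F by (rule sets.sigma_sets_subset[OF gens_sub])

lemma subalgebra_F: "subalgebra M (F t)"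
  using sets_F_sub by (simp add: subalgebra_def)

lemma finite_measure_subalgebra_F: "finite_measure_subalgebra M (F t)"
  by unfold_locales (rule subalgebra_F)

lemma sets_F_mono: assumes "s \<le> t" shows "sets (F s) \<subseteq> sets (F t)"
proof -
  have "assignment_events M \<T> s \<subseteq> assignment_events M \<T> t"
    unfolding assignment_events_def using assms by (intro subsetI) (auto intro: order_trans)
  moreover have "observed_outcome_events M \<N> \<T> Y s \<subseteq> observed_outcome_events M \<N> \<T> Y t"
  proof
    fix G assume "G \<in> observed_outcome_events M \<N> \<T> Y s"
    then obtain i k E where "G = (\<lambda>\<omega>. Y i k (i \<in> \<T> k \<omega>) \<omega>) -` E \<inter> space M" "1 \<le> k" "k \<le> s" "i \<in> \<N> k" "E \<in> sets borel"
      unfolding observed_outcome_events_def by blast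
    moreover from this assms have "k \<le> t" by simp
    ultimately show "G \<in> observed_outcome_events M \<N> \<T> Y t"
      unfolding observed_outcome_events_def by blast
  qed
  ultimately show ?thesis
    unfolding sets_F gens_def by (intro sigma_sets_mono') (rule Un_mono)
qed

lemma measurable_F_mono: "s \<le> t \<Longrightarrow> f \<in> measurable (F s) N \<Longrightarrow> f \<in> measurable (F t) N"
  using sets_F_mono[of s t] by (auto simp: measurable_def)

lemma measurable_F_M: "f \<in> measurable (F s) N \<Longrightarrow> f \<in> measurable M N"
  by (rule measurable_from_subalg[OF subalgebra_F])

lemma assigned_eq_in_F: assumes "1 \<le> k" "k \<le> t" shows "\<T> k -` {A} \<inter> space M \<in> sets (F t)"
  unfolding sets_F using assms by (intro sigma_sets.Basic) (auto simp: gens_def assignment_events_def)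

lemma assigned_mem_in_F: assumes "1 \<le> k" "k \<le> t" shows "{\<omega> \<in> space (F t). i \<in> \<T> k \<omega>} \<in> sets (F t)"
proof -
  have "{\<omega> \<in> space (F t). i \<in> \<T> k \<omega>} = (\<Union>A\<in>{A \<in> Pow (\<N> k). i \<in> A}. \<T> k -` {A} \<inter> space M)"
    using assigned_subset[OF _ assms(1)] by auto
  also have "\<dots> \<in> sets (F t)"
    using assms finite_units[OF assms(1)] by (intro sets.finite_UN assigned_eq_in_F) auto
  finally show ?thesis .
qed

lemma observed_outcome_F:
  assumes "1 \<le> k" "k \<le> t" "i \<in> \<N> k" shows "(\<lambda>\<omega>. Y i k (i \<in> \<T> k \<omega>) \<omega>) \<in> borel_measurable (F t)"
proof (rule measurableI)
  fix E :: "real set" assume "E \<in> sets borel"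
  then show "(\<lambda>\<omega>. Y i k (i \<in> \<T> k \<omega>) \<omega>) -` E \<inter> space (F t) \<in> sets (F t)"
    using assms unfolding sets_F space_F gens_def observed_outcome_events_def by (intro sigma_sets.Basic UnI2) blast
qed simp

lemma observed_sum_F: "observed_sum \<N> \<T> Y w t \<in> borel_measurable (F t)"
proof -
  \<comment> \<open>The random index set is replaced by the fixed finite set of units with an
    indicator, so that each summand is measurable on its own.\<close>
  have "(\<lambda>\<omega>. \<Sum>k=1..t. \<Sum>i\<in>\<N> k. if (i \<in> \<T> k \<omega>) = w then Y i k (i \<in> \<T> k \<omega>) \<omega> else 0) \<in> borel_measurable (F t)"
  proof (intro borel_measurable_sum measurable_If observed_outcome_F borel_measurable_const)
    fix k i assume "k \<in> {1..t}" "i \<in> \<N> k"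
    then have k: "1 \<le> k" "k \<le> t" by auto
    show "{\<omega> \<in> space (F t). (i \<in> \<T> k \<omega>) = w} \<in> sets (F t)"
    proof (cases w)
      case True
      then show ?thesis using assigned_mem_in_F[OF k, of i] by simp
    next
      case False
      then have "{\<omega> \<in> space (F t). (i \<in> \<T> k \<omega>) = w} = space (F t) - {\<omega> \<in> space (F t). i \<in> \<T> k \<omega>}" by auto
      then show ?thesis using sets.compl_sets[OF assigned_mem_in_F[OF k, of i]] by simp
    qed
  qed auto
  also have "(\<lambda>\<omega>. \<Sum>k=1..t. \<Sum>i\<in>\<N> k. if (i \<in> \<T> k \<omega>) = w then Y i k (i \<in> \<T> k \<omega>) \<omega> else 0) \<in> borel_measurable (F t) \<longleftrightarrow>
      observed_sum \<N> \<T> Y w t \<in> borel_measurable (F t)"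
  proof (rule measurable_cong)
    fix \<omega> assume "\<omega> \<in> space (F t)"
    then have \<omega>: "\<omega> \<in> space M" by simp
    show "(\<Sum>k=1..t. \<Sum>i\<in>\<N> k. if (i \<in> \<T> k \<omega>) = w then Y i k (i \<in> \<T> k \<omega>) \<omega> else 0) = observed_sum \<N> \<T> Y w t \<omega>"
      unfolding observed_sum_def
    proof (rule sum.cong[OF refl])
      fix k assume "k \<in> {1..t}"
      then have k: "1 \<le> k" by simp
      have sub: "(if w then \<T> k \<omega> else \<N> k - \<T> k \<omega>) \<subseteq> \<N> k"
        using assigned_subset[OF \<omega> k] by auto
      show "(\<Sum>i\<in>\<N> k. if (i \<in> \<T> k \<omega>) = w then Y i k (i \<in> \<T> k \<omega>) \<omega> else 0) =
        (\<Sum>i\<in>(if w then \<T> k \<omega> else \<N> k - \<T> k \<omega>). Y i k w \<omega>)"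
        by (rule sum.mono_neutral_cong_right[OF finite_units[OF k] sub]) (auto split: if_splits)
    qed
  qed
  finally show ?thesis .
qed

lemma card_assigned_F:
  assumes "1 \<le> k" "k \<le> t" shows "(\<lambda>\<omega>. real (card (\<T> k \<omega>))) \<in> borel_measurable (F t)"
proof -
  have "(\<lambda>\<omega>. \<Sum>i\<in>\<N> k. if i \<in> \<T> k \<omega> then 1 else 0 :: real) \<in> borel_measurable (F t)"
    using assigned_mem_in_F[OF assms] by (intro borel_measurable_sum measurable_If) auto
  also have "(\<lambda>\<omega>. \<Sum>i\<in>\<N> k. if i \<in> \<T> k \<omega> then 1 else 0 :: real) \<in> borel_measurable (F t) \<longleftrightarrow>
      (\<lambda>\<omega>. real (card (\<T> k \<omega>))) \<in> borel_measurable (F t)"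
  proof (rule measurable_cong)
    fix \<omega> assume "\<omega> \<in> space (F t)"
    then have "\<T> k \<omega> \<subseteq> \<N> k" using assigned_subset[OF _ assms(1)] by simp
    then have "\<N> k \<inter> {i. i \<in> \<T> k \<omega>} = \<T> k \<omega>" by auto
    then show "(\<Sum>i\<in>\<N> k. if i \<in> \<T> k \<omega> then 1 else 0 :: real) = real (card (\<T> k \<omega>))"
      using finite_units[OF assms(1)] by (simp add: sum.If_cases)
  qed
  finally show ?thesis .
qed

text \<open>Counts are taken from the assignments and not from \<open>m\<close>: the assignments are
  observable by construction, whereas \<open>m\<close> is tied to them only up to
  \<open>T\<close>.\<close>

definition assigned_size :: "bool \<Rightarrow> nat \<Rightarrow> 'a \<Rightarrow> real" where
  "assigned_size w t \<omega> = cum_size (\<lambda>k. card (\<N> k)) (\<lambda>k. card (\<T> k \<omega>)) w t"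

lemma assigned_size_F: "assigned_size w t \<in> borel_measurable (F t)"
  unfolding assigned_size_def[abs_def] cum_size_def
  by (cases w) (auto intro!: borel_measurable_sum borel_measurable_diff card_assigned_F)

text \<open>The size rule extended to all sample points, including those where the experiment has
  already ended; for \<open>1 \<le> t \<le> T\<close> it agrees with \<open>m t\<close>.\<close>

definition size_fun :: "nat \<Rightarrow> 'a \<Rightarrow> nat" where
  "size_fun t \<omega> = treatment_size (card (\<N> t)) (\<Delta> t \<omega>) (b t \<omega>)
     (\<lambda>w. post_mean (\<mu>0 w) (\<sigma>0 w) (\<sigma> w) (assigned_size w (t - 1) \<omega>) (observed_sum \<N> \<T> Y w (t - 1) \<omega>))
     (\<lambda>w. post_var (\<sigma>0 w) (\<sigma> w) (assigned_size w (t - 1) \<omega>))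
     \<sigma> (assigned_size True (t - 1) \<omega>) (observed_sum \<N> \<T> Y True (t - 1) \<omega>)"

lemma size_fun_F:
  assumes "1 \<le> t" shows "size_fun t \<in> measurable (F (t - 1)) (count_space UNIV)"
proof -
  note [measurable] = assigned_size_F[of _ "t - 1"] observed_sum_F[of _ "t - 1"]
  have "(\<lambda>\<omega>. post_var (\<sigma>0 w) (\<sigma> w) (assigned_size w (t - 1) \<omega>)) \<in> borel_measurable (F (t - 1))" for w
    unfolding post_var_def by measurable
  moreover have "(\<lambda>\<omega>. post_mean (\<mu>0 w) (\<sigma>0 w) (\<sigma> w) (assigned_size w (t - 1) \<omega>) (observed_sum \<N> \<T> Y w (t - 1) \<omega>)) \<in> borel_measurable (F (t - 1))" for w
    unfolding post_mean_def post_var_def by measurable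
  ultimately show ?thesis
    unfolding size_fun_def[abs_def]
    by (rule measurable_treatment_size[OF choices[OF assms] _ _ assigned_size_F observed_sum_F, rotated])
qed

lemma cum_size_eq:
  assumes "\<omega> \<in> space M" "t \<le> T \<omega>"
  shows "cum_size (\<lambda>k. card (\<N> k)) (\<lambda>k. m k \<omega>) w t = assigned_size w t \<omega>"
  unfolding assigned_size_def cum_size_def using assms card_assigned by (intro sum.cong) auto

lemma algorithm_at:
  assumes "\<omega> \<in> space M" "1 \<le> t" "t \<le> T \<omega>"
  shows "(\<Prod>k=1..<t. 1 - \<Delta> k \<omega>) > 1 - \<delta>"
    and "\<Delta> t \<omega> \<in> {0..1 - (1 - \<delta>) / (\<Prod>k=1..<t. 1 - \<Delta> k \<omega>)}"
    and "B \<le> b t \<omega>"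
    and "m t \<omega> = size_fun t \<omega>"
proof -
  have run: "(\<Prod>k=1..<t. 1 - \<Delta> k \<omega>) > 1 - \<delta> \<and>
        \<Delta> t \<omega> \<in> {0..1 - (1 - \<delta>) / (\<Prod>k=1..<t. 1 - \<Delta> k \<omega>)} \<and> b t \<omega> \<ge> B \<and>
        m t \<omega> = treatment_size (card (\<N> t)) (\<Delta> t \<omega>) (b t \<omega>)
                (\<lambda>w. post_mean (\<mu>0 w) (\<sigma>0 w) (\<sigma> w) (cum_size (\<lambda>k. card (\<N> k)) (\<lambda>k. m k \<omega>) w (t - 1)) (observed_sum \<N> \<T> Y w (t - 1) \<omega>))
                (\<lambda>w. post_var (\<sigma>0 w) (\<sigma> w) (cum_size (\<lambda>k. card (\<N> k)) (\<lambda>k. m k \<omega>) w (t - 1)))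
                \<sigma> (cum_size (\<lambda>k. card (\<N> k)) (\<lambda>k. m k \<omega>) True (t - 1)) (observed_sum \<N> \<T> Y True (t - 1) \<omega>)"
    by (rule bspec[OF algorithm[OF assms(1), unfolded algorithm_run_def]]) (use assms(2,3) in simp)
  have "t - 1 \<le> T \<omega>" using assms by simp
  note eq = cum_size_eq[OF assms(1) this]
  show "(\<Prod>k=1..<t. 1 - \<Delta> k \<omega>) > 1 - \<delta>" by (rule run[THEN conjunct1])
  show "\<Delta> t \<omega> \<in> {0..1 - (1 - \<delta>) / (\<Prod>k=1..<t. 1 - \<Delta> k \<omega>)}" by (rule run[THEN conjunct2, THEN conjunct1])
  show "B \<le> b t \<omega>" by (rule run[THEN conjunct2, THEN conjunct2, THEN conjunct1])
  show "m t \<omega> = size_fun t \<omega>"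
    unfolding size_fun_def eq[symmetric] by (rule run[THEN conjunct2, THEN conjunct2, THEN conjunct2])
qed

text \<open>Stage \<open>t\<close> runs iff the experiment has not ended by \<open>t - 1\<close>,
  and a stopping time decides this with the information of stage \<open>t - 1\<close>.\<close>

lemma running_F: assumes "1 \<le> t" shows "{\<omega> \<in> space M. t \<le> T \<omega>} \<in> sets (F (t - 1))"
proof -
  have "{\<omega> \<in> space M. t \<le> T \<omega>} = {\<omega> \<in> space (F (t - 1)). t - 1 < T \<omega>}" using assms by auto
  also have "\<dots> \<in> sets (F (t - 1))"
    using stopping_timeD2[OF stop, of "t - 1"] by (simp add: pred_def)
  finally show ?thesis .
qed

lemma measurable_stop [measurable]: "T \<in> measurable M (count_space UNIV)"
proof (rule measurableI)
  fix A :: "nat set"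
  have le: "{\<omega> \<in> space M. T \<omega> \<le> n} \<in> sets M" for n
    using stopping_timeD[OF stop, of n] sets_F_sub[of n] by (auto simp: pred_def)
  have "T -` {n} \<inter> space M = {\<omega> \<in> space M. T \<omega> \<le> n} - (if n = 0 then {} else {\<omega> \<in> space M. T \<omega> \<le> n - 1})" for n
    by (cases n) auto
  then have "T -` {n} \<inter> space M \<in> sets M" for n
    using sets.Diff[OF le[of n] le[of "n - 1"]] le[of n] by (cases n) (simp_all only: if_True if_False Diff_empty nat.distinct simp_thms)
  then have "(\<Union>n\<in>A. T -` {n} \<inter> space M) \<in> sets M" by (intro sets.countable_UN') auto
  moreover have "(\<Union>n\<in>A. T -` {n} \<inter> space M) = T -` A \<inter> space M" by auto
  ultimately show "T -` A \<inter> space M \<in> sets M" by simp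
qed simp

section \<open>Fixed assignment histories and the data vectors that they reveal\<close>

definition arm_of :: "(nat \<Rightarrow> 'u set) \<Rightarrow> 'u \<times> nat \<Rightarrow> bool" where
  "arm_of a j \<longleftrightarrow> fst j \<in> a (snd j)"

abbreviation data :: "(nat \<Rightarrow> 'u set) \<Rightarrow> nat \<Rightarrow> 'a \<Rightarrow> 'u \<times> nat \<Rightarrow> real" where
  "data a n \<equiv> obs (pairs n \<N>) (arm_of a)"

abbreviation data_space :: "nat \<Rightarrow> ('u \<times> nat \<Rightarrow> real) measure" where
  "data_space n \<equiv> PiM (pairs n \<N>) (\<lambda>_. borel)"

definition history :: "(nat \<Rightarrow> 'u set) \<Rightarrow> nat \<Rightarrow> 'a set" where
  "history a n = {\<omega> \<in> space M. \<forall>k\<in>{1..n}. \<T> k \<omega> = a k}"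

lemma finite_pairs_units: "finite (pairs n \<N>)"
  using finite_units by (intro finite_pairs) auto

lemma pairs_units: "pairs n \<N> \<subseteq> units"
  by (auto simp: pairs_def units_def)

lemma measurable_data: "data a n \<in> measurable M (data_space n)"
  by (rule measurable_obs[OF pairs_units])

lemma space_data: "\<omega> \<in> space M \<Longrightarrow> data a n \<omega> \<in> space (data_space n)"
  by (rule measurable_space[OF measurable_data])

lemma history_mono: "k \<le> n \<Longrightarrow> history a n \<subseteq> history a k"
  by (auto simp: history_def)

lemma history_eq_INT: "n \<noteq> 0 \<Longrightarrow> history a n = (\<Inter>k\<in>{1..n}. \<T> k -` {a k} \<inter> space M)"
  by (auto simp: history_def)

lemma history_0: "history a 0 = space M"
  by (simp add: history_def)

lemma history_in_F: "history a n \<in> sets (F n)"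
proof (cases "n = 0")
  case True
  then show ?thesis using sets.top[of "F 0"] by (simp add: history_0)
next
  case False
  then show ?thesis
    unfolding history_eq_INT[OF False] by (intro sets.finite_INT assigned_eq_in_F) auto
qed

text \<open>Once the assignments of the first \<open>n\<close> stages are fixed to \<open>a\<close>, the observations of these stages carry
  the same information as the vector \<open>data a n\<close>, whose components do not depend on the assignment.\<close>

lemma trace_F:
  assumes G: "G \<in> sets (F s)" and sn: "s \<le> n"
  shows "\<exists>E\<in>sets (data_space n). G \<inter> history a s = {\<omega> \<in> space M. data a n \<omega> \<in> E} \<inter> history a s"
  using G unfolding sets_F
proof (induction rule: sigma_sets.induct)
  case (Basic G)
  \<comment> \<open>On the history an assignment event is all or nothing, since the group is
    \<open>a k\<close>; an outcome event becomes an event on the coordinate \<open>(i, k)\<close>,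
    since the arm of that unit is known. The data vector may run further than the history
    (\<open>s \<le> n\<close>), as the induction over stages requires.\<close>
  consider (as) k A where "1 \<le> k" "k \<le> s" "G = \<T> k -` {A} \<inter> space M"
    | (ob) i k E where "1 \<le> k" "k \<le> s" "i \<in> \<N> k" "E \<in> sets borel" "G = (\<lambda>\<omega>. Y i k (i \<in> \<T> k \<omega>) \<omega>) -` E \<inter> space M"
    using Basic unfolding gens_def assignment_events_def observed_outcome_events_def by blast
  then show ?case
  proof cases
    case as
    then have *: "\<omega> \<in> history a s \<Longrightarrow> \<T> k \<omega> = a k" for \<omega> by (simp add: history_def)
    have sp: "history a s \<subseteq> space M" by (auto simp: history_def)
    show ?thesis
    proof (cases "A = a k")
      case True
      have "G \<inter> history a s = {\<omega> \<in> space M. data a n \<omega> \<in> space (data_space n)} \<inter> history a s"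
        using * sp True as(3) space_data by auto
      then show ?thesis by (intro bexI[of _ "space (data_space n)"]) simp_all
    next
      case False
      have "G \<inter> history a s = {\<omega> \<in> space M. data a n \<omega> \<in> {}} \<inter> history a s"
        using * False as(3) by auto
      then show ?thesis by (intro bexI[of _ "{}"]) simp_all
    qed
  next
    case ob
    have k: "(i, k) \<in> pairs n \<N>" using ob sn by (simp add: pairs_def)
    let ?E = "{x \<in> space (data_space n). x (i, k) \<in> E}"
    have E: "?E \<in> sets (data_space n)"
    proof -
      have "(\<lambda>x. x (i, k)) -` E \<inter> space (data_space n) \<in> sets (data_space n)"
        by (rule measurable_sets[OF measurable_component_singleton[OF k] ob(4)])
      moreover have "(\<lambda>x. x (i, k)) -` E \<inter> space (data_space n) = ?E" by auto
      ultimately show ?thesis by simp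
    qed
    have *: "\<omega> \<in> history a s \<Longrightarrow> \<T> k \<omega> = a k \<and> \<omega> \<in> space M" for \<omega> using ob by (simp add: history_def)
    have d: "data a n \<omega> (i, k) = Y i k (i \<in> a k) \<omega>" for \<omega>
      using k by (simp add: obs_def arm_of_def)
    have "G \<inter> history a s = {\<omega> \<in> space M. data a n \<omega> \<in> ?E} \<inter> history a s"
    proof (rule set_eqI)
      fix \<omega>
      show "\<omega> \<in> G \<inter> history a s \<longleftrightarrow> \<omega> \<in> {\<omega> \<in> space M. data a n \<omega> \<in> ?E} \<inter> history a s"
      proof (cases "\<omega> \<in> history a s")
        case True
        then show ?thesis using *[OF True] space_data[of \<omega> n a] unfolding ob(5) by (simp add: d)
      qed simp
    qed
    with E show ?thesis by blast
  qed
next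
  case Empty
  then show ?case by (intro bexI[of _ "{}"]) simp_all
next
  case (Compl G)
  then obtain E where E: "E \<in> sets (data_space n)" "G \<inter> history a s = {\<omega> \<in> space M. data a n \<omega> \<in> E} \<inter> history a s"
    by blast
  have "(space M - G) \<inter> history a s = (space M - (G \<inter> history a s)) \<inter> history a s" by auto
  also have "\<dots> = {\<omega> \<in> space M. data a n \<omega> \<in> space (data_space n) - E} \<inter> history a s"
    unfolding E(2) using space_data[of _ n a] by auto
  finally show ?case using E(1) by blast
next
  case (Union G)
  then have "\<forall>i. \<exists>E. E \<in> sets (data_space n) \<and> G i \<inter> history a s = {\<omega> \<in> space M. data a n \<omega> \<in> E} \<inter> history a s"
    by blast
  from choice[OF this] obtain E where E: "\<And>i. E i \<in> sets (data_space n)"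
      "\<And>i. G i \<inter> history a s = {\<omega> \<in> space M. data a n \<omega> \<in> E i} \<inter> history a s"
    by blast
  have "(\<Union>i. G i) \<inter> history a s = (\<Union>i. G i \<inter> history a s)" by auto
  also have "\<dots> = {\<omega> \<in> space M. data a n \<omega> \<in> (\<Union>i. E i)} \<inter> history a s"
    unfolding E(2) by auto
  finally show ?case using E(1) by (intro bexI[of _ "\<Union>i. E i"]) auto
qed

section \<open>What precedes an assignment: parameters, all outcomes and earlier groups\<close>

definition potential :: "'a measure" where
  "potential = sigma (space M) (param_events M \<theta> \<union> outcome_events M \<N> Y)"

definition pre_assignment :: "nat \<Rightarrow> 'a measure" where
  "pre_assignment k = sigma (space M) (param_events M \<theta> \<union> outcome_events M \<N> Y \<union> assignment_events M \<T> k)"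

lemma pre_gens_sub: "param_events M \<theta> \<union> outcome_events M \<N> Y \<union> assignment_events M \<T> k \<subseteq> sets M"
proof -
  have "outcome_events M \<N> Y \<subseteq> sets M"
    unfolding outcome_events_def using measurable_sets[OF measurable_Y] by (auto simp: units_def)
  moreover have "param_events M \<theta> \<subseteq> sets M" by (auto simp: param_events_def)
  ultimately show ?thesis using assignment_events_sub by blast
qed

lemma sets_potential: "sets potential = sigma_sets (space M) (param_events M \<theta> \<union> outcome_events M \<N> Y)"
  unfolding potential_def using pre_gens_sub sets.space_closed[of M] by (intro sets_measure_of) blast

lemma sets_pre_assignment:
  "sets (pre_assignment k) = sigma_sets (space M) (param_events M \<theta> \<union> outcome_events M \<N> Y \<union> assignment_events M \<T> k)"
  unfolding pre_assignment_def using pre_gens_sub sets.space_closed[of M] by (intro sets_measure_of) blast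

lemma space_potential [simp]: "space potential = space M"
  by (simp add: potential_def space_measure_of_conv)

lemma space_pre_assignment [simp]: "space (pre_assignment k) = space M"
  by (simp add: pre_assignment_def space_measure_of_conv)

lemma subalgebra_pre_assignment: "subalgebra M (pre_assignment k)"
  unfolding subalgebra_def sets_pre_assignment space_pre_assignment
  using sets.sigma_sets_subset[OF pre_gens_sub] by blast

lemma measurable_potential_pre: "f \<in> measurable potential N \<Longrightarrow> f \<in> measurable (pre_assignment k) N"
proof -
  have "sets potential \<subseteq> sets (pre_assignment k)"
    unfolding sets_potential sets_pre_assignment by (rule sigma_sets_mono') blast
  then show "f \<in> measurable potential N \<Longrightarrow> ?thesis" by (auto simp: measurable_def)
qed

lemma measurable_potential_M: "f \<in> measurable potential N \<Longrightarrow> f \<in> measurable M N"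
  using measurable_potential_pre[of f N 0] measurable_from_subalg[OF subalgebra_pre_assignment] by blast

lemma Y_potential: assumes "1 \<le> k" "i \<in> \<N> k" shows "Y i k w \<in> borel_measurable potential"
proof (rule measurableI)
  fix E :: "real set" assume "E \<in> sets borel"
  with assms show "Y i k w -` E \<inter> space potential \<in> sets potential"
    unfolding sets_potential space_potential outcome_events_def by (intro sigma_sets.Basic UnI2) blast
qed simp

lemma data_potential: "data a n \<in> measurable potential (data_space n)"
  unfolding obs_def[abs_def]
proof (rule measurable_restrict)
  fix j assume "j \<in> pairs n \<N>"
  then show "Y (fst j) (snd j) (arm_of a j) \<in> borel_measurable potential"
    by (intro Y_potential) (auto simp: pairs_def)
qed

lemma history_pre: "history a k \<in> sets (pre_assignment k)"
proof -
  have "\<T> j -` {a j} \<inter> space M \<in> sets (pre_assignment k)" if "j \<in> {1..k}" for j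
    unfolding sets_pre_assignment assignment_events_def using that by (intro sigma_sets.Basic UnI2) auto
  then have "k \<noteq> 0 \<Longrightarrow> (\<Inter>j\<in>{1..k}. \<T> j -` {a j} \<inter> space M) \<in> sets (pre_assignment k)"
    by (intro sets.finite_INT) auto
  then show ?thesis
    using history_eq_INT[of k a] sets.top[of "pre_assignment k"]
    unfolding space_pre_assignment by (cases "k = 0") (metis history_0, metis)
qed

lemma assignment_prob:
  assumes "1 \<le> t" "A \<subseteq> \<N> t"
  shows "AE \<omega> in M. t \<le> T \<omega> \<longrightarrow> real_cond_exp M (pre_assignment (t - 1)) (indicator {\<omega> \<in> space M. \<T> t \<omega> = A}) \<omega>
    = (if card A = m t \<omega> then 1 / real (card (\<N> t) choose m t \<omega>) else 0)"
  using assignment assms unfolding random_assignment_def pre_assignment_def by blast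

text \<open>Random assignment transfers a vanishing conditional mean given \<open>data a n\<close> to the event that the first
  \<open>k\<close> assignments are those of \<open>a\<close>: at each stage the probability of the next assignment depends on the
  past only through the observations.\<close>

lemma unconfounded:
  assumes f: "f \<in> borel_measurable potential" and bd: "\<And>\<omega>. \<omega> \<in> space M \<Longrightarrow> \<bar>f \<omega>\<bar> \<le> (c::real)"
    and a: "\<And>k. k \<in> {1..Suc n} \<Longrightarrow> a k \<subseteq> \<N> k"
    and zero: "\<And>E. E \<in> sets (data_space n) \<Longrightarrow> (\<integral>\<omega>. f \<omega> * indicator E (data a n \<omega>) \<partial>M) = 0"
    and k: "k \<le> Suc n" and E: "E \<in> sets (data_space n)"
  shows "(\<integral>\<omega>. f \<omega> * indicator (history a k \<inter> {\<omega> \<in> space M. k \<le> T \<omega>}) \<omega> * indicator E (data a n \<omega>) \<partial>M) = 0"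
  using k E
\<comment> \<open>One assignment is removed at a time. \<open>E\<close> must vary because each
  removal cuts the data event down by the observable condition that the stage runs with the right
  group size.\<close>
proof (induction k arbitrary: E)
  case 0
  have "(\<integral>\<omega>. f \<omega> * indicator (history a 0 \<inter> {\<omega> \<in> space M. 0 \<le> T \<omega>}) \<omega> * indicator E (data a n \<omega>) \<partial>M) =
      (\<integral>\<omega>. f \<omega> * indicator E (data a n \<omega>) \<partial>M)"
    by (rule Bochner_Integration.integral_cong) (auto simp: history_def)
  then show ?case using zero[OF 0(2)] by simp
next
  case (Suc k)
  define t where "t = Suc k"
  have t: "1 \<le> t" "t - 1 = k" "k \<le> n" "t \<in> {1..Suc n}" using Suc.prems by (auto simp: t_def)
  let ?R = "{\<omega> \<in> space M. t \<le> T \<omega>}"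
  have R: "?R \<in> sets (F k)" using running_F[OF t(1)] t(2) by simp
  obtain E1 where E1: "E1 \<in> sets (data_space n)" "?R \<inter> history a k = {\<omega> \<in> space M. data a n \<omega> \<in> E1} \<inter> history a k"
    using trace_F[OF R t(3)] by blast
  define Z where "Z = {\<omega> \<in> space M. size_fun t \<omega> = card (a t)}"
  have "size_fun t -` {card (a t)} \<inter> space (F k) \<in> sets (F k)"
    using size_fun_F[OF t(1)] t(2) by (intro measurable_sets[where A="count_space UNIV"]) auto
  moreover have "size_fun t -` {card (a t)} \<inter> space (F k) = Z" by (auto simp: Z_def)
  ultimately have "?R \<inter> Z \<in> sets (F k)" using R by auto
  from trace_F[OF this t(3)]
  obtain E2 where E2: "E2 \<in> sets (data_space n)" "?R \<inter> Z \<inter> history a k = {\<omega> \<in> space M. data a n \<omega> \<in> E2} \<inter> history a k"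
    by blast
  define U where "U = {\<omega> \<in> space M. \<T> t \<omega> = a t}"
  \<comment> \<open>When the stage runs and the size rule prescribes \<open>card (a t)\<close>, each
    group of that size has this probability; being a constant, it leaves the integral.\<close>
  define p where "p = 1 / real (card (\<N> t) choose card (a t))"
  \<comment> \<open>\<open>E1\<close> expresses through the data that stage \<open>t\<close> runs.
    So \<open>g\<close> is measurable before the assignment, and it vanishes where the stage does
    not run and nothing is assumed about the assignment probability.\<close>
  define g where "g \<omega> = f \<omega> * indicator (history a k) \<omega> * indicator (E \<inter> E1) (data a n \<omega>)" for \<omega>
  interpret P: finite_measure_subalgebra M "pre_assignment k"
    by unfold_locales (rule subalgebra_pre_assignment)
  have gP: "g \<in> borel_measurable (pre_assignment k)"
    unfolding g_def[abs_def]
  proof (intro borel_measurable_times borel_measurable_indicator history_pre)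
    show "f \<in> borel_measurable (pre_assignment k)" by (rule measurable_potential_pre[OF f])
    show "(\<lambda>\<omega>. indicator (E \<inter> E1) (data a n \<omega>)) \<in> borel_measurable (pre_assignment k)"
      using E1(1) Suc.prems(2)
      by (intro measurable_compose[OF measurable_potential_pre[OF data_potential]] borel_measurable_indicator) auto
  qed
  have U: "U \<in> sets M" using sets_assigned_eq[OF t(1), of "a t"] by (simp add: U_def vimage_def Int_def conj_commute)
  have gM: "g \<in> borel_measurable M" by (rule measurable_from_subalg[OF subalgebra_pre_assignment gP])
  have intgU: "integrable M (\<lambda>\<omega>. g \<omega> * indicator U \<omega>)"
  proof (rule integrable_const_bound[where B="\<bar>c\<bar>"])
    show "AE \<omega> in M. norm (g \<omega> * indicator U \<omega>) \<le> \<bar>c\<bar>"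
    proof (rule AE_I2)
      fix \<omega> assume "\<omega> \<in> space M"
      from bd[OF this] show "norm (g \<omega> * indicator U \<omega>) \<le> \<bar>c\<bar>"
        by (auto simp: g_def split: split_indicator)
    qed
  qed (use gM U in measurable)
  have hist: "history a t = history a k \<inter> U"
    by (auto simp: history_def U_def t_def atLeastAtMostSuc_conv)
  have "(\<integral>\<omega>. f \<omega> * indicator (history a t \<inter> ?R) \<omega> * indicator E (data a n \<omega>) \<partial>M) = (\<integral>\<omega>. g \<omega> * indicator U \<omega> \<partial>M)"
  proof (rule Bochner_Integration.integral_cong[OF refl])
    fix \<omega> assume \<omega>: "\<omega> \<in> space M"
    have "\<omega> \<in> history a k \<Longrightarrow> \<omega> \<in> ?R \<longleftrightarrow> data a n \<omega> \<in> E1" using E1(2) \<omega> by blast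
    then show "f \<omega> * indicator (history a t \<inter> ?R) \<omega> * indicator E (data a n \<omega>) = g \<omega> * indicator U \<omega>"
      by (auto simp: g_def hist split: split_indicator)
  qed
  also have "\<dots> = (\<integral>\<omega>. g \<omega> * real_cond_exp M (pre_assignment k) (indicator U) \<omega> \<partial>M)"
    using intgU gP U by (intro P.real_cond_exp_intg(2)[symmetric]) auto
  also have "\<dots> = (\<integral>\<omega>. p * (f \<omega> * indicator (history a k \<inter> {\<omega> \<in> space M. k \<le> T \<omega>}) \<omega> * indicator (E \<inter> E2) (data a n \<omega>)) \<partial>M)"
  proof (rule integral_cong_AE)
    have "history a k \<inter> {\<omega> \<in> space M. k \<le> T \<omega>} \<in> sets M"
      using history_in_F[of a k] sets_F_sub[of k] by (intro sets.Int) auto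
    moreover have "(\<lambda>\<omega>. indicator (E \<inter> E2) (data a n \<omega>) :: real) \<in> borel_measurable M"
      using E2(1) Suc.prems(2)
      by (intro measurable_compose[OF measurable_data] borel_measurable_indicator) auto
    ultimately show "(\<lambda>\<omega>. p * (f \<omega> * indicator (history a k \<inter> {\<omega> \<in> space M. k \<le> T \<omega>}) \<omega> * indicator (E \<inter> E2) (data a n \<omega>))) \<in> borel_measurable M"
      using measurable_potential_M[OF f] by (intro borel_measurable_times borel_measurable_const borel_measurable_indicator)
    show "(\<lambda>\<omega>. g \<omega> * real_cond_exp M (pre_assignment k) (indicator U) \<omega>) \<in> borel_measurable M"
      using gM by measurable
    show "AE \<omega> in M. g \<omega> * real_cond_exp M (pre_assignment k) (indicator U) \<omega> =
        p * (f \<omega> * indicator (history a k \<inter> {\<omega> \<in> space M. k \<le> T \<omega>}) \<omega> * indicator (E \<inter> E2) (data a n \<omega>))"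
      using assignment_prob[OF t(1) a[OF t(4)]] AE_space
    proof eventually_elim
      fix \<omega> assume ap: "t \<le> T \<omega> \<longrightarrow> real_cond_exp M (pre_assignment (t - 1)) (indicator {\<omega> \<in> space M. \<T> t \<omega> = a t}) \<omega>
        = (if card (a t) = m t \<omega> then 1 / real (card (\<N> t) choose m t \<omega>) else 0)" and \<omega>: "\<omega> \<in> space M"
      have ce: "t \<le> T \<omega> \<Longrightarrow> real_cond_exp M (pre_assignment k) (indicator U) \<omega> = (if \<omega> \<in> Z then p else 0)"
        using ap[unfolded t(2), folded U_def] algorithm_at(4)[OF \<omega> t(1)] \<omega> by (simp add: Z_def p_def)
      show "g \<omega> * real_cond_exp M (pre_assignment k) (indicator U) \<omega> =
        p * (f \<omega> * indicator (history a k \<inter> {\<omega> \<in> space M. k \<le> T \<omega>}) \<omega> * indicator (E \<inter> E2) (data a n \<omega>))"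
      proof (cases "\<omega> \<in> history a k")
        case True
        have e1: "t \<le> T \<omega> \<longleftrightarrow> data a n \<omega> \<in> E1" using E1(2) \<omega> True by blast
        have e2: "t \<le> T \<omega> \<and> \<omega> \<in> Z \<longleftrightarrow> data a n \<omega> \<in> E2" using E2(2) \<omega> True by blast
        \<comment> \<open>\<open>E2\<close> forces \<open>t \<le> T\<close> and hence
          \<open>k \<le> T\<close>, which restores the indicator expected by the induction
          hypothesis.\<close>
        have "t \<le> T \<omega> \<Longrightarrow> k \<le> T \<omega>" by (simp add: t_def)
        then show ?thesis using e1 e2 ce \<omega> True
          by (cases "t \<le> T \<omega>"; cases "\<omega> \<in> Z") (simp_all add: g_def indicator_def)
      qed (simp add: g_def)
    qed
  qed
  also have "\<dots> = p * (\<integral>\<omega>. f \<omega> * indicator (history a k \<inter> {\<omega> \<in> space M. k \<le> T \<omega>}) \<omega> * indicator (E \<inter> E2) (data a n \<omega>) \<partial>M)"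
    by simp
  also have "\<dots> = 0"
    using Suc.IH[of "E \<inter> E2"] Suc.prems E2(1) by simp
  finally show ?case by (simp add: t_def)
qed

text \<open>The part of the cost after stage \<open>n + 1\<close> that is unknown before it:
  treatment outcomes of the new group only, but control outcomes of every unit treated so
  far.\<close>

definition hidden_units :: "(nat \<Rightarrow> 'u set) \<Rightarrow> nat \<Rightarrow> (('u \<times> nat) \<times> bool) set" where
  "hidden_units a n = (\<lambda>i. ((i, Suc n), True)) ` a (Suc n) \<union> (\<lambda>j. (j, False)) ` pairs (Suc n) a"

text \<open>The argument of \<open>Phi\<close> in \<open>predictive\<close> when the bound is
  \<open>B\<close> less the treatment outcomes already seen: the test quantity of the algorithm with
  \<open>B\<close> in place of \<open>b\<close>.\<close>

definition threshold :: "(nat \<Rightarrow> 'u set) \<Rightarrow> nat \<Rightarrow> ('u \<times> nat \<Rightarrow> real) \<Rightarrow> real" where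
  "threshold a n x = (let n1 = real (card (a (Suc n))); n0 = real (card (pairs (Suc n) a)) in
     (B - obs_total (pairs n \<N>) (arm_of a) True x
       - (n1 * pmean (pairs n \<N>) (arm_of a) True x - n0 * pmean (pairs n \<N>) (arm_of a) False x))
     / sqrt (pred_var (pairs n \<N>) (arm_of a) n1 n0))"

text \<open>Ruin indicator minus its conditional probability given the data, written with the
  potential outcomes along \<open>a\<close> and thus defined on the whole space; it describes actual
  ruin only on the history \<open>a\<close>.\<close>

definition gap :: "(nat \<Rightarrow> 'u set) \<Rightarrow> nat \<Rightarrow> 'a \<Rightarrow> real" where
  "gap a n \<omega> = (if hidden_sum (hidden_units a n) \<omega> \<le> B - obs_total (pairs n \<N>) (arm_of a) True (data a n \<omega>) then 1 else 0)
     - Phi (threshold a n (data a n \<omega>))"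

lemma abs_gap: "\<bar>gap a n \<omega>\<bar> \<le> 1"
  using Phi_bounds[of "threshold a n (data a n \<omega>)"] by (auto simp: gap_def)

lemma measurable_threshold: "threshold a n \<in> borel_measurable (data_space n)"
  unfolding threshold_def[abs_def] Let_def
  by (intro borel_measurable_divide borel_measurable_diff borel_measurable_times borel_measurable_const
      measurable_obs_total measurable_pmean)

section \<open>Conditional ruin probability along one history\<close>

context
  fixes a :: "nat \<Rightarrow> 'u set" and n :: nat
  assumes a: "\<And>k. k \<in> {1..Suc n} \<Longrightarrow> a k \<subseteq> \<N> k"
begin

lemma finite_a: "k \<in> {1..Suc n} \<Longrightarrow> finite (a k)"
  using a[of k] finite_units[of k] finite_subset by auto

lemma hidden_units_facts:
  shows "finite (hidden_units a n)" and "fst ` hidden_units a n \<subseteq> units"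
    and "card {k \<in> hidden_units a n. snd k = True} = card (a (Suc n))"
    and "card {k \<in> hidden_units a n. snd k = False} = card (pairs (Suc n) a)"
    and "j \<in> pairs n \<N> \<Longrightarrow> (j, arm_of a j) \<notin> hidden_units a n"
    and "hidden_sum (hidden_units a n) \<omega> =
      (\<Sum>i\<in>a (Suc n). Y i (Suc n) True \<omega>) - (\<Sum>k=1..Suc n. \<Sum>i\<in>a k. Y i k False \<omega>)"
proof -
  have f: "finite (a (Suc n))" by (rule finite_a) simp
  have fp: "finite (pairs (Suc n) a)" by (rule finite_pairs[OF finite_a])
  show fin: "finite (hidden_units a n)" using f fp by (simp add: hidden_units_def)
  show "fst ` hidden_units a n \<subseteq> units"
  proof -
    have "i \<in> \<N> k" if "i \<in> a k" "1 \<le> k" "k \<le> Suc n" for i k using a[of k] that by auto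
    then show ?thesis by (auto simp: hidden_units_def units_def pairs_def)
  qed
  have t: "{k \<in> hidden_units a n. snd k = True} = (\<lambda>i. ((i, Suc n), True)) ` a (Suc n)"
    by (auto simp: hidden_units_def)
  show "card {k \<in> hidden_units a n. snd k = True} = card (a (Suc n))"
    unfolding t by (rule card_image) (auto simp: inj_on_def)
  have u: "{k \<in> hidden_units a n. snd k = False} = (\<lambda>j. (j, False)) ` pairs (Suc n) a"
    by (auto simp: hidden_units_def)
  show "card {k \<in> hidden_units a n. snd k = False} = card (pairs (Suc n) a)"
    unfolding u by (rule card_image) (auto simp: inj_on_def)
  \<comment> \<open>A hidden treatment outcome belongs to stage \<open>n + 1\<close>, beyond the
    data; a hidden control outcome belongs to a treated unit, whose arm in the data is
    treatment.\<close>
  show "j \<in> pairs n \<N> \<Longrightarrow> (j, arm_of a j) \<notin> hidden_units a n"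
    by (auto simp: hidden_units_def pairs_def arm_of_def)
  have "hidden_sum (hidden_units a n) \<omega> =
      (\<Sum>k\<in>(\<lambda>i. ((i, Suc n), True)) ` a (Suc n). (if snd k then 1 else - 1) * Y (fst (fst k)) (snd (fst k)) (snd k) \<omega>) +
      (\<Sum>k\<in>(\<lambda>j. (j, False)) ` pairs (Suc n) a. (if snd k then 1 else - 1) * Y (fst (fst k)) (snd (fst k)) (snd k) \<omega>)"
    unfolding hidden_sum_def hidden_units_def using f fp by (intro sum.union_disjoint) auto
  also have "\<dots> = (\<Sum>i\<in>a (Suc n). Y i (Suc n) True \<omega>) + (\<Sum>j\<in>pairs (Suc n) a. - Y (fst j) (snd j) False \<omega>)"
    by (intro arg_cong2[where f="(+)"]; subst sum.reindex) (auto simp: inj_on_def)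
  also have "(\<Sum>j\<in>pairs (Suc n) a. - Y (fst j) (snd j) False \<omega>) = (\<Sum>k=1..Suc n. \<Sum>i\<in>a k. - Y i k False \<omega>)"
    by (subst sum_pairs[OF finite_a]) simp_all
  finally show "hidden_sum (hidden_units a n) \<omega> =
      (\<Sum>i\<in>a (Suc n). Y i (Suc n) True \<omega>) - (\<Sum>k=1..Suc n. \<Sum>i\<in>a k. Y i k False \<omega>)"
    by (simp add: sum_negf)
qed

lemma gap_potential: "gap a n \<in> borel_measurable potential"
proof -
  have Yp: "Y i k w \<in> borel_measurable potential" if "k \<in> {1..Suc n}" "i \<in> a k" for i k w
    using that a[of k] by (intro Y_potential) auto
  have h: "hidden_sum (hidden_units a n) \<in> borel_measurable potential"
    unfolding hidden_units_facts(6)[abs_def] by (intro borel_measurable_diff borel_measurable_sum Yp) auto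
  have S: "(\<lambda>\<omega>. obs_total (pairs n \<N>) (arm_of a) True (data a n \<omega>)) \<in> borel_measurable potential"
    by (rule measurable_compose[OF data_potential measurable_obs_total])
  have P: "(\<lambda>\<omega>. Phi (threshold a n (data a n \<omega>))) \<in> borel_measurable potential"
    by (rule measurable_compose[OF measurable_compose[OF data_potential measurable_threshold] borel_measurable_Phi])
  show ?thesis unfolding gap_def[abs_def]
    using h S P by measurable
qed

text \<open>\<open>predictive\<close> equates the probability of ruin on a data event with the
  integral of \<open>Phi\<close> over it, and the difference of the two is the mean of
  \<open>gap\<close>. A new treated unit gives both arms a positive count, as
  \<open>predictive\<close> demands.\<close>

lemma gap_zero:
  assumes ne: "0 < card (a (Suc n))" and E: "E \<in> sets (data_space n)"
  shows "(\<integral>\<omega>. gap a n \<omega> * indicator E (data a n \<omega>) \<partial>M) = 0"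
proof -
  let ?K = "pairs n \<N>" and ?arm = "arm_of a" and ?H = "hidden_units a n"
  have "card (a (Suc n)) \<le> card (pairs (Suc n) a)"
  proof (rule card_inj_on_le[of "\<lambda>i. (i, Suc n)"])
    show "finite (pairs (Suc n) a)" by (rule finite_pairs[OF finite_a])
  qed (auto simp: inj_on_def pairs_def)
  then have n: "0 < real (card {k \<in> ?H. snd k = w})" for w
    using ne hidden_units_facts(3,4) by (cases w) simp_all
  have m: "(\<lambda>x. B - obs_total ?K ?arm True x) \<in> borel_measurable (data_space n)"
    using measurable_obs_total[of ?K ?arm True] by measurable
  let ?A = "{\<omega> \<in> space M. hidden_sum ?H \<omega> \<le> B - obs_total ?K ?arm True (data a n \<omega>) \<and> data a n \<omega> \<in> E}"
  have P: "prob ?A = (\<integral>\<omega>. Phi (threshold a n (data a n \<omega>)) * indicator E (data a n \<omega>) \<partial>M)"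
    using predictive[OF finite_pairs_units pairs_units hidden_units_facts(1,2,5) n m E]
    unfolding threshold_def Let_def hidden_units_facts(3,4) .
  have ind: "(\<lambda>\<omega>. indicator E (data a n \<omega>) :: real) \<in> borel_measurable M"
    using E by (intro measurable_compose[OF measurable_data] borel_measurable_indicator)
  have int: "integrable M (\<lambda>\<omega>. Phi (threshold a n (data a n \<omega>)) * indicator E (data a n \<omega>))"
  proof (rule integrable_const_bound[where B=1])
    show "(\<lambda>\<omega>. Phi (threshold a n (data a n \<omega>)) * indicator E (data a n \<omega>)) \<in> borel_measurable M"
      by (intro borel_measurable_times ind measurable_compose[OF measurable_compose[OF measurable_data measurable_threshold] borel_measurable_Phi])
    show "AE \<omega> in M. norm (Phi (threshold a n (data a n \<omega>)) * indicator E (data a n \<omega>)) \<le> 1"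
      using Phi_bounds by (intro AE_I2) (auto split: split_indicator)
  qed
  have g: "(\<lambda>\<omega>. gap a n \<omega> * indicator E (data a n \<omega>)) \<in> borel_measurable M"
    by (intro borel_measurable_times ind measurable_potential_M gap_potential)
  have "(\<lambda>\<omega>. gap a n \<omega> * indicator E (data a n \<omega>) + Phi (threshold a n (data a n \<omega>)) * indicator E (data a n \<omega>)) \<in> borel_measurable M"
    using g int by measurable
  then have A: "?A \<in> sets M"
  proof -
    assume [measurable]: "(\<lambda>\<omega>. gap a n \<omega> * indicator E (data a n \<omega>) + Phi (threshold a n (data a n \<omega>)) * indicator E (data a n \<omega>)) \<in> borel_measurable M"
    \<comment> \<open>The sum takes only the values 0 and 1, so cutting at \<open>1 / 2\<close>
      recovers the event from a function already known to be measurable.\<close>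
    have "?A = {\<omega> \<in> space M. 1 / 2 < gap a n \<omega> * indicator E (data a n \<omega>) + Phi (threshold a n (data a n \<omega>)) * indicator E (data a n \<omega>)}"
      by (auto simp: gap_def split: split_indicator)
    also have "\<dots> \<in> sets M" by measurable
    finally show ?thesis .
  qed
  have "(\<integral>\<omega>. gap a n \<omega> * indicator E (data a n \<omega>) \<partial>M) =
      (\<integral>\<omega>. indicator ?A \<omega> - Phi (threshold a n (data a n \<omega>)) * indicator E (data a n \<omega>) \<partial>M)"
    by (rule Bochner_Integration.integral_cong) (auto simp: gap_def split: split_indicator)
  also have "\<dots> = prob ?A - (\<integral>\<omega>. Phi (threshold a n (data a n \<omega>)) * indicator E (data a n \<omega>) \<partial>M)"
    using int A by (subst Bochner_Integration.integral_diff) (auto simp: emeasure_eq_measure)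
  finally show ?thesis unfolding P by simp
qed

lemma arm_pairs:
  "{j \<in> pairs n \<N>. arm_of a j = w} = pairs n (\<lambda>k. if w then a k else \<N> k - a k)"
proof -
  have "a k \<subseteq> \<N> k" if "k \<in> {1..n}" for k using a[of k] that by auto
  then show ?thesis by (cases w) (auto simp: pairs_def arm_of_def)
qed

lemma finite_arm: "k \<in> {1..n} \<Longrightarrow> finite (if w then a k else \<N> k - a k)"
  using finite_a[of k] finite_units[of k] by auto

lemma count_arm: "count (pairs n \<N>) (arm_of a) w = cum_size (\<lambda>k. card (\<N> k)) (\<lambda>k. card (a k)) w n"
proof -
  have "real (card (if w then a k else \<N> k - a k)) = (if w then real (card (a k)) else real (card (\<N> k)) - real (card (a k)))"
    if "k \<in> {1..n}" for k
    using that a[of k] finite_a[of k] finite_units[of k] by (auto simp: card_Diff_subset of_nat_diff card_mono)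
  then show ?thesis
    unfolding count_def arm_pairs cum_size_def by (subst card_pairs[OF finite_arm]) simp_all
qed

lemma obs_total_data: "obs_total (pairs n \<N>) (arm_of a) w (data a n \<omega>) =
    (\<Sum>k=1..n. \<Sum>i\<in>(if w then a k else \<N> k - a k). Y i k w \<omega>)"
proof -
  have "obs_total (pairs n \<N>) (arm_of a) w (data a n \<omega>) = (\<Sum>j\<in>{j \<in> pairs n \<N>. arm_of a j = w}. Y (fst j) (snd j) w \<omega>)"
    unfolding obs_total_def by (rule sum.cong) (auto simp: obs_def)
  also have "\<dots> = (\<Sum>k=1..n. \<Sum>i\<in>(if w then a k else \<N> k - a k). Y i k w \<omega>)"
    unfolding arm_pairs by (subst sum_pairs[OF finite_arm]) simp_all
  finally show ?thesis .
qed

lemma card_pairs_Suc: "real (card (pairs (Suc n) a)) = real (card (a (Suc n))) + count (pairs n \<N>) (arm_of a) True"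
  unfolding count_arm cum_size_def by (subst card_pairs[OF finite_a]) simp_all

text \<open>Each unit treated by stage \<open>n\<close> has its treatment outcome in the data and
  its control outcome among the hidden ones, so observed total and hidden sum add up to the total
  cost at stage \<open>n + 1\<close>.\<close>

lemma on_history:
  assumes \<omega>: "\<omega> \<in> history a (Suc n)"
  shows "gap a n \<omega> = (if total_cost \<T> Y (Suc n) \<omega> \<le> B then 1 else 0) - Phi (threshold a n (data a n \<omega>))"
    and "threshold a n (data a n \<omega>) =
      (let p = (\<lambda>w. post_mean (\<mu>0 w) (\<sigma>0 w) (\<sigma> w) (assigned_size w n \<omega>) (observed_sum \<N> \<T> Y w n \<omega>));
           v = (\<lambda>w. post_var (\<sigma>0 w) (\<sigma> w) (assigned_size w n \<omega>));
           M1 = assigned_size True n \<omega>; k = real (card (\<T> (Suc n) \<omega>))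
       in (B - observed_sum \<N> \<T> Y True n \<omega> - mu_tilde p M1 k) / sigma_tilde v \<sigma> M1 k)"
proof -
  have h: "\<T> k \<omega> = a k" if "k \<in> {1..Suc n}" for k using \<omega> that by (simp add: history_def)
  have S: "observed_sum \<N> \<T> Y w n \<omega> = obs_total (pairs n \<N>) (arm_of a) w (data a n \<omega>)" for w
    unfolding obs_total_data observed_sum_def using h by (intro sum.cong) auto
  have C: "assigned_size w n \<omega> = count (pairs n \<N>) (arm_of a) w" for w
    unfolding count_arm assigned_size_def cum_size_def using h by (intro sum.cong) auto
  have "total_cost \<T> Y (Suc n) \<omega> = (\<Sum>k=1..Suc n. \<Sum>i\<in>a k. Y i k True \<omega> - Y i k False \<omega>)"
    unfolding total_cost_def stage_cost_def using h by (intro sum.cong) auto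
  also have "\<dots> = (\<Sum>k=1..Suc n. \<Sum>i\<in>a k. Y i k True \<omega>) - (\<Sum>k=1..Suc n. \<Sum>i\<in>a k. Y i k False \<omega>)"
    by (simp only: sum_subtractf)
  also have "\<dots> = obs_total (pairs n \<N>) (arm_of a) True (data a n \<omega>) + hidden_sum (hidden_units a n) \<omega>"
    unfolding hidden_units_facts(6) obs_total_data by simp
  finally show "gap a n \<omega> = (if total_cost \<T> Y (Suc n) \<omega> \<le> B then 1 else 0) - Phi (threshold a n (data a n \<omega>))"
    unfolding gap_def by (simp add: algebra_simps)
  have k: "\<T> (Suc n) \<omega> = a (Suc n)" by (rule h) simp
  show "threshold a n (data a n \<omega>) =
      (let p = (\<lambda>w. post_mean (\<mu>0 w) (\<sigma>0 w) (\<sigma> w) (assigned_size w n \<omega>) (observed_sum \<N> \<T> Y w n \<omega>));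
           v = (\<lambda>w. post_var (\<sigma>0 w) (\<sigma> w) (assigned_size w n \<omega>));
           M1 = assigned_size True n \<omega>; k = real (card (\<T> (Suc n) \<omega>))
       in (B - observed_sum \<N> \<T> Y True n \<omega> - mu_tilde p M1 k) / sigma_tilde v \<sigma> M1 k)"
    unfolding threshold_def Let_def S C k card_pairs_Suc mu_tilde_def sigma_tilde_def pred_var_def pvar_def pmean_def
    by (simp add: mult.commute)
qed

text \<open>The algorithm tests with \<open>b\<close>, ruin concerns \<open>B\<close>; since
  \<open>B \<le> b\<close>, the argument of \<open>Phi\<close> only gets smaller. The accepted test
  bounds it by the quantile, and monotonicity of \<open>Phi\<close> returns
  \<open>\<Delta>\<close>.\<close>

lemma Phi_threshold_le:
  assumes \<omega>: "\<omega> \<in> history a (Suc n)" and run: "Suc n \<le> T \<omega>" and pos: "0 < size_fun (Suc n) \<omega>"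
  shows "Phi (threshold a n (data a n \<omega>)) \<le> \<Delta> (Suc n) \<omega>"
proof -
  define p where "p w = post_mean (\<mu>0 w) (\<sigma>0 w) (\<sigma> w) (assigned_size w n \<omega>) (observed_sum \<N> \<T> Y w n \<omega>)" for w
  define v where "v w = post_var (\<sigma>0 w) (\<sigma> w) (assigned_size w n \<omega>)" for w
  define M1 where "M1 = assigned_size True n \<omega>"
  define S1 where "S1 = observed_sum \<N> \<T> Y True n \<omega>"
  define k where "k = size_fun (Suc n) \<omega>"
  have sp: "\<omega> \<in> space M" using \<omega> by (simp add: history_def)
  have t: "1 \<le> Suc n" by simp
  note alg = algorithm_at[OF sp t run]
  have card: "card (\<T> (Suc n) \<omega>) = k"
    using card_assigned[OF sp t run] alg(4) by (simp add: k_def)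
  have k: "k = treatment_size (card (\<N> (Suc n))) (\<Delta> (Suc n) \<omega>) (b (Suc n) \<omega>) p v \<sigma> M1 S1"
    unfolding k_def size_fun_def p_def v_def M1_def S1_def by simp
  have ok: "\<Delta> (Suc n) \<omega> \<noteq> 0" "(b (Suc n) \<omega> - S1 - mu_tilde p M1 (real k)) / sigma_tilde v \<sigma> M1 (real k) \<le> inv Phi (\<Delta> (Suc n) \<omega>)"
    using treatment_size_ok[OF k] pos unfolding k_def[symmetric] by auto
  \<comment> \<open>A positive size excludes \<open>\<Delta> = 0\<close>, and
    \<open>\<delta> < 1\<close> keeps \<open>\<Delta>\<close> below 1, so \<open>inv Phi\<close> is
    a genuine quantile here.\<close>
  have Q: "0 < (\<Prod>k=1..<Suc n. 1 - \<Delta> k \<omega>)" using alg(1) \<delta> by linarith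
  have "0 < (1 - \<delta>) / (\<Prod>k=1..<Suc n. 1 - \<Delta> k \<omega>)"
    using Q \<delta> by simp
  then have D: "0 < \<Delta> (Suc n) \<omega>" "\<Delta> (Suc n) \<omega> < 1"
    using alg(2) ok(1) unfolding atLeastAtMost_iff by linarith+
  have s: "0 \<le> sigma_tilde v \<sigma> M1 (real k)"
  proof -
    have C: "M1 = count (pairs n \<N>) (arm_of a) True"
      unfolding M1_def count_arm assigned_size_def cum_size_def using \<omega> by (intro sum.cong) (auto simp: history_def)
    have vv: "v w = pvar (pairs n \<N>) (arm_of a) w" for w
      unfolding v_def pvar_def count_arm assigned_size_def cum_size_def using \<omega>
      by (intro arg_cong[where f="post_var (\<sigma>0 w) (\<sigma> w)"] sum.cong) (auto simp: history_def)
    have "0 \<le> M1" by (simp add: C count_def)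
    then show ?thesis
      unfolding sigma_tilde_def vv using pvar_pos[of "pairs n \<N>" "arm_of a"]
      by (intro real_sqrt_ge_zero add_nonneg_nonneg mult_nonneg_nonneg) (auto simp: less_imp_le)
  qed
  have "threshold a n (data a n \<omega>) = (B - S1 - mu_tilde p M1 (real k)) / sigma_tilde v \<sigma> M1 (real k)"
    unfolding on_history(2)[OF \<omega>] Let_def p_def[symmetric] v_def[symmetric] M1_def[symmetric] S1_def[symmetric] card ..
  also have "\<dots> \<le> (b (Suc n) \<omega> - S1 - mu_tilde p M1 (real k)) / sigma_tilde v \<sigma> M1 (real k)"
    using alg(3) s by (intro divide_right_mono) auto
  also have "\<dots> \<le> inv Phi (\<Delta> (Suc n) \<omega>)" by (rule ok(2))
  finally have "Phi (threshold a n (data a n \<omega>)) \<le> Phi (inv Phi (\<Delta> (Suc n) \<omega>))" by (rule Phi_mono)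
  then show ?thesis using Phi_inv[OF D] by simp
qed

end

end

section \<open>The ruin probability\<close>

context rrc_experiment begin

lemma total_cost_measurable: "total_cost \<T> Y n \<in> borel_measurable M"
proof -
  have "(\<lambda>\<omega>. \<Sum>k=1..n. \<Sum>i\<in>\<N> k. if i \<in> \<T> k \<omega> then Y i k True \<omega> - Y i k False \<omega> else 0) \<in> borel_measurable M"
  proof (intro borel_measurable_sum measurable_If borel_measurable_diff borel_measurable_const)
    fix k i assume "k \<in> {1..n}" "i \<in> \<N> k"
    then show "Y i k True \<in> borel_measurable M" "Y i k False \<in> borel_measurable M"
      "{\<omega> \<in> space M. i \<in> \<T> k \<omega>} \<in> sets M"
      using measurable_Y[of i k] sets_assigned_mem[of k i] by (simp_all add: units_def)
  qed
  also have "(\<lambda>\<omega>. \<Sum>k=1..n. \<Sum>i\<in>\<N> k. if i \<in> \<T> k \<omega> then Y i k True \<omega> - Y i k False \<omega> else 0) \<in> borel_measurable M \<longleftrightarrow>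
      total_cost \<T> Y n \<in> borel_measurable M"
  proof (rule measurable_cong)
    fix \<omega> assume \<omega>: "\<omega> \<in> space M"
    show "(\<Sum>k=1..n. \<Sum>i\<in>\<N> k. if i \<in> \<T> k \<omega> then Y i k True \<omega> - Y i k False \<omega> else 0) = total_cost \<T> Y n \<omega>"
      unfolding total_cost_def stage_cost_def
    proof (rule sum.cong[OF refl])
      fix k assume "k \<in> {1..n}"
      then have k: "1 \<le> k" by simp
      show "(\<Sum>i\<in>\<N> k. if i \<in> \<T> k \<omega> then Y i k True \<omega> - Y i k False \<omega> else 0) = (\<Sum>i\<in>\<T> k \<omega>. Y i k True \<omega> - Y i k False \<omega>)"
        by (rule sum.mono_neutral_cong_right[OF finite_units[OF k] assigned_subset[OF \<omega> k]]) auto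
    qed
  qed
  finally show ?thesis .
qed

definition excess :: "nat \<Rightarrow> 'a \<Rightarrow> real" where
  "excess t \<omega> = (if total_cost \<T> Y t \<omega> \<le> B then 1 else 0) - \<Delta> t \<omega>"

definition active :: "nat \<Rightarrow> 'a set" where
  "active t = {\<omega> \<in> space M. t \<le> T \<omega> \<and> 0 < size_fun t \<omega>}"

lemma active_F: assumes "1 \<le> t" shows "active t \<in> sets (F (t - 1))"
proof -
  have "size_fun t -` {0<..} \<inter> space (F (t - 1)) \<in> sets (F (t - 1))"
    by (rule measurable_sets[OF size_fun_F[OF assms]]) simp
  moreover have "active t = {\<omega> \<in> space M. t \<le> T \<omega>} \<inter> (size_fun t -` {0<..} \<inter> space (F (t - 1)))"
    by (auto simp: active_def)
  ultimately show ?thesis using running_F[OF assms] by auto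
qed

lemma excess_measurable: "1 \<le> t \<Longrightarrow> excess t \<in> borel_measurable M"
  unfolding excess_def[abs_def] using total_cost_measurable[of t] measurable_F_M[OF choices(1)[of t]] by measurable

text \<open>The product \<open>Q\<close> of the overview. The range ends in \<open>..<Suc t\<close>
  so that the product in \<open>algorithm_run\<close> at stage \<open>t + 1\<close> is literally
  \<open>survival t\<close>.\<close>

definition survival :: "nat \<Rightarrow> 'a \<Rightarrow> real" where "survival t \<omega> = (\<Prod>k=1..<Suc t. 1 - \<Delta> k \<omega>)"

lemma survival_0 [simp]: "survival 0 \<omega> = 1" by (simp add: survival_def)

lemma survival_Suc: "survival (Suc t) \<omega> = survival t \<omega> * (1 - \<Delta> (Suc t) \<omega>)"
  by (simp add: survival_def)

lemma budget:
  assumes \<omega>: "\<omega> \<in> space M" and t: "Suc t \<le> T \<omega>"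
  shows "0 \<le> \<Delta> (Suc t) \<omega>" and "\<Delta> (Suc t) \<omega> \<le> 1" and "1 - \<delta> \<le> survival (Suc t) \<omega>"
proof -
  note alg = algorithm_at(1,2)[OF \<omega> _ t, folded survival_def]
  have S: "1 - \<delta> < survival t \<omega>" using alg(1) by simp
  have S0: "0 < survival t \<omega>" using S \<delta> by linarith
  have D: "0 \<le> \<Delta> (Suc t) \<omega>" "\<Delta> (Suc t) \<omega> \<le> 1 - (1 - \<delta>) / survival t \<omega>"
    using alg(2) by simp_all
  show "0 \<le> \<Delta> (Suc t) \<omega>" by (rule D)
  have "0 \<le> (1 - \<delta>) / survival t \<omega>" using S0 \<delta> by simp
  then show "\<Delta> (Suc t) \<omega> \<le> 1" using D(2) by linarith
  have "(1 - \<delta>) / survival t \<omega> \<le> 1 - \<Delta> (Suc t) \<omega>" using D(2) by linarith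
  then show "1 - \<delta> \<le> survival (Suc t) \<omega>"
    unfolding survival_Suc using S0 by (simp add: pos_divide_le_eq mult.commute)
qed

lemma survival_ge: assumes "\<omega> \<in> space M" "t \<le> T \<omega>" shows "1 - \<delta> \<le> survival t \<omega>"
  using assms budget(3)[of \<omega> "t - 1"] \<delta> by (cases t) auto

text \<open>Up to a given stage there are finitely many histories, so \<open>G\<close> splits into
  pieces with a fixed history. On each piece \<open>excess\<close> is at most \<open>gap\<close> by
  the accepted test, and \<open>unconfounded\<close> makes the mean of \<open>gap\<close> over the
  piece vanish.\<close>

lemma excess_nonpos:
  assumes G: "G \<in> sets (F n)" and sub: "G \<subseteq> active (Suc n)"
  shows "(\<integral>\<omega>. excess (Suc n) \<omega> * indicator G \<omega> \<partial>M) \<le> 0"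
proof -
  \<comment> \<open>Extensional functions, so that every sample point follows exactly one history in
    \<open>A\<close>.\<close>
  define A where "A = PiE {1..Suc n} (\<lambda>k. Pow (\<N> k))"
  have finA: "finite A" unfolding A_def using finite_units by (intro finite_PiE) auto
  have GM: "G \<in> sets M" using G sets_F_sub[of n] by blast
  have hM: "history a (Suc n) \<in> sets M" for a using history_in_F[of a "Suc n"] sets_F_sub[of "Suc n"] by blast
  have part: "indicator G \<omega> = (\<Sum>a\<in>A. indicator (G \<inter> history a (Suc n)) \<omega> :: real)" if \<omega>: "\<omega> \<in> space M" for \<omega>
  proof -
    define a0 where "a0 = (\<lambda>k\<in>{1..Suc n}. \<T> k \<omega>)"
    have a0: "a0 \<in> A" using assigned_subset[OF \<omega>] by (auto simp: A_def a0_def)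
    have uniq: "a \<in> A \<Longrightarrow> \<omega> \<in> history a (Suc n) \<longleftrightarrow> a = a0" for a
    proof
      assume "a \<in> A" "\<omega> \<in> history a (Suc n)"
      then show "a = a0"
        unfolding A_def a0_def by (intro extensionalityI[of a "{1..Suc n}"]) (auto simp: history_def PiE_def)
    next
      assume "a = a0" then show "\<omega> \<in> history a (Suc n)" using \<omega> by (simp add: history_def a0_def)
    qed
    have "(\<Sum>a\<in>A. indicator (G \<inter> history a (Suc n)) \<omega> :: real) = (\<Sum>a\<in>A. if a = a0 then indicator G \<omega> else 0)"
      by (rule sum.cong) (auto simp: uniq split: split_indicator)
    then show ?thesis using finA a0 by (simp add: sum.delta')
  qed
  have exbd: "\<bar>excess (Suc n) \<omega>\<bar> \<le> 1" if "\<omega> \<in> G" for \<omega>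
  proof -
    have "\<omega> \<in> space M" "Suc n \<le> T \<omega>" using that sub by (auto simp: active_def)
    from budget[OF this] show ?thesis by (auto simp: excess_def)
  qed
  have int: "integrable M (\<lambda>\<omega>. excess (Suc n) \<omega> * indicator (G \<inter> history a (Suc n)) \<omega>)" for a
  proof (rule integrable_const_bound[where B=1])
    show "AE \<omega> in M. norm (excess (Suc n) \<omega> * indicator (G \<inter> history a (Suc n)) \<omega>) \<le> 1"
      using exbd by (intro AE_I2) (auto split: split_indicator)
    show "(\<lambda>\<omega>. excess (Suc n) \<omega> * indicator (G \<inter> history a (Suc n)) \<omega>) \<in> borel_measurable M"
      using GM hM excess_measurable[of "Suc n"] by (intro borel_measurable_times borel_measurable_indicator) auto
  qed
  have each: "(\<integral>\<omega>. excess (Suc n) \<omega> * indicator (G \<inter> history a (Suc n)) \<omega> \<partial>M) \<le> 0" if "a \<in> A" for a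
  proof (cases "card (a (Suc n)) = 0")
    case True
    \<comment> \<open>An active stage treats somebody, so a history with an empty new group does not
      meet \<open>G\<close>.\<close>
    have "G \<inter> history a (Suc n) = {}"
    proof (rule ccontr)
      assume "G \<inter> history a (Suc n) \<noteq> {}"
      then obtain \<omega> where \<omega>: "\<omega> \<in> G" "\<omega> \<in> history a (Suc n)" by blast
      then have "\<omega> \<in> space M" "Suc n \<le> T \<omega>" "0 < size_fun (Suc n) \<omega>" "\<T> (Suc n) \<omega> = a (Suc n)"
        using sub by (auto simp: active_def history_def)
      then show False using True card_assigned[of \<omega> "Suc n"] algorithm_at(4)[of \<omega> "Suc n"] by simp
    qed
    then show ?thesis by simp
  next
    case False
    have a: "\<And>k. k \<in> {1..Suc n} \<Longrightarrow> a k \<subseteq> \<N> k" using that unfolding A_def by blast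
    \<comment> \<open>\<open>G\<close> is decided before stage \<open>n + 1\<close>, so it is traced
      on the history through \<open>n\<close> and becomes an event on the data of the first
      \<open>n\<close> stages.\<close>
    obtain E where E: "E \<in> sets (data_space n)" "G \<inter> history a n = {\<omega> \<in> space M. data a n \<omega> \<in> E} \<inter> history a n"
      using trace_F[OF G order_refl] by blast
    have gint: "integrable M (\<lambda>\<omega>. gap a n \<omega> * indicator (G \<inter> history a (Suc n)) \<omega>)"
    proof (rule integrable_const_bound[where B=1])
      show "AE \<omega> in M. norm (gap a n \<omega> * indicator (G \<inter> history a (Suc n)) \<omega>) \<le> 1"
        using abs_gap[of a n] by (intro AE_I2) (auto split: split_indicator)
      show "(\<lambda>\<omega>. gap a n \<omega> * indicator (G \<inter> history a (Suc n)) \<omega>) \<in> borel_measurable M"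
        using GM hM measurable_potential_M[OF gap_potential[OF a]] by (intro borel_measurable_times borel_measurable_indicator) auto
    qed
    have "(\<integral>\<omega>. excess (Suc n) \<omega> * indicator (G \<inter> history a (Suc n)) \<omega> \<partial>M) \<le>
        (\<integral>\<omega>. gap a n \<omega> * indicator (G \<inter> history a (Suc n)) \<omega> \<partial>M)"
    proof (rule integral_mono[OF int gint])
      fix \<omega>
      show "excess (Suc n) \<omega> * indicator (G \<inter> history a (Suc n)) \<omega> \<le> gap a n \<omega> * indicator (G \<inter> history a (Suc n)) \<omega>"
      proof (cases "\<omega> \<in> G \<inter> history a (Suc n)")
        case True
        then have h: "\<omega> \<in> history a (Suc n)" and r: "Suc n \<le> T \<omega>" "0 < size_fun (Suc n) \<omega>"
          using sub by (auto simp: active_def)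
        show ?thesis
          using on_history(1)[OF a h] Phi_threshold_le[OF a h r] True by (simp add: excess_def)
      qed simp
    qed
    also have "\<dots> = (\<integral>\<omega>. gap a n \<omega> * indicator (history a (Suc n) \<inter> {\<omega> \<in> space M. Suc n \<le> T \<omega>}) \<omega> * indicator E (data a n \<omega>) \<partial>M)"
    proof (rule Bochner_Integration.integral_cong[OF refl])
      fix \<omega> assume \<omega>: "\<omega> \<in> space M"
      have "\<omega> \<in> history a (Suc n) \<Longrightarrow> \<omega> \<in> history a n" using history_mono[of n "Suc n" a] by auto
      then have "\<omega> \<in> history a (Suc n) \<Longrightarrow> \<omega> \<in> G \<longleftrightarrow> data a n \<omega> \<in> E" using E(2) \<omega> by blast
      moreover have "\<omega> \<in> G \<Longrightarrow> Suc n \<le> T \<omega>" using sub by (auto simp: active_def)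
      ultimately show "gap a n \<omega> * indicator (G \<inter> history a (Suc n)) \<omega> =
        gap a n \<omega> * indicator (history a (Suc n) \<inter> {\<omega> \<in> space M. Suc n \<le> T \<omega>}) \<omega> * indicator E (data a n \<omega>)"
        using \<omega> by (auto split: split_indicator)
    qed
    also have "\<dots> = 0"
      using False by (intro unconfounded[where c=1, OF gap_potential[OF a] abs_gap a gap_zero[OF a] order_refl E(1)]) auto
    finally show ?thesis .
  qed
  have "(\<integral>\<omega>. excess (Suc n) \<omega> * indicator G \<omega> \<partial>M) =
      (\<integral>\<omega>. (\<Sum>a\<in>A. excess (Suc n) \<omega> * indicator (G \<inter> history a (Suc n)) \<omega>) \<partial>M)"
    by (rule Bochner_Integration.integral_cong[OF refl]) (simp only: part sum_distrib_left)
  also have "\<dots> = (\<Sum>a\<in>A. \<integral>\<omega>. excess (Suc n) \<omega> * indicator (G \<inter> history a (Suc n)) \<omega> \<partial>M)"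
    using int by (intro Bochner_Integration.integral_sum)
  also have "\<dots> \<le> 0" using each by (rule sum_nonpos)
  finally show ?thesis .
qed

section \<open>The stopped process and its mean\<close>

definition reserve :: "nat \<Rightarrow> 'a \<Rightarrow> real" where
  "reserve t \<omega> = (if B < total_cost \<T> Y t \<omega> then 1 else 0) / survival t \<omega>"

definition stopped :: "nat \<Rightarrow> 'a \<Rightarrow> nat" where "stopped n \<omega> = min (T \<omega>) n"

text \<open>\<open>\<Delta> t\<close> is chosen before stage \<open>t\<close>, so the product
  including it is known at \<open>t - 1\<close>. This predictability lets
  \<open>1 / survival\<close> serve as a weight for stage \<open>t\<close>.\<close>

lemma survival_F: "survival t \<in> borel_measurable (F (t - 1))"
  unfolding survival_def[abs_def]
  by (intro borel_measurable_prod borel_measurable_diff borel_measurable_const)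
     (auto intro!: measurable_F_mono[OF _ choices(1)])

lemma reserve_measurable: "reserve t \<in> borel_measurable M"
  unfolding reserve_def[abs_def]
  using total_cost_measurable[of t] measurable_F_M[OF survival_F[of t]] by measurable

lemma measurable_stopped: "stopped n \<in> measurable M (count_space UNIV)"
  unfolding stopped_def[abs_def] by (rule measurable_compose[OF measurable_stop]) simp

lemma reserve_bound: "\<omega> \<in> space M \<Longrightarrow> t \<le> T \<omega> \<Longrightarrow> 0 \<le> reserve t \<omega> \<and> reserve t \<omega> \<le> 1 / (1 - \<delta>)"
  using survival_ge[of \<omega> t] \<delta> by (auto simp: reserve_def intro!: divide_left_mono frac_le)

lemma integrable_reserve: "integrable M (\<lambda>\<omega>. reserve (stopped n \<omega>) \<omega>)"
proof (rule integrable_const_bound[where B="1 / (1 - \<delta>)"])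
  show "AE \<omega> in M. norm (reserve (stopped n \<omega>) \<omega>) \<le> 1 / (1 - \<delta>)"
    using reserve_bound by (intro AE_I2) (auto simp: stopped_def)
  show "(\<lambda>\<omega>. reserve (stopped n \<omega>) \<omega>) \<in> borel_measurable M"
    by (rule measurable_compose_countable[OF reserve_measurable measurable_stopped])
qed

text \<open>Each increment is at least \<open>- h * f\<close>, where \<open>f\<close> is the excess
  on active stages and \<open>h\<close> the weight \<open>1 / survival\<close>, set to zero after
  stopping; the mean of \<open>h * f\<close> is nonpositive. The start is 1 because the empty cost
  \<open>0\<close> exceeds \<open>B\<close>.\<close>

lemma expectation_reserve: "1 \<le> (\<integral>\<omega>. reserve (stopped n \<omega>) \<omega> \<partial>M)"
proof (induction n)
  case 0
  have "(\<integral>\<omega>. reserve (stopped 0 \<omega>) \<omega> \<partial>M) = (\<integral>\<omega>. 1 \<partial>M)"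
    using B by (intro Bochner_Integration.integral_cong) (auto simp: reserve_def stopped_def total_cost_def)
  then show ?case by (simp add: prob_space)
next
  case (Suc n)
  define h where "h \<omega> = (if Suc n \<le> T \<omega> then 1 / survival (Suc n) \<omega> else 0)" for \<omega>
  define f where "f \<omega> = excess (Suc n) \<omega> * indicator (active (Suc n)) \<omega>" for \<omega>
  have aF: "active (Suc n) \<in> sets (F n)" using active_F[of "Suc n"] by simp
  have aM: "active (Suc n) \<in> sets M" using aF sets_F_sub[of n] by blast
  have hF: "h \<in> borel_measurable (F n)"
    unfolding h_def[abs_def] using survival_F[of "Suc n"] running_F[of "Suc n"]
    by (intro measurable_If borel_measurable_divide borel_measurable_const) auto
  have h0: "0 \<le> h \<omega>" and h1: "h \<omega> \<le> 1 / (1 - \<delta>)" if "\<omega> \<in> space M" for \<omega>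
    using survival_ge[OF that, of "Suc n"] \<delta> by (auto simp: h_def intro!: divide_left_mono)
  have intf: "integrable M f"
  proof (rule integrable_const_bound[where B=1])
    show "AE \<omega> in M. norm (f \<omega>) \<le> 1"
      using budget by (intro AE_I2) (auto simp: f_def excess_def active_def split: split_indicator)
    show "f \<in> borel_measurable M"
      unfolding f_def[abs_def] using aM excess_measurable[of "Suc n"]
      by (intro borel_measurable_times borel_measurable_indicator) auto
  qed
  have hf: "(\<integral>\<omega>. h \<omega> * f \<omega> \<partial>M) \<le> 0"
  proof (rule integral_mult_nonpos_of_set_integral_nonpos[OF finite_measure_subalgebra_F intf _ hF h0 h1])
    fix G assume G: "G \<in> sets (F n)"
    have "f \<omega> * indicator G \<omega> = excess (Suc n) \<omega> * indicator (active (Suc n) \<inter> G) \<omega>" for \<omega>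
      by (simp add: f_def indicator_inter_arith)
    then show "(\<integral>\<omega>. f \<omega> * indicator G \<omega> \<partial>M) \<le> 0"
      using excess_nonpos[of "active (Suc n) \<inter> G" n] G aF by auto
  qed
  have inthf: "integrable M (\<lambda>\<omega>. h \<omega> * f \<omega>)"
  proof (rule integrable_const_bound[where B="1 / (1 - \<delta>)"])
    show "AE \<omega> in M. norm (h \<omega> * f \<omega>) \<le> 1 / (1 - \<delta>)"
    proof (rule AE_I2)
      fix \<omega> assume \<omega>: "\<omega> \<in> space M"
      have "\<bar>f \<omega>\<bar> \<le> 1" using budget[OF \<omega>, of n] by (auto simp: f_def excess_def active_def split: split_indicator)
      then have "\<bar>h \<omega>\<bar> * \<bar>f \<omega>\<bar> \<le> 1 / (1 - \<delta>) * 1" using h0[OF \<omega>] h1[OF \<omega>] \<delta> by (intro mult_mono) auto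
      then show "norm (h \<omega> * f \<omega>) \<le> 1 / (1 - \<delta>)" by (simp add: abs_mult)
    qed
    show "(\<lambda>\<omega>. h \<omega> * f \<omega>) \<in> borel_measurable M"
      using measurable_F_M[OF hF] intf by measurable
  qed
  have step: "reserve (stopped n \<omega>) \<omega> - h \<omega> * f \<omega> \<le> reserve (stopped (Suc n) \<omega>) \<omega>" if \<omega>: "\<omega> \<in> space M" for \<omega>
  proof (cases "Suc n \<le> T \<omega>")
    case False
    then have "stopped (Suc n) \<omega> = stopped n \<omega>" by (simp add: stopped_def)
    then show ?thesis using False by (simp add: h_def)
  next
    case True
    then have st: "stopped (Suc n) \<omega> = Suc n" "stopped n \<omega> = n" by (auto simp: stopped_def)
    note bud = budget[OF \<omega> True]
    have S: "0 < survival n \<omega>" using survival_ge[OF \<omega>, of n] True \<delta> by simp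
    have S': "0 < survival (Suc n) \<omega>" using bud(3) \<delta> by simp
    show ?thesis
    proof (cases "\<omega> \<in> active (Suc n)")
      case True
      \<comment> \<open>Earlier ruin cannot be used, so the old indicator is replaced by 1. The last
        equality of the chain holds because \<open>excess\<close> and the new indicator add up to
        \<open>1 - \<Delta>\<close>.\<close>
      have "reserve n \<omega> \<le> 1 / survival n \<omega>" using S by (simp add: reserve_def)
      also have "\<dots> = (1 - \<Delta> (Suc n) \<omega>) / survival (Suc n) \<omega>"
      proof -
        have "1 - \<Delta> (Suc n) \<omega> \<noteq> 0" using S' by (auto simp: survival_Suc)
        then show ?thesis by (simp add: survival_Suc)
      qed
      also have "\<dots> = h \<omega> * f \<omega> + reserve (Suc n) \<omega>"
        using True \<open>Suc n \<le> T \<omega>\<close> S' by (auto simp: h_def f_def excess_def reserve_def field_simps)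
      finally show ?thesis unfolding st by simp
    next
      case False
      then have "size_fun (Suc n) \<omega> = 0" using \<omega> True by (simp add: active_def)
      then have "card (\<T> (Suc n) \<omega>) = 0"
        using card_assigned[OF \<omega> _ True] algorithm_at(4)[OF \<omega> _ True] by simp
      then have "\<T> (Suc n) \<omega> = {}" using finite_assigned[OF \<omega>, of "Suc n"] by simp
      then have "total_cost \<T> Y (Suc n) \<omega> = total_cost \<T> Y n \<omega>"
        by (simp add: total_cost_def stage_cost_def)
      moreover have "survival (Suc n) \<omega> \<le> survival n \<omega>"
        unfolding survival_Suc using S bud by (simp add: mult_left_le)
      ultimately have "reserve n \<omega> \<le> reserve (Suc n) \<omega>"
        using S S' by (simp add: reserve_def frac_le)
      then show ?thesis using False unfolding st by (simp add: f_def)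
    qed
  qed
  have "1 \<le> (\<integral>\<omega>. reserve (stopped n \<omega>) \<omega> \<partial>M) - (\<integral>\<omega>. h \<omega> * f \<omega> \<partial>M)"
    using Suc.IH hf by simp
  also have "\<dots> = (\<integral>\<omega>. reserve (stopped n \<omega>) \<omega> - h \<omega> * f \<omega> \<partial>M)"
    by (rule Bochner_Integration.integral_diff[symmetric, OF integrable_reserve inthf])
  also have "\<dots> \<le> (\<integral>\<omega>. reserve (stopped (Suc n) \<omega>) \<omega> \<partial>M)"
    by (intro integral_mono Bochner_Integration.integrable_diff integrable_reserve inthf step)
  finally show ?case .
qed

text \<open>At a stopped time \<open>survival\<close> is at least \<open>1 - \<delta>\<close>, so
  the process is at most the indicator of no ruin divided by \<open>1 - \<delta>\<close>; comparing
  means gives the bound.\<close>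

lemma prob_stopped: "1 - \<delta> \<le> prob {\<omega> \<in> space M. B < total_cost \<T> Y (stopped n \<omega>) \<omega>}"
proof -
  let ?G = "{\<omega> \<in> space M. B < total_cost \<T> Y (stopped n \<omega>) \<omega>}"
  have [measurable]: "(\<lambda>\<omega>. total_cost \<T> Y (stopped n \<omega>) \<omega>) \<in> borel_measurable M"
    by (rule measurable_compose_countable[OF total_cost_measurable measurable_stopped])
  have G: "?G \<in> sets M" by measurable
  have "1 \<le> (\<integral>\<omega>. reserve (stopped n \<omega>) \<omega> \<partial>M)" by (rule expectation_reserve)
  also have "\<dots> \<le> (\<integral>\<omega>. indicator ?G \<omega> / (1 - \<delta>) \<partial>M)"
  proof (rule integral_mono[OF integrable_reserve])
    show "integrable M (\<lambda>\<omega>. indicator ?G \<omega> / (1 - \<delta>))"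
      using G by (intro Bochner_Integration.integrable_divide) (auto simp: emeasure_eq_measure)
    show "reserve (stopped n \<omega>) \<omega> \<le> indicator ?G \<omega> / (1 - \<delta>)" if "\<omega> \<in> space M" for \<omega>
      using that reserve_bound[OF that, of "stopped n \<omega>"] by (auto simp: reserve_def stopped_def)
  qed
  also have "\<dots> = prob ?G / (1 - \<delta>)" using G by simp
  finally show ?thesis using \<delta> by (simp add: pos_le_divide_eq)
qed

theorem risk_of_ruin_constrained: "RRC M \<T> Y T \<delta> B"
proof -
  let ?G = "{\<omega> \<in> space M. B < total_cost \<T> Y (T \<omega>) \<omega>}"
  have [measurable]: "(\<lambda>\<omega>. total_cost \<T> Y (T \<omega>) \<omega>) \<in> borel_measurable M"
    by (rule measurable_compose_countable[OF total_cost_measurable measurable_stop])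
  have G: "?G \<in> sets M" by measurable
  \<comment> \<open>\<open>T\<close> is finite at every sample point but need not be bounded: the
    runs longer than \<open>n\<close> form events that decrease to the empty set, and they are
    charged as an error.\<close>
  define L where "L n = {\<omega> \<in> space M. n < T \<omega>}" for n
  have L: "L n \<in> sets M" for n
    unfolding L_def by measurable
  have "(\<lambda>n. prob (L n)) \<longlonglongrightarrow> prob (\<Inter>n. L n)"
    using L by (intro finite_Lim_measure_decseq) (auto simp: decseq_def L_def)
  moreover have "(\<Inter>n. L n) = {}" by (auto simp: L_def)
  ultimately have "(\<lambda>n. prob ?G + prob (L n)) \<longlonglongrightarrow> prob ?G + 0"
    by (intro tendsto_add tendsto_const) simp
  moreover have "1 - \<delta> \<le> prob ?G + prob (L n)" for n
  proof -
    have "1 - \<delta> \<le> prob {\<omega> \<in> space M. B < total_cost \<T> Y (stopped n \<omega>) \<omega>}" by (rule prob_stopped)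
    also have "\<dots> \<le> prob (?G \<union> L n)"
      using G L[of n] by (intro finite_measure_mono) (auto simp: stopped_def L_def min_def)
    also have "\<dots> \<le> prob ?G + prob (L n)"
      using G L[of n] by (intro measure_Un_le)
    finally show ?thesis .
  qed
  ultimately have "1 - \<delta> \<le> prob ?G + 0"
    by (intro LIMSEQ_le_const) auto
  then show ?thesis by (simp add: RRC_def)
qed

end

theorem theorem3p2:
  fixes M :: "'a measure"
    and \<N> :: "nat \<Rightarrow> 'u set"
    and \<mu>0 \<sigma>0 \<sigma> :: "bool \<Rightarrow> real"
    and \<theta> :: "bool \<Rightarrow> 'a \<Rightarrow> real"
    and Y :: "'u \<Rightarrow> nat \<Rightarrow> bool \<Rightarrow> 'a \<Rightarrow> real"
    and \<Delta> b :: "nat \<Rightarrow> 'a \<Rightarrow> real"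
    and m :: "nat \<Rightarrow> 'a \<Rightarrow> nat"
    and \<T> :: "nat \<Rightarrow> 'a \<Rightarrow> 'u set"
    and T :: "'a \<Rightarrow> nat"
    and B \<delta> :: real
  assumes "B < 0" and "0 \<le> \<delta>" and "\<delta> < 1"
    and "prob_space M"
    and "\<And>t. 1 \<le> t \<Longrightarrow> finite (\<N> t)"
    and "\<And>w. \<sigma>0 w > 0" and "\<And>w. \<sigma> w > 0"
    and model: "conjugate_gaussian_model M \<N> \<mu>0 \<sigma>0 \<sigma> \<theta> Y"
    and assignment: "random_assignment M \<N> \<theta> Y m \<T> T"
    and stop: "stopping_time (observed M \<N> \<T> Y) T"
    and choices: "\<And>t. 1 \<le> t \<Longrightarrow> \<Delta> t \<in> borel_measurable (observed M \<N> \<T> Y (t - 1))"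
      "\<And>t. 1 \<le> t \<Longrightarrow> b t \<in> borel_measurable (observed M \<N> \<T> Y (t - 1))"
    and algorithm: "\<And>\<omega>. \<omega> \<in> space M \<Longrightarrow>
      algorithm_run B \<delta> \<mu>0 \<sigma>0 \<sigma> (\<lambda>t. card (\<N> t)) (\<lambda>t. \<Delta> t \<omega>) (\<lambda>t. b t \<omega>) (\<lambda>t. m t \<omega>)
        (\<lambda>w t. observed_sum \<N> \<T> Y w t \<omega>) (T \<omega>)"
  shows "RRC M \<T> Y T \<delta> B"
proof -
  interpret rrc_experiment M \<N> \<mu>0 \<sigma>0 \<sigma> \<theta> Y \<Delta> b m \<T> T B \<delta>
    using assms by (intro rrc_experiment.intro gaussian_experiment.intro
        gaussian_experiment_axioms.intro rrc_experiment_axioms.intro)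
  show ?thesis by (rule risk_of_ruin_constrained)
qed

end
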